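(* Suppose that the Regularity assumption, the Oracle assumption and the Parameter assumption of the context hold. Fix an integer $K\ge2$ and $\delta\in(0,1)$, set $B=K$, $Q=\lceil\sqrt K\rceil$, $b=\max\{1,\lceil2D_1L_s^2Q\rceil\}$, and let $\mathcal X_\delta\subseteq\mathbb R^n$ be a known Borel set with an exact membership test such that $$x_0\in\mathcal X_\delta,\qquad \mathcal S_{\mathrm{st}}(\delta)\subseteq\mathcal X_\delta,\qquad \mathcal N_\Delta(\mathcal X_\delta)\subset\mathcal U .$$ Consider the restart procedure of the context, let $T$ be the number of attempts, $N_{\mathrm{grad}}$ the total stochastic-gradient count over all attempts, and $(x_{\widehat k+1},\lambda_{\widehat k+1})$ the returned pair, with $\mathcal R_{\widehat k+1}=\mathcal R(x_{\widehat k+1},\lambda_{\widehat k+1})$. The procedure terminates almost surely and $$\mathbb E[T]\le\frac1{1-\delta},\qquad \mathbb E[\mathcal R_{\widehat k+1}^2]\le\frac{C_{\mathrm{st}}}{(1-\delta)(K-1)},\qquad \mathbb E[N_{\mathrm{grad}}]\le\frac{\lceil K/Q\rceil B+2Kb}{1-\delta}.$$ The expected numbers of deterministic constraint/Jacobian evaluations, exact linear-system solves, and membership tests for $\mathcal X_\delta$ are each $\mathcal O(K/(1-\delta))$.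
   Context: Norms are Euclidean for vectors and spectral for matrices; for $f:\mathbb R^n\to\mathbb R$, $c:\mathbb R^n\to\mathbb R^m$, $\nabla c(x):=(\nabla c_1(x),\ldots,\nabla c_m(x))\in\mathbb R^{n\times m}$. All random variables are assumed measurable. $\mathcal N_r(S):=\{y\in\mathbb R^n:\operatorname{dist}(y,S)\le r\}$. The KKT residual is $\mathcal R(x,\lambda):=(\|\nabla f(x)+\nabla c(x)\lambda\|^2+\|c(x)\|^2)^{1/2}$. Regularity assumption: $f$ and $c$ are continuously differentiable on a nonempty open set $\mathcal U\subseteq\mathbb R^n$, and there are $\underline f\in\mathbb R$ and positive constants $G,L_f,M,L_c,\sigma$ such that for all $x,y\in\mathcal U$ and $u\in\mathbb R^m$: (i) $f(x)\ge\underline f$, $\|\nabla f(x)\|\le G$, $\|\nabla f(x)-\nabla f(y)\|\le L_f\|x-y\|$; (ii) $\|\nabla c(x)\|\le M$, $\|\nabla c(x)-\nabla c(y)\|\le L_c\|x-y\|$; (iii) $\|\nabla c(x)u\|\ge\sigma\|u\|$. Oracle assumption: $f(x)=\mathbb E[F(x;\xi)]$ for $x\in\mathcal U$; for almost every $\xi$, $F(\cdot;\xi)$ is differentiable on $\mathcal U$; and there are $\sigma_f,L_s\ge0$ such that for all $x,y\in\mathcal U$: (i) $\mathbb E[\nabla F(x;\xi)]=\nabla f(x)$ and $\mathbb E\|\nabla F(x;\xi)-\nabla f(x)\|^2\le\sigma_f^2$; (ii) $\mathbb E\|\nabla F(x;\xi)-\nabla F(y;\xi)\|^2\le L_s^2\|x-y\|^2$.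 Constants: $\kappa_{\mathrm{lin}}:=L_c/2$ and, for $\beta,\rho,\Delta,\Lambda>0$, $$C_{\mathrm{mod}}:=\frac{L_f}{2}+\kappa_{\mathrm{lin}}(3\Lambda+\rho M\Delta)+\frac{\rho}{2}\kappa_{\mathrm{lin}}^2\Delta^2,\quad A_p:=\beta+\rho M\kappa_{\mathrm{lin}}\Delta,\quad B_p:=A_p+L_f+L_c\Lambda,\quad C_{\lambda,p}:=\frac{4}{\sigma^2}\max\{A_p^2,B_p^2\},$$ $$C_{\lambda,e}:=\frac4{\sigma^2},\quad C_e^\star:=\frac2\beta+\frac{C_{\lambda,e}}\rho,\quad C_s:=\beta+\rho M\kappa_{\mathrm{lin}}\Delta+L_f+L_c\Lambda,$$ $$\overline\Phi_1:=f(x_0)+G\Delta+\frac{4\Lambda^2}{\rho}+\frac{C_{\lambda,p}}{\rho}\Delta^2,\quad \underline\Phi:=\underline f-\frac{\Lambda^2}{2\rho},\quad D_0:=\Delta^2+\frac{4(\overline\Phi_1-\underline\Phi)}{\beta},\quad D_1:=\frac{8C_e^\star}{\beta},$$ $$C_R^{\mathrm{st}}:=\max\left\{2C_s^2+\frac{C_{\lambda,p}}{\rho^2},2+\frac{C_{\lambda,e}}{\rho^2}\right\},\quad \Gamma_e:=2\sigma_f^2+\frac{D_0}{D_1},\quad \Gamma_p:=2D_1\sigma_f^2+2D_0,\quad C_{\mathrm{st}}:=2C_R^{\mathrm{st}}(\Gamma_p+\Gamma_e),$$ $$H_{\mathrm{det}}:=\overline\Phi_1+\frac{\Lambda^2}{2\rho},\quad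 H_{\mathrm{st}}(\delta):=H_{\mathrm{det}}+\frac{2C_e^\star\Gamma_e}{\delta},\quad \mathcal S_{\mathrm{st}}(\delta):=\{x\in\mathbb R^n:f(x)\le H_{\mathrm{st}}(\delta),\ \|c(x)\|\le2\Lambda/\rho\}.$$ Parameter assumption: the fixed constants $\beta,\rho,\Delta,\Lambda>0$ satisfy $$\Lambda\ge\frac{G+\beta\Delta+\rho M\kappa_{\mathrm{lin}}\Delta^2}{\sigma},\quad \frac{G}{\beta}+\frac{3M\Lambda}{\beta+\rho\sigma^2}\le\Delta,\quad C_{\mathrm{mod}}\le\frac{3\beta}{8},\quad \rho\ge\frac{8C_{\lambda,p}}{\beta},$$ and the initial pair satisfies $\|\lambda_0\|\le\Lambda$ and $\rho\|c(x_0)\|\le\Lambda$. Stochastic NR-LALM with projected SPIDER (positive integers $Q,B,b$): start from $(x_0,\lambda_0)$. Let $\mathcal G_k$ be the $\sigma$-algebra generated by the algorithmic history before the $k$th batch is sampled. At iteration $k$, draw a batch $\{\xi_{k,i}\}$ of independent copies of $\xi$, independent of $\mathcal G_k$, of size $B$ if $k\equiv0\pmod Q$ and of size $b$ otherwise, and set $$h_k=\begin{cases}\frac1B\sum_{i=1}^B\nabla F(x_k;\xi_{k,i}),&k\equiv0\pmod Q,\\ h_{k-1}+\frac1b\sum_{i=1}^b[\nabla F(x_k;\xi_{k,i})-\nabla F(x_{k-1};\xi_{k,i})],&\text{otherwise},\end{cases}$$ $v_k:=\operatorname{Proj}_{\{w:\|w\|\le G\}}(h_k)$. Then $p_k$ solves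 $(\beta I_n+\rho\nabla c(x_k)\nabla c(x_k)^\top)p_k=-v_k-\nabla c(x_k)(\lambda_k+\rho c(x_k))$, and $x_{k+1}=x_k+p_k$, $\lambda_{k+1}=\lambda_k+\rho c(x_{k+1})$. Restart procedure: an attempt runs stochastic NR-LALM with projected SPIDER (the recursion generating $h_k,v_k,p_k,x_{k+1},\lambda_{k+1}$) from $(x_0,\lambda_0)$ while the current iterate lies in $\mathcal X_\delta$; it stops (no further oracle calls) at the exit time $\tau_{\mathrm{ex}}:=\inf\{k\ge1:x_k\notin\mathcal X_\delta\}$ if $\tau_{\mathrm{ex}}\le K$, and is accepted if $\tau_{\mathrm{ex}}>K$, i.e. it completes $K$ steps without exit. After each exit, restart from $(x_0,\lambda_0)$ with fresh independent oracle samples. From the first accepted attempt, draw $\widehat k$ independently and uniformly from $\{1,\ldots,K-1\}$ and return that attempt's pair $(x_{\widehat k+1},\lambda_{\widehat k+1})$. Cost accounting: an executed iteration with $k\equiv0\pmod Q$ costs $B$ stochastic-gradient evaluations, any other executed iteration costs $2b$; besides the initial evaluation of $c(x_0)$, each iteration uses one evaluation of $\nabla c(x_k)$, one of $c(x_{k+1})$, one linear-system solve, and one membership test. The implied constant in $\mathcal O(K/(1-\delta))$ does not depend on $K$ or $\delta$. *)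

theory Defs
  imports "HOL-Probability.Probability"
begin

text \<open>Gradients, transposed Jacobians and the KKT residual. The norm of the type of matrices
  is the Frobenius norm, so the spectral norm is written as an operator norm.\<close>

definition grad :: "(real^'n \<Rightarrow> real) \<Rightarrow> real^'n \<Rightarrow> real^'n" where
  "grad f x = (THE g. GDERIV f x :> g)"

definition grad_cols :: "(real^'n \<Rightarrow> real^'m) \<Rightarrow> real^'n \<Rightarrow> real^'m^'n" where
  "grad_cols c x = (\<chi> i j. grad (\<lambda>y. c y $ j) x $ i)"

definition spec_norm :: "real^'m^'n \<Rightarrow> real" where
  "spec_norm A = onorm (\<lambda>u. A *v u)"

definition kkt_residual :: "(real^'n \<Rightarrow> real) \<Rightarrow> (real^'n \<Rightarrow> real^'m) \<Rightarrow> real^'n \<Rightarrow> real^'m \<Rightarrow> real" where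
  "kkt_residual f c x l = sqrt ((norm (grad f x + grad_cols c x *v l))\<^sup>2 + (norm (c x))\<^sup>2)"

definition nbhd :: "real \<Rightarrow> (real^'n) set \<Rightarrow> (real^'n) set" where
  "nbhd r S = {y. infdist y S \<le> r}"


text \<open>The scalar constants: \<open>f_low\<close> is the lower bound of the objective; \<open>G_f\<close>, \<open>L_f\<close>, \<open>M_c\<close>,
  \<open>L_c\<close>, \<open>sig_c\<close> are the regularity constants $G, L_f, M, L_c, \sigma$; \<open>sig_f\<close>, \<open>L_s\<close> are the
  oracle constants; the last four are $\beta, \rho, \Delta, \Lambda$.\<close>

record consts_rec =
  f_low :: real
  G_f :: real
  L_f :: real
  M_c :: real
  L_c :: real
  sig_c :: real
  sig_f :: real
  L_s :: real
  beta_p :: real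
  rho_p :: real
  Delta_p :: real
  Lambda_p :: real

definition kappa_lin :: "consts_rec \<Rightarrow> real" where
  "kappa_lin q = L_c q / 2"

definition C_mod :: "consts_rec \<Rightarrow> real" where
  "C_mod q = L_f q / 2 + kappa_lin q * (3 * Lambda_p q + rho_p q * M_c q * Delta_p q)
     + rho_p q / 2 * (kappa_lin q)\<^sup>2 * (Delta_p q)\<^sup>2"

definition A_p :: "consts_rec \<Rightarrow> real" where
  "A_p q = beta_p q + rho_p q * M_c q * kappa_lin q * Delta_p q"

definition B_p :: "consts_rec \<Rightarrow> real" where
  "B_p q = A_p q + L_f q + L_c q * Lambda_p q"

definition C_lam_p :: "consts_rec \<Rightarrow> real" where
  "C_lam_p q = 4 / (sig_c q)\<^sup>2 * max ((A_p q)\<^sup>2) ((B_p q)\<^sup>2)"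

definition C_lam_e :: "consts_rec \<Rightarrow> real" where
  "C_lam_e q = 4 / (sig_c q)\<^sup>2"

definition C_e_star :: "consts_rec \<Rightarrow> real" where
  "C_e_star q = 2 / beta_p q + C_lam_e q / rho_p q"

definition C_s :: "consts_rec \<Rightarrow> real" where
  "C_s q = beta_p q + rho_p q * M_c q * kappa_lin q * Delta_p q + L_f q + L_c q * Lambda_p q"

definition Phi_up :: "consts_rec \<Rightarrow> (real^'n \<Rightarrow> real) \<Rightarrow> real^'n \<Rightarrow> real" where
  "Phi_up q f x0 = f x0 + G_f q * Delta_p q + 4 * (Lambda_p q)\<^sup>2 / rho_p q
     + C_lam_p q / rho_p q * (Delta_p q)\<^sup>2"

definition Phi_low :: "consts_rec \<Rightarrow> real" where
  "Phi_low q = f_low q - (Lambda_p q)\<^sup>2 / (2 * rho_p q)"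

definition D_0 :: "consts_rec \<Rightarrow> (real^'n \<Rightarrow> real) \<Rightarrow> real^'n \<Rightarrow> real" where
  "D_0 q f x0 = (Delta_p q)\<^sup>2 + 4 * (Phi_up q f x0 - Phi_low q) / beta_p q"

definition D_1 :: "consts_rec \<Rightarrow> real" where
  "D_1 q = 8 * C_e_star q / beta_p q"

definition C_R_st :: "consts_rec \<Rightarrow> real" where
  "C_R_st q = max (2 * (C_s q)\<^sup>2 + C_lam_p q / (rho_p q)\<^sup>2) (2 + C_lam_e q / (rho_p q)\<^sup>2)"

definition Gamma_e :: "consts_rec \<Rightarrow> (real^'n \<Rightarrow> real) \<Rightarrow> real^'n \<Rightarrow> real" where
  "Gamma_e q f x0 = 2 * (sig_f q)\<^sup>2 + D_0 q f x0 / D_1 q"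

definition Gamma_p :: "consts_rec \<Rightarrow> (real^'n \<Rightarrow> real) \<Rightarrow> real^'n \<Rightarrow> real" where
  "Gamma_p q f x0 = 2 * D_1 q * (sig_f q)\<^sup>2 + 2 * D_0 q f x0"

definition C_st :: "consts_rec \<Rightarrow> (real^'n \<Rightarrow> real) \<Rightarrow> real^'n \<Rightarrow> real" where
  "C_st q f x0 = 2 * C_R_st q * (Gamma_p q f x0 + Gamma_e q f x0)"

definition H_det :: "consts_rec \<Rightarrow> (real^'n \<Rightarrow> real) \<Rightarrow> real^'n \<Rightarrow> real" where
  "H_det q f x0 = Phi_up q f x0 + (Lambda_p q)\<^sup>2 / (2 * rho_p q)"

definition H_st :: "consts_rec \<Rightarrow> (real^'n \<Rightarrow> real) \<Rightarrow> real^'n \<Rightarrow> real \<Rightarrow> real" where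
  "H_st q f x0 \<delta> = H_det q f x0 + 2 * C_e_star q * Gamma_e q f x0 / \<delta>"

definition S_st :: "consts_rec \<Rightarrow> (real^'n \<Rightarrow> real) \<Rightarrow> (real^'n \<Rightarrow> real^'m) \<Rightarrow> real^'n \<Rightarrow> real \<Rightarrow> (real^'n) set" where
  "S_st q f c x0 \<delta> = {x. f x \<le> H_st q f x0 \<delta> \<and> norm (c x) \<le> 2 * Lambda_p q / rho_p q}"


definition regularity ::
  "consts_rec \<Rightarrow> (real^'n) set \<Rightarrow> (real^'n \<Rightarrow> real) \<Rightarrow> (real^'n \<Rightarrow> real^'m) \<Rightarrow> bool" where
  "regularity q U f c \<longleftrightarrow>
     open U \<and> U \<noteq> {} \<and>
     (\<forall>x\<in>U. f differentiable (at x)) \<and> continuous_on U (grad f) \<and>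
     (\<forall>x\<in>U. c differentiable (at x)) \<and> continuous_on U (grad_cols c) \<and>
     G_f q > 0 \<and> L_f q > 0 \<and> M_c q > 0 \<and> L_c q > 0 \<and> sig_c q > 0 \<and>
     (\<forall>x\<in>U. f_low q \<le> f x \<and> norm (grad f x) \<le> G_f q) \<and>
     (\<forall>x\<in>U. \<forall>y\<in>U. norm (grad f x - grad f y) \<le> L_f q * norm (x - y)) \<and>
     (\<forall>x\<in>U. spec_norm (grad_cols c x) \<le> M_c q) \<and>
     (\<forall>x\<in>U. \<forall>y\<in>U. spec_norm (grad_cols c x - grad_cols c y) \<le> L_c q * norm (x - y)) \<and>
     (\<forall>x\<in>U. \<forall>u. sig_c q * norm u \<le> norm (grad_cols c x *v u))"

text \<open>\<open>P\<close> is the law of $\xi$, and \<open>gF x s\<close> is the stochastic gradient $\nabla F(x;s)$ returned by the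
  oracle. Since \<open>F\<close> is differentiable only for almost every sample, \<open>gF\<close> is constrained to be the
  gradient only there; its values on the exceptional null set are arbitrary, apart from
  joint measurability, which is what makes $\nabla F(x_k;\xi_{k,i})$ a random variable.\<close>

definition stochastic_oracle ::
  "consts_rec \<Rightarrow> (real^'n) set \<Rightarrow> (real^'n \<Rightarrow> real) \<Rightarrow> 'x measure \<Rightarrow> (real^'n \<Rightarrow> 'x \<Rightarrow> real)
     \<Rightarrow> (real^'n \<Rightarrow> 'x \<Rightarrow> real^'n) \<Rightarrow> bool" where
  "stochastic_oracle q U f P F gF \<longleftrightarrow>
     prob_space P \<and>
     (\<forall>x\<in>U. has_bochner_integral P (F x) (f x)) \<and>
     (AE s in P. \<forall>x\<in>U. (\<lambda>y. F y s) differentiable (at x) \<and> gF x s = grad (\<lambda>y. F y s) x) \<and>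
     (\<lambda>(x, s). gF x s) \<in> borel_measurable (restrict_space borel U \<Otimes>\<^sub>M P) \<and>
     sig_f q \<ge> 0 \<and> L_s q \<ge> 0 \<and>
     (\<forall>x\<in>U. has_bochner_integral P (gF x) (grad f x)) \<and>
     (\<forall>x\<in>U. (\<integral>\<^sup>+s. ennreal ((norm (gF x s - grad f x))\<^sup>2) \<partial>P) \<le> ennreal ((sig_f q)\<^sup>2)) \<and>
     (\<forall>x\<in>U. \<forall>y\<in>U. (\<integral>\<^sup>+s. ennreal ((norm (gF x s - gF y s))\<^sup>2) \<partial>P)
        \<le> ennreal ((L_s q)\<^sup>2 * (norm (x - y))\<^sup>2))"

definition parameter_assumption ::
  "consts_rec \<Rightarrow> (real^'n \<Rightarrow> real^'m) \<Rightarrow> real^'n \<Rightarrow> real^'m \<Rightarrow> bool" where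
  "parameter_assumption q c x0 l0 \<longleftrightarrow>
     beta_p q > 0 \<and> rho_p q > 0 \<and> Delta_p q > 0 \<and> Lambda_p q > 0 \<and>
     Lambda_p q \<ge> (G_f q + beta_p q * Delta_p q
        + rho_p q * M_c q * kappa_lin q * (Delta_p q)\<^sup>2) / sig_c q \<and>
     G_f q / beta_p q + 3 * M_c q * Lambda_p q / (beta_p q + rho_p q * (sig_c q)\<^sup>2) \<le> Delta_p q \<and>
     C_mod q \<le> 3 * beta_p q / 8 \<and>
     rho_p q \<ge> 8 * C_lam_p q / beta_p q \<and>
     norm l0 \<le> Lambda_p q \<and> rho_p q * norm (c x0) \<le> Lambda_p q"


text \<open>Exit time of a trajectory; it is \<open>\<infinity>\<close> (the infimum of the empty set) if there is no exit.\<close>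

definition exit_time :: "(real^'n) set \<Rightarrow> (nat \<Rightarrow> real^'n) \<Rightarrow> enat" where
  "exit_time X x = (INF k\<in>{k. 1 \<le> k \<and> x k \<notin> X}. enat k)"

text \<open>Iterations carried out by one attempt: those before the exit time and before step \<open>K\<close>.\<close>

definition executed :: "(real^'n) set \<Rightarrow> nat \<Rightarrow> (nat \<Rightarrow> real^'n) \<Rightarrow> nat set" where
  "executed X K x = {k. k < K \<and> enat k < exit_time X x}"

definition accepted :: "(real^'n) set \<Rightarrow> nat \<Rightarrow> (nat \<Rightarrow> real^'n) \<Rightarrow> bool" where
  "accepted X K x \<longleftrightarrow> enat K < exit_time X x"

text \<open>One attempt, run on the oracle samples \<open>z k i\<close> (iteration \<open>k\<close>, batch position \<open>i\<close>). The
  sequences are unconstrained after the attempt has stopped. \<open>mat \<beta>\<close> is $\beta I_n$, and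
  \<open>closest_point (cball 0 G)\<close> is the projection onto the ball of radius $G$.\<close>

definition attempt_run ::
  "consts_rec \<Rightarrow> (real^'n \<Rightarrow> real^'m) \<Rightarrow> (real^'n \<Rightarrow> 'x \<Rightarrow> real^'n) \<Rightarrow> real^'n \<Rightarrow> real^'m \<Rightarrow> (real^'n) set
     \<Rightarrow> nat \<Rightarrow> nat \<Rightarrow> nat \<Rightarrow> nat \<Rightarrow> (nat \<Rightarrow> nat \<Rightarrow> 'x)
     \<Rightarrow> (nat \<Rightarrow> real^'n) \<Rightarrow> (nat \<Rightarrow> real^'m) \<Rightarrow> (nat \<Rightarrow> real^'n) \<Rightarrow> (nat \<Rightarrow> real^'n) \<Rightarrow> (nat \<Rightarrow> real^'n)
     \<Rightarrow> bool" where
  "attempt_run q c gF x0 l0 X K Q B b z x l h v p \<longleftrightarrow>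
     x 0 = x0 \<and> l 0 = l0 \<and>
     (\<forall>k\<in>executed X K x.
        h k = (if k mod Q = 0
               then (1 / real B) *\<^sub>R (\<Sum>i<B. gF (x k) (z k i))
               else h (k - 1) + (1 / real b) *\<^sub>R (\<Sum>i<b. gF (x k) (z k i) - gF (x (k - 1)) (z k i))) \<and>
        v k = closest_point (cball 0 (G_f q)) (h k) \<and>
        (mat (beta_p q) + rho_p q *\<^sub>R (grad_cols c (x k) ** transpose (grad_cols c (x k)))) *v p k
          = - v k - grad_cols c (x k) *v (l k + rho_p q *\<^sub>R c (x k)) \<and>
        x (Suc k) = x k + p k \<and>
        l (Suc k) = l k + rho_p q *\<^sub>R c (x (Suc k)))"

text \<open>Indices \<open>(j, k, i)\<close> of the oracle samples: attempt \<open>j\<close>, iteration \<open>k\<close>, batch position \<open>i\<close>.\<close>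

definition sample_index :: "nat \<Rightarrow> nat \<Rightarrow> nat \<Rightarrow> nat \<Rightarrow> (nat \<times> nat \<times> nat) set" where
  "sample_index K Q B b = {(j, k, i). k < K \<and> i < (if k mod Q = 0 then B else b)}"

text \<open>The randomness of the restart procedure: independent samples with law \<open>P\<close> (so that
  every batch is independent of the history, and attempts are independent of each other), and
  the uniform output index \<open>kh\<close>, independent of all samples.\<close>

definition restart_randomness ::
  "'w measure \<Rightarrow> 'x measure \<Rightarrow> (nat \<times> nat \<times> nat) set \<Rightarrow> nat
     \<Rightarrow> (nat \<times> nat \<times> nat \<Rightarrow> 'w \<Rightarrow> 'x) \<Rightarrow> ('w \<Rightarrow> nat) \<Rightarrow> bool" where
  "restart_randomness M P I K \<xi> kh \<longleftrightarrow>
     prob_space M \<and>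
     (\<forall>t\<in>I. \<xi> t \<in> measurable M P \<and> distr M P (\<xi> t) = P) \<and>
     prob_space.indep_vars M (\<lambda>_. P) \<xi> I \<and>
     kh \<in> measurable M (count_space {1..K-1}) \<and>
     distr M (count_space {1..K-1}) kh = uniform_count_measure {1..K-1} \<and>
     prob_space.indep_set M
       (sets (vimage_algebra (space M) kh (count_space {1..K-1})))
       (sets (vimage_algebra (space M) (\<lambda>\<omega>. \<lambda>t\<in>I. \<xi> t \<omega>) (\<Pi>\<^sub>M t\<in>I. P)))"


text \<open>Attempt \<open>j\<close> is made iff all earlier attempts exited. The total of a per-attempt cost
  over all attempts made is \<open>[0,\<infinity>]\<close>-valued, as the procedure need not terminate surely.\<close>

definition total_cost :: "(nat \<Rightarrow> bool) \<Rightarrow> (nat \<Rightarrow> nat) \<Rightarrow> ennreal" where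
  "total_cost acc cost = (\<Sum>j. if \<forall>i<j. \<not> acc i then of_nat (cost j) else 0)"

definition grad_cost :: "nat \<Rightarrow> nat \<Rightarrow> nat \<Rightarrow> nat set \<Rightarrow> nat" where
  "grad_cost Q B b E = (\<Sum>k\<in>E. if k mod Q = 0 then B else 2 * b)"

text \<open>Squared residual of the returned pair, with value 0 if the procedure does not terminate.\<close>

definition returned_sq_residual ::
  "(real^'n \<Rightarrow> real) \<Rightarrow> (real^'n \<Rightarrow> real^'m) \<Rightarrow> (nat \<Rightarrow> bool)
     \<Rightarrow> (nat \<Rightarrow> nat \<Rightarrow> real^'n) \<Rightarrow> (nat \<Rightarrow> nat \<Rightarrow> real^'m) \<Rightarrow> nat \<Rightarrow> ennreal" where
  "returned_sq_residual f c acc x l kh =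
     (if \<exists>j. acc j
      then (let j = (LEAST j. acc j) in ennreal ((kkt_residual f c (x j (kh + 1)) (l j (kh + 1)))\<^sup>2))
      else 0)"

text \<open>The bound $E[Y] \le r$ for a \<open>[0,\<infinity>]\<close>-valued random variable, including its measurability.\<close>

definition expectation_le :: "'w measure \<Rightarrow> ('w \<Rightarrow> ennreal) \<Rightarrow> real \<Rightarrow> bool" where
  "expectation_le M Y r \<longleftrightarrow> Y \<in> borel_measurable M \<and> (\<integral>\<^sup>+\<omega>. Y \<omega> \<partial>M) \<le> ennreal r"

end

theory Submission
  imports Defs
begin

text \<open>The augmented Lagrangian plus a multiple of \<open>\<parallel>p\<^bsub>k-1\<^esub>\<parallel>\<^sup>2\<close> is a Lyapunov function: along every
  trajectory that stays in \<open>X\<close>, deterministically, it decreases by \<open>\<beta>/4 \<parallel>p\<^sub>k\<parallel>\<^sup>2\<close> up to gradient errors.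
  Hence the sum \<open>S\<^sub>p\<close> of the squared steps before the exit is at most \<open>D\<^sub>0 + D\<^sub>1 S\<^sub>e\<close>, where \<open>S\<^sub>e\<close> is the
  sum of the squared gradient errors. Conversely the recursive gradient estimator has
  \<open>E S\<^sub>e \<le> \<sigma>\<^sub>f\<^sup>2 + E S\<^sub>p / (2 D\<^sub>1)\<close> for the chosen batch sizes, so both expectations are bounded by
  \<open>\<Gamma>\<^sub>e\<close> and \<open>\<Gamma>\<^sub>p\<close>. Since the constraint bound in \<open>S\<^bsub>st\<^esub>(\<delta>)\<close> holds on the whole trajectory, an exit
  forces the objective above \<open>H\<^bsub>st\<^esub>(\<delta>)\<close> and therefore \<open>S\<^sub>e \<ge> \<Gamma>\<^sub>e / \<delta>\<close>, which by Markov's inequality has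
  probability at most \<open>\<delta>\<close>. Independence of the attempts turns every per-attempt bound \<open>r\<close>
  into the geometric series \<open>\<Sum>\<^sub>j \<delta>\<^sup>j r = r / (1 - \<delta>)\<close>.\<close>

section \<open>Linear algebra and elementary bounds\<close>

text \<open>The main obstacle is that an attempt is given only as a relation: after its exit the
  sequences are arbitrary, measurability is not built in, and the data are controlled only on
  \<open>U\<close>. The probabilistic argument therefore runs on an explicit chain of the samples,
  built from Borel functions and frozen at exit; every attempt coincides with it up to and including
  the exit point. Random stopping then appears only through indicators of
  \<open>iterate z k \<in> X\<close>, and since these are decided by the history before batch
  \<open>k\<close> is drawn, they leave that batch unbiased. The bounds on \<open>E S_e\<close> and
  \<open>E S_p\<close> depend on each other. They can be solved because the size of \<open>b\<close>
  makes the feedback factor \<open>D_1 / (2 * D_1) = 1/2\<close>, and because both sums are surely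
  bounded, by clipping and by the step bound \<open>\<Delta>\<close>, so that the common term is
  finite and may be subtracted. The recursion is unbiased for the raw estimate only, whereas the
  Lyapunov argument uses the clipped one; projecting can only bring an estimate closer to the true
  gradient, which links the two.\<close>

lemma quadratic_upper_bound:
  fixes \<phi> :: "'a::real_inner \<Rightarrow> real"
  assumes der: "\<And>t. 0 \<le> t \<Longrightarrow> t \<le> 1 \<Longrightarrow> (\<phi> has_derivative (\<lambda>h. D (a + t *\<^sub>R p) \<bullet> h)) (at (a + t *\<^sub>R p))"
    and lip: "\<And>t. 0 \<le> t \<Longrightarrow> t \<le> 1 \<Longrightarrow> norm (D (a + t *\<^sub>R p) - D a) \<le> L * (t * norm p)"
  shows "\<phi> (a + p) \<le> \<phi> a + D a \<bullet> p + L / 2 * (norm p)\<^sup>2"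
proof -
  \<comment> \<open>Along the segment: the function minus its linear part and the claimed quadratic
    term. The Lipschitz bound makes the derivative nonpositive, and comparing the endpoints is the
    claim.\<close>
  define \<psi> where "\<psi> t = \<phi> (a + t *\<^sub>R p) - t * (D a \<bullet> p) - L / 2 * t\<^sup>2 * (norm p)\<^sup>2" for t
  have "\<psi> 1 \<le> \<psi> 0"
  proof (rule DERIV_nonpos_imp_nonincreasing[of 0 1 \<psi>])
    fix t :: real assume t: "0 \<le> t" "t \<le> 1"
    let ?d = "D (a + t *\<^sub>R p) \<bullet> p - D a \<bullet> p - L * t * (norm p)\<^sup>2"
    have "((\<lambda>t. \<phi> (a + t *\<^sub>R p)) has_derivative (\<lambda>h. D (a + t *\<^sub>R p) \<bullet> (h *\<^sub>R p))) (at t)"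
      by (rule has_derivative_compose[where f="\<lambda>t. a + t *\<^sub>R p"])
         (auto intro!: derivative_eq_intros der[OF t])
    then have "((\<lambda>t. \<phi> (a + t *\<^sub>R p)) has_real_derivative D (a + t *\<^sub>R p) \<bullet> p) (at t)"
      by (rule has_derivative_imp_has_field_derivative) simp
    then have "(\<psi> has_real_derivative ?d) (at t)"
      unfolding \<psi>_def by (auto intro!: derivative_eq_intros)
    moreover have "?d \<le> 0"
    proof -
      have "(D (a + t *\<^sub>R p) - D a) \<bullet> p \<le> norm (D (a + t *\<^sub>R p) - D a) * norm p"
        by (rule norm_cauchy_schwarz)
      also have "\<dots> \<le> L * (t * norm p) * norm p"
        by (intro mult_right_mono lip t) simp
      finally show ?thesis by (simp add: inner_diff_left power2_eq_square mult_ac)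
    qed
    ultimately show "\<exists>y. (\<psi> has_real_derivative y) (at t) \<and> y \<le> 0" by blast
  qed simp
  then show ?thesis by (simp add: \<psi>_def)
qed

lemma norm_le_of_inner_self_le:
  fixes x :: "'a::real_inner"
  assumes "x \<bullet> x \<le> b * norm x" "0 \<le> b"
  shows "norm x \<le> b"
proof (cases "x = 0")
  case False
  then show ?thesis using assms(1) by (simp add: dot_square_norm power2_eq_square)
qed (use assms in simp)

lemma power2_sum4_le:
  fixes a :: real
  shows "(a + b + c + d)\<^sup>2 \<le> 4 * (a\<^sup>2 + b\<^sup>2 + c\<^sup>2 + d\<^sup>2)"
proof -
  have "0 \<le> (a - b)\<^sup>2 + (a - c)\<^sup>2 + (a - d)\<^sup>2 + (b - c)\<^sup>2 + (b - d)\<^sup>2 + (c - d)\<^sup>2" by simp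
  then show ?thesis by (simp add: power2_eq_square algebra_simps)
qed

lemma power2_sum2_le: "((a::real) + b)\<^sup>2 \<le> 2 * a\<^sup>2 + 2 * b\<^sup>2"
  using sum_squares_bound[of a b] by (simp add: power2_sum)

lemma inner_matrix_vector_left:
  fixes A :: "real^'m^'n"
  shows "(A *v u) \<bullet> w = u \<bullet> (transpose A *v w)"
  by (metis dot_lmul_matrix inner_commute transpose_matrix_vector)

lemma norm_matrix_vector_le_spec_norm: "norm (A *v u) \<le> spec_norm A * norm u"
  unfolding spec_norm_def by (rule onorm[OF matrix_vector_mul_bounded_linear])

lemma spec_norm_nonneg: "0 \<le> spec_norm A"
  unfolding spec_norm_def by (rule onorm_pos_le) simp

text \<open>Testing \<open>transpose A *v w\<close> against itself removes the transpose, and one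
  factor of its norm cancels; so the spectral bound on the Jacobian serves its transpose as
  well.\<close>

lemma norm_transpose_vector_le:
  fixes A :: "real^'m^'n"
  shows "norm (transpose A *v w) \<le> spec_norm A * norm w"
proof (rule norm_le_of_inner_self_le)
  have "(transpose A *v w) \<bullet> (transpose A *v w) = (A *v (transpose A *v w)) \<bullet> w"
    by (rule inner_matrix_vector_left[symmetric])
  also have "\<dots> \<le> norm (A *v (transpose A *v w)) * norm w" by (rule norm_cauchy_schwarz)
  also have "\<dots> \<le> spec_norm A * norm (transpose A *v w) * norm w"
    by (intro mult_right_mono norm_matrix_vector_le_spec_norm) simp
  finally show "(transpose A *v w) \<bullet> (transpose A *v w) \<le> spec_norm A * norm w * norm (transpose A *v w)"
    by (simp add: mult_ac)
qed (simp add: spec_norm_nonneg)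

lemma mat_vector_mult: "mat k *v (x :: real^'n) = k *\<^sub>R x"
  by (simp add: vec_eq_iff matrix_vector_mult_def mat_def if_distrib[where f="\<lambda>a. a * _"]
      sum.delta cong: if_cong)

lemma regularized_gram_vector_mult:
  fixes A :: "real^'m^'n"
  shows "(mat b + r *\<^sub>R (A ** transpose A)) *v w = b *\<^sub>R w + r *\<^sub>R (A *v (transpose A *v w))"
  by (simp add: matrix_vector_mult_add_rdistrib mat_vector_mult scaleR_matrix_vector_assoc[symmetric]
      matrix_vector_mul_assoc del: transpose_matrix_vector)

text \<open>Pairing with \<open>w\<close> gives \<open>b |w|^2 + r |A^T w|^2\<close>, which vanishes
  only at 0. Injectivity is used both for solvability of the dual system and for a nonzero
  determinant in Cramer's rule.\<close>

lemma regularized_gram_inj: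
  fixes A :: "real^'m^'n"
  assumes "b > 0" "r \<ge> 0"
  shows "inj (\<lambda>w. b *\<^sub>R w + r *\<^sub>R (A *v (transpose A *v w)))"
    and "linear (\<lambda>w. b *\<^sub>R w + r *\<^sub>R (A *v (transpose A *v w)))"
proof -
  let ?T = "\<lambda>w. b *\<^sub>R w + r *\<^sub>R (A *v (transpose A *v w))"
  show lin: "linear ?T"
    by (simp add: regularized_gram_vector_mult[symmetric] del: transpose_matrix_vector)
  show "inj ?T"
  proof (rule linear_injective_0[OF lin, THEN iffD2], intro allI impI)
    fix w assume "?T w = 0"
    then have "?T w \<bullet> w = 0" by simp
    then have "b * (w \<bullet> w) + r * ((transpose A *v w) \<bullet> (transpose A *v w)) = 0"
      by (simp add: inner_add_left inner_matrix_vector_left del: transpose_matrix_vector)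
    moreover have "r * ((transpose A *v w) \<bullet> (transpose A *v w)) \<ge> 0" using assms by simp
    ultimately have "b * (w \<bullet> w) \<le> 0" by linarith
    then have "w \<bullet> w \<le> 0" using assms by (simp add: mult_le_0_iff)
    then show "w = 0" by (metis inner_gt_zero_iff not_le)
  qed
qed

text \<open>Split the solution as \<open>p = p\<^sub>1 - A u\<close> with \<open>(b + r A\<^sup>T A) u = w\<close>; the push-through identity
  lets the second part benefit from the lower bound \<open>s\<close> on \<open>A\<close>.\<close>

lemma regularized_gram_solution_bound:
  fixes A :: "real^'m^'n"
  assumes eq: "b *\<^sub>R p + r *\<^sub>R (A *v (transpose A *v p)) = - v - A *v w"
    and b: "b > 0" and r: "r > 0" and s: "s > 0" and lower: "\<And>u. s * norm u \<le> norm (A *v u)"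
    and upper: "spec_norm A \<le> m"
  shows "norm p \<le> norm v / b + m * norm w / (b + r * s\<^sup>2)"
proof -
  let ?T = "\<lambda>u. b *\<^sub>R u + r *\<^sub>R (transpose A *v (transpose (transpose A) *v u))"
  have "surj ?T"
    by (rule linear_injective_imp_surjective) (use regularized_gram_inj[of b r "transpose A"] b r in auto)
  then obtain u where u: "w = ?T u" by (rule surjE)
  then have u: "b *\<^sub>R u + r *\<^sub>R (transpose A *v (A *v u)) = w"
    by (simp only: transpose_transpose)
  define p1 where "p1 = p + A *v u"
  have "b *\<^sub>R (A *v u) + r *\<^sub>R (A *v (transpose A *v (A *v u))) = A *v w"
    unfolding u[symmetric]
    by (simp add: matrix_vector_right_distrib matrix_vector_mult_scaleR del: transpose_matrix_vector)
  with eq have eq1: "b *\<^sub>R p1 + r *\<^sub>R (A *v (transpose A *v p1)) = - v"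
    unfolding p1_def
    by (simp add: matrix_vector_right_distrib scaleR_add_right del: transpose_matrix_vector)
       (simp add: algebra_simps del: transpose_matrix_vector)
  have "norm p1 \<le> norm v / b"
  proof (rule norm_le_of_inner_self_le)
    have "b * (p1 \<bullet> p1) + r * ((transpose A *v p1) \<bullet> (transpose A *v p1)) = (- v) \<bullet> p1"
      unfolding eq1[symmetric]
      by (simp add: inner_add_left inner_matrix_vector_left del: transpose_matrix_vector)
    moreover have "(- v) \<bullet> p1 \<le> norm v * norm p1" using norm_cauchy_schwarz[of "-v" p1] by simp
    moreover have "r * ((transpose A *v p1) \<bullet> (transpose A *v p1)) \<ge> 0" using r by simp
    ultimately have "b * (p1 \<bullet> p1) \<le> norm v * norm p1" by linarith
    then show "p1 \<bullet> p1 \<le> norm v / b * norm p1" using b by (simp add: field_simps)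
  qed (use b in simp)
  moreover have "norm u \<le> norm w / (b + r * s\<^sup>2)"
  proof (rule norm_le_of_inner_self_le)
    have "(transpose A *v (A *v u)) \<bullet> u = (A *v u) \<bullet> (A *v u)"
      by (simp only: inner_matrix_vector_left[of A u] inner_commute[of _ u])
    then have "b * (u \<bullet> u) + r * ((A *v u) \<bullet> (A *v u)) = w \<bullet> u"
      unfolding u[symmetric] by (simp add: inner_add_left del: transpose_matrix_vector)
    moreover have "w \<bullet> u \<le> norm w * norm u" by (rule norm_cauchy_schwarz)
    moreover have "r * (s\<^sup>2 * (u \<bullet> u)) \<le> r * ((A *v u) \<bullet> (A *v u))"
    proof (rule mult_left_mono)
      have "(s * norm u)\<^sup>2 \<le> (norm (A *v u))\<^sup>2" using lower s by (intro power_mono) auto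
      then show "s\<^sup>2 * (u \<bullet> u) \<le> (A *v u) \<bullet> (A *v u)"
        by (simp add: power_mult_distrib dot_square_norm)
    qed (use r in simp)
    ultimately have "(b + r * s\<^sup>2) * (u \<bullet> u) \<le> norm w * norm u" by (simp add: algebra_simps)
    moreover have "b + r * s\<^sup>2 > 0" using b r by (simp add: add_pos_nonneg)
    ultimately show "u \<bullet> u \<le> norm w / (b + r * s\<^sup>2) * norm u" by (simp add: field_simps)
  qed (use b r in simp)
  then have "norm (A *v u) \<le> m * (norm w / (b + r * s\<^sup>2))"
    using upper order_trans[OF spec_norm_nonneg upper]
    by (intro order_trans[OF norm_matrix_vector_le_spec_norm] mult_mono) auto
  moreover have "norm p \<le> norm p1 + norm (A *v u)"
    using norm_triangle_ineq4[of p1 "A *v u"] by (simp add: p1_def)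
  ultimately show ?thesis by simp
qed

section \<open>Descent along a trajectory in \<open>X\<close>\<close>

text \<open>\<open>grad\<close> is a definite description, so existence and uniqueness must come
  first: the adjoint of the derivative at 1 is the Riesz representative, and derivatives are
  unique.\<close>

lemma has_derivative_grad:
  fixes f :: "real^'n \<Rightarrow> real"
  assumes "f differentiable (at x)"
  shows "(f has_derivative (\<lambda>h. grad f x \<bullet> h)) (at x)"
proof -
  obtain D where D: "(f has_derivative D) (at x)" using assms by (auto simp: differentiable_def)
  have "D h = h \<bullet> adjoint D 1" for h
    using adjoint_works[OF has_derivative_linear[OF D], of h 1] by simp
  then have "D = (\<lambda>h. h \<bullet> adjoint D 1)" by blast
  with D have ex: "GDERIV f x :> adjoint D 1" by (simp add: gderiv_def)
  have "GDERIV f x :> grad f x"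
    unfolding grad_def
  proof (rule theI[of "\<lambda>d. GDERIV f x :> d", OF ex])
    fix y assume "GDERIV f x :> y"
    then have "(\<lambda>h. h \<bullet> y) = (\<lambda>h. h \<bullet> adjoint D 1)"
      using ex unfolding gderiv_def by (rule has_derivative_unique)
    then show "y = adjoint D 1" by (simp add: fun_eq_iff vector_eq_ldot)
  qed
  then show ?thesis by (simp add: gderiv_def inner_commute)
qed

text \<open>Scalarizing \<open>c\<close> with a fixed weight \<open>w\<close> is what makes the
  scalar quadratic bound applicable to the constraint map.\<close>

lemma has_derivative_grad_cols:
  fixes c :: "real^'n \<Rightarrow> real^'m"
  assumes "c differentiable (at x)"
  shows "((\<lambda>y. w \<bullet> c y) has_derivative (\<lambda>h. (grad_cols c x *v w) \<bullet> h)) (at x)"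
proof -
  have d: "(\<lambda>y. c y $ j) differentiable (at x)" for j
  proof -
    obtain D where "(c has_derivative D) (at x)" using assms by (auto simp: differentiable_def)
    then have "((\<lambda>y. c y $ j) has_derivative (\<lambda>h. D h $ j)) (at x)"
      by (rule bounded_linear.has_derivative[OF bounded_linear_vec_nth])
    then show ?thesis by (auto simp: differentiable_def)
  qed
  have "((\<lambda>y. \<Sum>j\<in>UNIV. w $ j * c y $ j) has_derivative
      (\<lambda>h. \<Sum>j\<in>UNIV. w $ j * (grad (\<lambda>y. c y $ j) x \<bullet> h))) (at x)"
    by (intro has_derivative_sum has_derivative_mult_right has_derivative_grad d)
  moreover have "(\<Sum>j\<in>UNIV. w $ j * (grad (\<lambda>y. c y $ j) x \<bullet> h)) = (grad_cols c x *v w) \<bullet> h" for h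
    by (simp add: inner_vec_def matrix_vector_mult_def grad_cols_def sum_distrib_left
        sum_distrib_right mult_ac sum.swap[of _ "UNIV::'n set"])
  ultimately show ?thesis by (simp add: inner_vec_def)
qed

lemma norm_triangle5:
  fixes a1 :: "'a::real_normed_vector"
  shows "norm (a1 + a2 - a3 - a4 + a5) \<le> norm a1 + norm a2 + norm a3 + norm a4 + norm a5"
  using norm_triangle_ineq[of a1 a2] norm_triangle_ineq4[of "a1 + a2" a3]
    norm_triangle_ineq4[of "a1 + a2 - a3" a4] norm_triangle_ineq[of "a1 + a2 - a3 - a4" a5]
  by linarith

lemma norm_triangle8:
  fixes a1 :: "'a::real_normed_vector"
  shows "norm ((a1 + a2) + (b1 - b2) - a3 - a4 - a5 + a6)
    \<le> (norm a1 + norm a2) + (norm b1 + norm b2) + norm a3 + norm a4 + norm a5 + norm a6"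
  using norm_triangle_ineq[of a1 a2] norm_triangle_ineq4[of b1 b2]
    norm_triangle5[of "a1 + a2" "b1 - b2" a3 a4 "a6 - a5"] norm_triangle_ineq4[of a6 a5]
  by (simp add: algebra_simps)

section \<open>Consequences of the regularity and parameter assumptions near
  \<open>X\<close>\<close>

locale nr_lalm =
  fixes q :: consts_rec and U :: "(real^'n) set" and f :: "real^'n \<Rightarrow> real"
    and c :: "real^'n \<Rightarrow> real^'m" and x0 :: "real^'n" and l0 :: "real^'m" and X :: "(real^'n) set"
  assumes regular: "regularity q U f c" and params: "parameter_assumption q c x0 l0"
    and nbhd_subset: "nbhd (Delta_p q) X \<subseteq> U" and x0_in: "x0 \<in> X"
begin

abbreviation "\<beta> \<equiv> beta_p q"
abbreviation "\<rho> \<equiv> rho_p q"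
abbreviation "\<Delta> \<equiv> Delta_p q"
abbreviation "\<Lambda> \<equiv> Lambda_p q"
abbreviation "\<kappa> \<equiv> kappa_lin q"
abbreviation "J \<equiv> grad_cols c"
abbreviation "g \<equiv> grad f"

lemma consts_pos [simp]:
  "G_f q > 0" "L_f q > 0" "M_c q > 0" "L_c q > 0" "sig_c q > 0" "\<kappa> > 0"
  "\<beta> > 0" "\<rho> > 0" "\<Delta> > 0" "\<Lambda> > 0"
  using regular params by (auto simp: regularity_def parameter_assumption_def kappa_lin_def)

lemmas consts_nonneg [simp] = consts_pos[THEN less_imp_le]
lemmas consts_nonzero [simp] = consts_pos[THEN less_imp_neq, symmetric]

lemma C_lam_p_nonneg: "C_lam_p q \<ge> 0"
  unfolding C_lam_p_def by (simp add: le_max_iff_disj)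

lemma C_lam_e_pos: "C_lam_e q > 0"
  unfolding C_lam_e_def by simp

lemma C_e_star_pos: "C_e_star q > 0"
  unfolding C_e_star_def using C_lam_e_pos by (simp add: add_pos_pos)

lemma C_R_st_nonneg: "0 \<le> C_R_st q"
  unfolding C_R_st_def using C_lam_e_pos by (simp add: le_max_iff_disj)

lemma D_1_pos: "D_1 q > 0"
  unfolding D_1_def using C_e_star_pos by simp

lemma X_subset_U: "X \<subseteq> U"
proof
  fix x assume "x \<in> X"
  then have "x \<in> nbhd \<Delta> X" by (simp add: nbhd_def)
  then show "x \<in> U" using nbhd_subset by blast
qed

text \<open>\<open>U\<close> need not be convex; the \<open>\<Delta>\<close>-neighbourhood condition
  is what keeps the whole segment of a step where the regularity bounds hold.\<close>

lemma segment_in_U: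
  assumes "x \<in> X" "norm p \<le> \<Delta>" "0 \<le> t" "t \<le> 1"
  shows "x + t *\<^sub>R p \<in> U"
proof -
  have "infdist (x + t *\<^sub>R p) X \<le> dist (x + t *\<^sub>R p) x" by (rule infdist_le[OF assms(1)])
  also have "\<dots> = t * norm p" using assms by (simp add: dist_norm)
  also have "\<dots> \<le> 1 * \<Delta>" using assms by (intro mult_mono) auto
  finally show ?thesis using nbhd_subset by (auto simp: nbhd_def)
qed

lemma step_in_U: "x \<in> X \<Longrightarrow> norm p \<le> \<Delta> \<Longrightarrow> x + p \<in> U"
  using segment_in_U[of x p 1] by simp

lemma f_lower: "x \<in> U \<Longrightarrow> f_low q \<le> f x"
  and grad_bound: "x \<in> U \<Longrightarrow> norm (g x) \<le> G_f q"
  and grad_lip: "x \<in> U \<Longrightarrow> y \<in> U \<Longrightarrow> norm (g x - g y) \<le> L_f q * norm (x - y)"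
  and jac_bound: "x \<in> U \<Longrightarrow> spec_norm (J x) \<le> M_c q"
  and jac_lip: "x \<in> U \<Longrightarrow> y \<in> U \<Longrightarrow> spec_norm (J x - J y) \<le> L_c q * norm (x - y)"
  and jac_lower: "x \<in> U \<Longrightarrow> sig_c q * norm u \<le> norm (J x *v u)"
  and f_diff: "x \<in> U \<Longrightarrow> f differentiable (at x)"
  and c_diff: "x \<in> U \<Longrightarrow> c differentiable (at x)"
  using regular by (auto simp: regularity_def)

lemma D_0_pos: "0 < D_0 q f x0"
proof -
  have "f_low q \<le> f x0" using x0_in X_subset_U f_lower by blast
  moreover have "0 \<le> G_f q * \<Delta>" "0 \<le> 4 * \<Lambda>\<^sup>2 / \<rho>" "0 \<le> C_lam_p q / \<rho> * \<Delta>\<^sup>2" "0 \<le> \<Lambda>\<^sup>2 / (2 * \<rho>)"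
    using C_lam_p_nonneg by simp_all
  ultimately have "0 \<le> Phi_up q f x0 - Phi_low q" unfolding Phi_up_def Phi_low_def by linarith
  then show ?thesis unfolding D_0_def by (intro add_pos_nonneg) simp_all
qed

lemma jac_vector_bound: "x \<in> U \<Longrightarrow> norm (J x *v u) \<le> M_c q * norm u"
  by (rule order_trans[OF norm_matrix_vector_le_spec_norm]) (simp add: jac_bound mult_right_mono)

lemma jac_transpose_vector_bound: "x \<in> U \<Longrightarrow> norm (transpose (J x) *v u) \<le> M_c q * norm u"
  by (rule order_trans[OF norm_transpose_vector_le]) (simp add: jac_bound mult_right_mono)

lemma jac_diff_vector_bound:
  assumes "x \<in> U" "y \<in> U"
  shows "norm (J x *v u - J y *v u) \<le> L_c q * norm (x - y) * norm u"
proof -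
  have "norm ((J x - J y) *v u) \<le> spec_norm (J x - J y) * norm u"
    by (rule norm_matrix_vector_le_spec_norm)
  also have "\<dots> \<le> L_c q * norm (x - y) * norm u"
    by (rule mult_right_mono[OF jac_lip[OF assms]]) simp
  finally show ?thesis by (simp add: matrix_vector_mult_diff_rdistrib)
qed

lemma jac_diff_multiplier_bound:
  assumes "x \<in> U" "y \<in> U" "norm m \<le> \<Lambda>"
  shows "norm (J x *v m - J y *v m) \<le> L_c q * \<Lambda> * norm (x - y)"
proof -
  have "L_c q * norm (x - y) * norm m \<le> L_c q * norm (x - y) * \<Lambda>"
    using assms(3) by (intro mult_left_mono) simp_all
  also have "\<dots> = L_c q * \<Lambda> * norm (x - y)" by simp
  finally show ?thesis by (rule order_trans[OF jac_diff_vector_bound[OF assms(1,2)]])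
qed

lemma f_upper:
  assumes "x \<in> X" "norm p \<le> \<Delta>"
  shows "f (x + p) \<le> f x + g x \<bullet> p + L_f q / 2 * (norm p)\<^sup>2"
proof (rule quadratic_upper_bound)
  fix t :: real assume t: "0 \<le> t" "t \<le> 1"
  note U = segment_in_U[OF assms t]
  show "(f has_derivative (\<lambda>h. g (x + t *\<^sub>R p) \<bullet> h)) (at (x + t *\<^sub>R p))"
    by (intro has_derivative_grad f_diff U)
  show "norm (g (x + t *\<^sub>R p) - g x) \<le> L_f q * (t * norm p)"
    using grad_lip[OF U, of x] assms X_subset_U t by (auto simp: mult_ac)
qed

text \<open>Mean value bound on the ball of radius \<open>\<Delta>\<close>, which is convex and
  contained in \<open>U\<close>. It handles the first step, before any descent inequality is
  available.\<close>

lemma f_step_le: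
  assumes "x \<in> X" "norm p \<le> \<Delta>"
  shows "f (x + p) \<le> f x + G_f q * \<Delta>"
proof -
  have "norm (f (x + p) - f x) \<le> G_f q * norm (x + p - x)"
  proof (rule differentiable_bound[of "cball x \<Delta>"])
    fix y assume "y \<in> cball x \<Delta>"
    then have "y \<in> U" using segment_in_U[OF assms(1), of "y - x" 1] by (simp add: dist_norm norm_minus_commute)
    then show "(f has_derivative (\<lambda>h. g y \<bullet> h)) (at y within cball x \<Delta>)"
      by (rule has_derivative_at_withinI[OF has_derivative_grad[OF f_diff]])
    show "onorm (\<lambda>h. g y \<bullet> h) \<le> G_f q"
    proof (rule onorm_le)
      fix h
      have "norm (g y \<bullet> h) \<le> norm (g y) * norm h" by (simp add: Cauchy_Schwarz_ineq2)
      also have "\<dots> \<le> G_f q * norm h" by (intro mult_right_mono grad_bound \<open>y \<in> U\<close>) simp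
      finally show "norm (g y \<bullet> h) \<le> G_f q * norm h" .
    qed
  qed (use assms in \<open>auto simp: dist_norm\<close>)
  also have "\<dots> \<le> G_f q * \<Delta>" using assms by (simp add: mult_left_mono)
  finally show ?thesis by simp
qed

text \<open>Pair the remainder \<open>r\<close> with itself: the scalar function
  \<open>r \<bullet> c\<close> has gradient Lipschitz constant \<open>L_c q * norm r\<close> along
  the segment, and one factor \<open>norm r\<close> cancels. This is the origin of
  \<open>\<kappa>\<close> as half of \<open>L_c\<close>.\<close>

lemma c_linearization:
  assumes "x \<in> X" "norm p \<le> \<Delta>"
  shows "norm (c (x + p) - c x - transpose (J x) *v p) \<le> \<kappa> * (norm p)\<^sup>2"
proof (rule norm_le_of_inner_self_le)
  define r where "r = c (x + p) - c x - transpose (J x) *v p"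
  have "r \<bullet> c (x + p) \<le> r \<bullet> c x + (J x *v r) \<bullet> p + L_c q * norm r / 2 * (norm p)\<^sup>2"
  proof (rule quadratic_upper_bound)
    fix t :: real assume t: "0 \<le> t" "t \<le> 1"
    note U = segment_in_U[OF assms t]
    show "((\<lambda>y. r \<bullet> c y) has_derivative (\<lambda>h. (J (x + t *\<^sub>R p) *v r) \<bullet> h)) (at (x + t *\<^sub>R p))"
      by (intro has_derivative_grad_cols c_diff U)
    show "norm (J (x + t *\<^sub>R p) *v r - J x *v r) \<le> L_c q * norm r * (t * norm p)"
      using jac_diff_vector_bound[OF U, of x r] assms X_subset_U t by (auto simp: mult_ac)
  qed
  then have "r \<bullet> (c (x + p) - c x - transpose (J x) *v p) \<le> L_c q * norm r / 2 * (norm p)\<^sup>2"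
    by (simp add: inner_diff_right inner_matrix_vector_left del: transpose_matrix_vector)
  then show "(c (x + p) - c x - transpose (J x) *v p) \<bullet> (c (x + p) - c x - transpose (J x) *v p)
      \<le> \<kappa> * (norm p)\<^sup>2 * norm (c (x + p) - c x - transpose (J x) *v p)"
    by (simp add: r_def[symmetric] kappa_lin_def mult_ac del: transpose_matrix_vector)
qed simp

text \<open>The second parameter inequality is tailored to this bound: its
  \<open>3 * \<Lambda>\<close> is \<open>\<Lambda>\<close> for the multiplier plus
  \<open>2 * \<Lambda>\<close> for the scaled constraint. Both are hypotheses here because the
  induction establishing them uses this lemma.\<close>

lemma direction_bound:
  assumes y: "y \<in> U" and w: "norm w \<le> G_f q" and "norm m \<le> \<Lambda>" "\<rho> * norm (c y) \<le> 2 * \<Lambda>"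
    and eq: "\<beta> *\<^sub>R d + \<rho> *\<^sub>R (J y *v (transpose (J y) *v d)) = - w - J y *v (m + \<rho> *\<^sub>R c y)"
  shows "norm d \<le> \<Delta>"
proof -
  have "norm d \<le> norm w / \<beta> + M_c q * norm (m + \<rho> *\<^sub>R c y) / (\<beta> + \<rho> * (sig_c q)\<^sup>2)"
    by (rule regularized_gram_solution_bound[OF eq]) (use jac_lower jac_bound y in simp_all)
  also have "\<dots> \<le> G_f q / \<beta> + 3 * M_c q * \<Lambda> / (\<beta> + \<rho> * (sig_c q)\<^sup>2)"
  proof -
    have "norm (m + \<rho> *\<^sub>R c y) \<le> 3 * \<Lambda>"
      using norm_triangle_ineq[of m "\<rho> *\<^sub>R c y"] assms by simp
    then have "M_c q * norm (m + \<rho> *\<^sub>R c y) \<le> M_c q * (3 * \<Lambda>)"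
      by (intro mult_left_mono) simp_all
    moreover have "0 \<le> \<beta> + \<rho> * (sig_c q)\<^sup>2" by simp
    ultimately show ?thesis using w by (intro add_mono divide_right_mono) simp_all
  qed
  also have "\<dots> \<le> \<Delta>" using params by (simp add: parameter_assumption_def)
  finally show ?thesis .
qed

end

text \<open>Only points from which a step is taken must lie in \<open>X\<close>; \<open>x N\<close>
  may be the exit point. Bounds valid up to index \<open>N\<close> inclusive are what later controls
  the exit.\<close>

locale trajectory = nr_lalm q U f c x0 l0 X
  for q U and f :: "real^'n \<Rightarrow> real" and c :: "real^'n \<Rightarrow> real^'m" and x0 l0 X +
  fixes N :: nat and x :: "nat \<Rightarrow> real^'n" and l :: "nat \<Rightarrow> real^'m"
    and v :: "nat \<Rightarrow> real^'n" and p :: "nat \<Rightarrow> real^'n"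
  assumes start: "x 0 = x0" "l 0 = l0"
    and visited: "\<And>k. k < N \<Longrightarrow> x k \<in> X"
    and v_bound: "\<And>k. k < N \<Longrightarrow> norm (v k) \<le> G_f q"
    and p_eq: "\<And>k. k < N \<Longrightarrow> \<beta> *\<^sub>R p k + \<rho> *\<^sub>R (J (x k) *v (transpose (J (x k)) *v p k))
        = - v k - J (x k) *v (l k + \<rho> *\<^sub>R c (x k))"
    and x_Suc: "\<And>k. k < N \<Longrightarrow> x (Suc k) = x k + p k"
    and l_Suc: "\<And>k. k < N \<Longrightarrow> l (Suc k) = l k + \<rho> *\<^sub>R c (x (Suc k))"
begin

definition "e k = v k - g (x k)"
definition "r k = c (x (Suc k)) - c (x k) - transpose (J (x k)) *v p k"

lemma visited_U: "k < N \<Longrightarrow> x k \<in> U"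
  using visited X_subset_U by blast

lemma p_bound_aux:
  assumes k: "k < N" and "norm (l k) \<le> \<Lambda>" "\<rho> * norm (c (x k)) \<le> 2 * \<Lambda>"
  shows "norm (p k) \<le> \<Delta>"
  by (rule direction_bound[OF visited_U[OF k] v_bound[OF k] assms(2,3) p_eq[OF k]])

lemma r_bound_aux:
  assumes "k < N" "norm (p k) \<le> \<Delta>"
  shows "norm (r k) \<le> \<kappa> * (norm (p k))\<^sup>2"
  unfolding r_def x_Suc[OF assms(1)] by (rule c_linearization[OF visited[OF assms(1)] assms(2)])

lemma c_Suc: "c (x (Suc k)) = c (x k) + transpose (J (x k)) *v p k + r k"
  by (simp add: r_def)

text \<open>The linear system contains \<open>\<rho>\<close> times the linearized constraint, which
  is the dual update up to the remainder \<open>r k\<close>. The old multiplier thus disappears,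
  leaving approximate stationarity for the new one.\<close>

lemma jac_multiplier:
  assumes "k < N"
  shows "J (x k) *v l (Suc k) = - \<beta> *\<^sub>R p k - v k + \<rho> *\<^sub>R (J (x k) *v r k)"
proof -
  have "J (x k) *v l (Suc k) = J (x k) *v (l k + \<rho> *\<^sub>R c (x k))
      + \<rho> *\<^sub>R (J (x k) *v (transpose (J (x k)) *v p k)) + \<rho> *\<^sub>R (J (x k) *v r k)"
    unfolding l_Suc[OF assms] c_Suc
    by (simp add: matrix_vector_right_distrib matrix_vector_mult_scaleR scaleR_add_right
        del: transpose_matrix_vector)
  then show ?thesis using p_eq[OF assms] by (simp add: algebra_simps del: transpose_matrix_vector)
qed

text \<open>One of the two factors \<open>norm (p k)\<close> is traded for \<open>\<Delta>\<close>,
  so the remainder enters linearly; this gives the term with \<open>\<kappa>\<close> in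
  \<open>A_p\<close> and \<open>C_s\<close>.\<close>

lemma jac_r_bound_aux:
  assumes "k < N" "norm (p k) \<le> \<Delta>"
  shows "norm (\<rho> *\<^sub>R (J (x k) *v r k)) \<le> \<rho> * M_c q * \<kappa> * \<Delta> * norm (p k)"
proof -
  have "norm (J (x k) *v r k) \<le> M_c q * norm (r k)"
    by (rule jac_vector_bound[OF visited_U[OF assms(1)]])
  also have "\<dots> \<le> M_c q * (\<kappa> * (norm (p k) * \<Delta>))"
  proof (intro mult_left_mono)
    have "\<kappa> * (norm (p k))\<^sup>2 \<le> \<kappa> * (norm (p k) * \<Delta>)"
      using assms(2) by (simp add: power2_eq_square mult_left_mono)
    then show "norm (r k) \<le> \<kappa> * (norm (p k) * \<Delta>)"
      using r_bound_aux[OF assms] by linarith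
  qed simp
  finally have "\<rho> * norm (J (x k) *v r k) \<le> \<rho> * (M_c q * (\<kappa> * (norm (p k) * \<Delta>)))"
    by (rule mult_left_mono) simp
  then show ?thesis by (simp add: mult_ac)
qed

text \<open>The bounds do not accumulate: the old ones serve only to get a step of length at most
  \<open>\<Delta>\<close>. Then \<open>jac_multiplier\<close> bounds the image of the new multiplier
  without the old one, the lower bound \<open>sig_c\<close> inverts the Jacobian, and the constraint
  is a difference of two multipliers, hence the factor 2.\<close>

lemma iterate_bounds: "k \<le> N \<Longrightarrow> norm (l k) \<le> \<Lambda> \<and> \<rho> * norm (c (x k)) \<le> 2 * \<Lambda>"
proof (induction k)
  case 0
  have "norm l0 \<le> \<Lambda>" "\<rho> * norm (c x0) \<le> \<Lambda>"
    using params by (simp_all add: parameter_assumption_def)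
  then show ?case using consts_pos(10) unfolding start by linarith
next
  case (Suc k)
  then have k: "k < N" by simp
  have p: "norm (p k) \<le> \<Delta>" using Suc k by (intro p_bound_aux) auto
  have "sig_c q * norm (l (Suc k)) \<le> norm (J (x k) *v l (Suc k))"
    by (rule jac_lower[OF visited_U[OF k]])
  also have "\<dots> \<le> norm (\<beta> *\<^sub>R p k) + norm (v k) + norm (\<rho> *\<^sub>R (J (x k) *v r k))"
    unfolding jac_multiplier[OF k]
    using norm_triangle_ineq[of "- \<beta> *\<^sub>R p k - v k" "\<rho> *\<^sub>R (J (x k) *v r k)"]
      norm_triangle_ineq4[of "- \<beta> *\<^sub>R p k" "v k"] by simp
  also have "\<dots> \<le> \<beta> * \<Delta> + G_f q + \<rho> * M_c q * \<kappa> * \<Delta>\<^sup>2"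
  proof -
    have "\<rho> * M_c q * \<kappa> * \<Delta> * norm (p k) \<le> \<rho> * M_c q * \<kappa> * \<Delta>\<^sup>2"
      unfolding power2_eq_square mult.assoc[symmetric] using p by (intro mult_left_mono) simp_all
    moreover have "norm (\<beta> *\<^sub>R p k) \<le> \<beta> * \<Delta>" using p by simp
    ultimately show ?thesis
      using jac_r_bound_aux[OF k p] v_bound[OF k] by linarith
  qed
  also have "\<dots> \<le> sig_c q * \<Lambda>"
    using params by (simp add: parameter_assumption_def field_simps)
  finally have l: "norm (l (Suc k)) \<le> \<Lambda>" by simp
  have "\<rho> *\<^sub>R c (x (Suc k)) = l (Suc k) - l k" by (simp add: l_Suc[OF k])
  then have "\<rho> * norm (c (x (Suc k))) = norm (l (Suc k) - l k)" 
    by (metis norm_scaleR abs_of_nonneg consts_nonneg(8))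
  also have "\<dots> \<le> 2 * \<Lambda>" using norm_triangle_ineq4[of "l (Suc k)" "l k"] l Suc by simp
  finally show ?case using l by simp
qed

lemma l_bound: "k \<le> N \<Longrightarrow> norm (l k) \<le> \<Lambda>"
  and c_bound: "k \<le> N \<Longrightarrow> \<rho> * norm (c (x k)) \<le> 2 * \<Lambda>"
  using iterate_bounds by auto

lemma p_bound: "k < N \<Longrightarrow> norm (p k) \<le> \<Delta>"
  by (intro p_bound_aux l_bound c_bound) auto

lemmas r_bound = r_bound_aux[OF _ p_bound]
lemmas jac_r_bound = jac_r_bound_aux[OF _ p_bound]

lemma iterate_in_U: "k \<le> N \<Longrightarrow> x k \<in> U"
proof (cases k)
  case 0
  then show ?thesis using x0_in X_subset_U start by auto
next
  case (Suc i)
  assume "k \<le> N"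
  then show ?thesis using Suc step_in_U visited p_bound x_Suc by simp
qed


section \<open>The augmented Lagrangian and the Lyapunov descent\<close>

definition "lagrangian y m = f y + m \<bullet> c y + \<rho> / 2 * (norm (c y))\<^sup>2"

text \<open>Testing the linear system with the step turns the first-order terms into
  \<open>- \<beta> |p|^2 - \<rho> |a|^2\<close> up to the gradient error, where \<open>a\<close> is
  the linearized change of \<open>c\<close>. Half of the \<open>|a|^2\<close> term pays for the
  square in the penalty, the other half is dropped. Of \<open>\<beta>\<close>, 3/8 absorbs the
  curvature via \<open>C_mod\<close> and 1/8 the gradient error; 1/2 remains.\<close>

lemma lagrangian_primal_descent:
  assumes k: "k < N"
  shows "lagrangian (x (Suc k)) (l k)
    \<le> lagrangian (x k) (l k) - \<beta> / 2 * (norm (p k))\<^sup>2 + 2 / \<beta> * (norm (e k))\<^sup>2"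
proof -
  define a where "a = transpose (J (x k)) *v p k"
  define P where "P = (norm (p k))\<^sup>2"
  note p = p_bound[OF k] and r = r_bound[OF k k, folded P_def]
  have P: "P \<ge> 0" "P \<le> \<Delta>\<^sup>2" using p by (auto simp: P_def intro: power_mono)
  have cS: "c (x (Suc k)) = c (x k) + a + r k" by (simp add: c_Suc a_def)
  have f1: "f (x (Suc k)) \<le> f (x k) + g (x k) \<bullet> p k + L_f q / 2 * P"
    unfolding x_Suc[OF k] P_def by (rule f_upper[OF visited[OF k] p])
  have l1: "l k \<bullet> r k \<le> \<Lambda> * (\<kappa> * P)"
    by (rule order_trans[OF norm_cauchy_schwarz])
       (use l_bound[of k] k r in \<open>intro mult_mono, auto\<close>)
  have a: "norm a \<le> M_c q * \<Delta>"
    unfolding a_def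
    by (rule order_trans[OF jac_transpose_vector_bound[OF visited_U[OF k]]]) (use p in \<open>simp add: mult_left_mono\<close>)
  have "\<rho> * ((c (x k) + a) \<bullet> r k) \<le> (2 * \<Lambda> + \<rho> * M_c q * \<Delta>) * (\<kappa> * P)"
  proof -
    have "\<rho> * ((c (x k) + a) \<bullet> r k) \<le> \<rho> * (norm (c (x k) + a) * norm (r k))"
      by (intro mult_left_mono norm_cauchy_schwarz) simp
    also have "\<dots> \<le> \<rho> * norm (c (x k) + a) * (\<kappa> * P)"
      using r by (simp add: mult_left_mono)
    also have "\<dots> \<le> (2 * \<Lambda> + \<rho> * M_c q * \<Delta>) * (\<kappa> * P)"
    proof (rule mult_right_mono)
      have "\<rho> * norm (c (x k) + a) \<le> \<rho> * (norm (c (x k)) + M_c q * \<Delta>)"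
        using norm_triangle_ineq[of "c (x k)" a] a by (intro mult_left_mono) auto
      then show "\<rho> * norm (c (x k) + a) \<le> 2 * \<Lambda> + \<rho> * M_c q * \<Delta>"
        using c_bound[of k] k by (simp add: distrib_left mult_ac)
    qed (use P in simp)
    finally show ?thesis .
  qed
  moreover have "(norm (r k))\<^sup>2 \<le> \<kappa>\<^sup>2 * \<Delta>\<^sup>2 * P"
  proof -
    have "(norm (r k))\<^sup>2 \<le> (\<kappa> * P)\<^sup>2" using r by (intro power_mono) auto
    also have "\<dots> = \<kappa>\<^sup>2 * (P * P)" by (simp add: power2_eq_square)
    also have "\<dots> \<le> \<kappa>\<^sup>2 * (\<Delta>\<^sup>2 * P)" using P by (intro mult_left_mono mult_right_mono) auto
    finally show ?thesis by (simp add: mult_ac)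
  qed
  then have "\<rho> / 2 * (norm (r k))\<^sup>2 \<le> \<rho> / 2 * (\<kappa>\<^sup>2 * \<Delta>\<^sup>2 * P)" by (intro mult_left_mono) auto
  moreover have "(norm (c (x (Suc k))))\<^sup>2
      = (norm (c (x k)))\<^sup>2 + 2 * (c (x k) \<bullet> a) + (norm a)\<^sup>2 + 2 * ((c (x k) + a) \<bullet> r k) + (norm (r k))\<^sup>2"
    unfolding cS power2_norm_eq_inner by (simp add: inner_add_left inner_add_right inner_commute)
  then have "\<rho> / 2 * (norm (c (x (Suc k))))\<^sup>2 = \<rho> / 2 * (norm (c (x k)))\<^sup>2 + \<rho> * (c (x k) \<bullet> a)
      + \<rho> / 2 * (norm a)\<^sup>2 + \<rho> * ((c (x k) + a) \<bullet> r k) + \<rho> / 2 * (norm (r k))\<^sup>2"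
    by (simp add: algebra_simps)
  moreover have "l k \<bullet> c (x (Suc k)) = l k \<bullet> c (x k) + l k \<bullet> a + l k \<bullet> r k"
    by (simp add: cS inner_add_right)
  moreover have "\<beta> * P + \<rho> * (norm a)\<^sup>2 = - (v k \<bullet> p k) - l k \<bullet> a - \<rho> * (c (x k) \<bullet> a)"
    using arg_cong[OF p_eq[OF k], of "\<lambda>y. y \<bullet> p k"]
    by (simp add: inner_add_left inner_diff_left inner_matrix_vector_left a_def[symmetric]
        power2_norm_eq_inner P_def del: transpose_matrix_vector)
  moreover have "v k \<bullet> p k = g (x k) \<bullet> p k + e k \<bullet> p k" by (simp add: e_def inner_diff_left)
  \<comment> \<open>Young's inequality, weighted so that exactly \<open>\<beta> / 8\<close> of the
    squared step is spent.\<close>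
  moreover have "- (e k \<bullet> p k) \<le> \<beta> / 8 * P + 2 / \<beta> * (norm (e k))\<^sup>2"
  proof -
    have "- (e k \<bullet> p k) \<le> norm (e k) * norm (p k)"
      using norm_cauchy_schwarz[of "- e k" "p k"] by simp
    moreover have "0 \<le> \<beta> / 8 * (norm (p k) - 4 / \<beta> * norm (e k))\<^sup>2" by simp
    moreover have "\<beta> / 8 * (norm (p k) - 4 / \<beta> * norm (e k))\<^sup>2
        = \<beta> / 8 * P + 2 / \<beta> * (norm (e k))\<^sup>2 - norm (e k) * norm (p k)"
      unfolding P_def by (simp add: power2_eq_square field_simps)
    ultimately show ?thesis by linarith
  qed
  moreover have "C_mod q * P \<le> 3 * \<beta> / 8 * P"
    using params P by (intro mult_right_mono) (auto simp: parameter_assumption_def)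
  \<comment> \<open>The \<open>3 * \<Lambda>\<close> in \<open>C_mod\<close> combines
    \<open>\<Lambda>\<close> from the multiplier term with \<open>2 * \<Lambda>\<close> from the
    penalty cross term.\<close>
  moreover have "C_mod q * P = L_f q / 2 * P + \<Lambda> * (\<kappa> * P) + (2 * \<Lambda> + \<rho> * M_c q * \<Delta>) * (\<kappa> * P)
      + \<rho> / 2 * (\<kappa>\<^sup>2 * \<Delta>\<^sup>2 * P)"
    by (simp add: C_mod_def algebra_simps)
  moreover have "0 \<le> \<rho> / 2 * (norm a)\<^sup>2" by simp
  moreover have "\<rho> * (norm a)\<^sup>2 = \<rho> / 2 * (norm a)\<^sup>2 + \<rho> / 2 * (norm a)\<^sup>2" by simp
  moreover have "\<beta> * P = \<beta> / 2 * P + 3 * \<beta> / 8 * P + \<beta> / 8 * P" by simp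
  ultimately show ?thesis
    using f1 l1 unfolding lagrangian_def P_def[symmetric] by linarith
qed

text \<open>Subtract the approximate stationarity identities of two consecutive steps and invert the
  Jacobian with \<open>sig_c\<close>. Squaring the four resulting terms gives the factor 4 in
  \<open>C_lam_p\<close> and \<open>C_lam_e\<close>.\<close>

lemma multiplier_increment:
  assumes k: "Suc k < N"
  shows "(norm (l (Suc (Suc k)) - l (Suc k)))\<^sup>2
    \<le> C_lam_p q * ((norm (p (Suc k)))\<^sup>2 + (norm (p k))\<^sup>2)
      + C_lam_e q * ((norm (e (Suc k)))\<^sup>2 + (norm (e k))\<^sup>2)"
proof -
  let ?k = "Suc k"
  have k': "k < N" using k by simp
  let ?A = "A_p q" and ?B = "B_p q"
  note U = visited_U[OF k] visited_U[OF k']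
  \<comment> \<open>The earlier identity lives at \<open>x k\<close>; moving its Jacobian to the new
    point costs the bracket with two Jacobians, which is the \<open>L_c q * \<Lambda>\<close> part
    of \<open>B_p\<close>.\<close>
  have split: "J (x ?k) *v (l (Suc ?k) - l ?k) =
      (- \<beta> *\<^sub>R p ?k + \<rho> *\<^sub>R (J (x ?k) *v r ?k)) + (\<beta> *\<^sub>R p k - \<rho> *\<^sub>R (J (x k) *v r k))
      - (g (x ?k) - g (x k)) - (J (x ?k) *v l ?k - J (x k) *v l ?k) - e ?k + e k"
    using jac_multiplier[OF k] jac_multiplier[OF k']
    by (simp add: matrix_vector_mult_diff_distrib e_def)
  have "norm (J (x ?k) *v (l (Suc ?k) - l ?k)) \<le> (norm (- \<beta> *\<^sub>R p ?k) + norm (\<rho> *\<^sub>R (J (x ?k) *v r ?k)))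
      + (norm (\<beta> *\<^sub>R p k) + norm (\<rho> *\<^sub>R (J (x k) *v r k)))
      + norm (g (x ?k) - g (x k)) + norm (J (x ?k) *v l ?k - J (x k) *v l ?k) + norm (e ?k) + norm (e k)"
    unfolding split by (rule norm_triangle8)
  also have "\<dots> \<le> ?A * norm (p ?k) + ?B * norm (p k) + norm (e ?k) + norm (e k)"
  proof -
    have combine: "(n1 + n2) + (n3 + n4) + n5 + n6 + d1 + d0 \<le> a + b + d1 + d0"
      if "n5 \<le> t5" "n6 \<le> t6" "n1 = t1" "n3 = t3" "a = t1 + t2" "b = t3 + t4 + t5 + t6" "n2 \<le> t2" "n4 \<le> t4"
      for n1 n2 n3 n4 n5 n6 d1 d0 t1 t2 t3 t4 t5 t6 a b :: real
      using that by linarith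
    have gbd: "norm (g (x ?k) - g (x k)) \<le> L_f q * norm (p k)"
      using grad_lip[OF U] by (simp add: x_Suc[OF k'])
    have jbd: "norm (J (x ?k) *v l ?k - J (x k) *v l ?k) \<le> L_c q * \<Lambda> * norm (p k)"
      using jac_diff_multiplier_bound[OF U l_bound[of ?k]] k by (simp add: x_Suc[OF k'])
    have n: "norm (- \<beta> *\<^sub>R p ?k) = \<beta> * norm (p ?k)" "norm (\<beta> *\<^sub>R p k) = \<beta> * norm (p k)"
      by simp_all
    have AB: "A_p q * norm (p ?k) = \<beta> * norm (p ?k) + \<rho> * M_c q * \<kappa> * \<Delta> * norm (p ?k)"
      "B_p q * norm (p k) = \<beta> * norm (p k) + \<rho> * M_c q * \<kappa> * \<Delta> * norm (p k)
        + L_f q * norm (p k) + L_c q * \<Lambda> * norm (p k)"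
      by (simp_all only: A_p_def B_p_def distrib_right)
    show ?thesis
      by (rule combine[OF gbd jbd n AB jac_r_bound[OF k k] jac_r_bound[OF k' k']])
  qed
  finally have "norm (J (x ?k) *v (l (Suc ?k) - l ?k))
    \<le> ?A * norm (p ?k) + ?B * norm (p k) + norm (e ?k) + norm (e k)" .
  with jac_lower[OF U(1)]
  have "sig_c q * norm (l (Suc ?k) - l ?k)
    \<le> ?A * norm (p ?k) + ?B * norm (p k) + norm (e ?k) + norm (e k)"
    by (rule order_trans)
  then have "(sig_c q * norm (l (Suc ?k) - l ?k))\<^sup>2
    \<le> (?A * norm (p ?k) + ?B * norm (p k) + norm (e ?k) + norm (e k))\<^sup>2"
    by (intro power_mono) auto
  also have "\<dots> \<le> 4 * ((?A * norm (p ?k))\<^sup>2 + (?B * norm (p k))\<^sup>2 + (norm (e ?k))\<^sup>2 + (norm (e k))\<^sup>2)"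
    by (rule power2_sum4_le)
  also have "\<dots> \<le> 4 * (max (?A\<^sup>2) (?B\<^sup>2) * ((norm (p ?k))\<^sup>2 + (norm (p k))\<^sup>2)
      + ((norm (e ?k))\<^sup>2 + (norm (e k))\<^sup>2))"
  proof -
    have "(?A * norm (p ?k))\<^sup>2 \<le> max (?A\<^sup>2) (?B\<^sup>2) * (norm (p ?k))\<^sup>2"
      "(?B * norm (p k))\<^sup>2 \<le> max (?A\<^sup>2) (?B\<^sup>2) * (norm (p k))\<^sup>2"
      by (simp_all only: power_mult_distrib) (intro mult_right_mono, simp_all)+
    then show ?thesis by (simp add: distrib_left)
  qed
  finally have "(norm (l (Suc ?k) - l ?k))\<^sup>2 \<le> 4 * (max (?A\<^sup>2) (?B\<^sup>2) * ((norm (p ?k))\<^sup>2 + (norm (p k))\<^sup>2)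
      + ((norm (e ?k))\<^sup>2 + (norm (e k))\<^sup>2)) / (sig_c q)\<^sup>2"
    by (simp add: power_mult_distrib pos_le_divide_eq mult_ac)
  then show ?thesis by (simp add: C_lam_p_def C_lam_e_def add_divide_distrib distrib_left)
qed

text \<open>Subtraction truncates at \<open>k = 0\<close>: only the values from index 1 on are used.\<close>

definition "\<Phi> k = lagrangian (x k) (l k) + C_lam_p q / \<rho> * (norm (p (k - 1)))\<^sup>2"

text \<open>The dual update raises the Lagrangian. This increase is what the extra squared step in
  \<open>\<Phi>\<close> has to pay for.\<close>

lemma lagrangian_dual_step:
  assumes "k < N"
  shows "lagrangian (x (Suc k)) (l (Suc k))
    = lagrangian (x (Suc k)) (l k) + (norm (l (Suc k) - l k))\<^sup>2 / \<rho>"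
proof -
  have d: "l (Suc k) - l k = \<rho> *\<^sub>R c (x (Suc k))" by (simp add: l_Suc[OF assms])
  have "(norm (l (Suc k) - l k))\<^sup>2 / \<rho> = (l (Suc k) - l k) \<bullet> c (x (Suc k))"
    unfolding d power2_norm_eq_inner by simp
  then show ?thesis by (simp add: lagrangian_def inner_diff_left)
qed

text \<open>The dual increase costs \<open>C_lam_p q / \<rho>\<close> times both squared steps. The
  older one is paid by the extra term of \<open>\<Phi>\<close>; the newer one occurs twice, once
  here and once in the new extra term. The condition
  \<open>\<rho> \<ge> 8 * C_lam_p q / \<beta>\<close> makes each at most \<open>\<beta> / 8\<close>,
  leaving \<open>\<beta> / 4\<close> of the primal \<open>\<beta> / 2\<close>.\<close>

lemma \<Phi>_descent:
  assumes k: "Suc k < N"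
  shows "\<Phi> (Suc (Suc k)) \<le> \<Phi> (Suc k) - \<beta> / 4 * (norm (p (Suc k)))\<^sup>2
    + C_e_star q * ((norm (e (Suc k)))\<^sup>2 + (norm (e k))\<^sup>2)"
proof -
  define P1 P0 E1 E0 where defs: "P1 = (norm (p (Suc k)))\<^sup>2" "P0 = (norm (p k))\<^sup>2"
    "E1 = (norm (e (Suc k)))\<^sup>2" "E0 = (norm (e k))\<^sup>2"
  have nn: "P1 \<ge> 0" "E0 \<ge> 0" by (simp_all add: defs)
  have "(norm (l (Suc (Suc k)) - l (Suc k)))\<^sup>2 / \<rho> \<le> (C_lam_p q * (P1 + P0) + C_lam_e q * (E1 + E0)) / \<rho>"
    using multiplier_increment[OF k] by (intro divide_right_mono) (simp_all add: defs)
  also have "\<dots> = C_lam_p q / \<rho> * P1 + C_lam_p q / \<rho> * P0 + C_lam_e q / \<rho> * E1 + C_lam_e q / \<rho> * E0"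
    by (simp add: distrib_left add_divide_distrib)
  finally have dual: "(norm (l (Suc (Suc k)) - l (Suc k)))\<^sup>2 / \<rho> \<le> \<dots>" .
  have dom: "C_lam_p q / \<rho> * P1 \<le> \<beta> / 8 * P1"
    using params nn by (intro mult_right_mono) (auto simp: parameter_assumption_def field_simps)
  have split: "\<beta> / 2 * P1 = \<beta> / 4 * P1 + \<beta> / 8 * P1 + \<beta> / 8 * P1" by simp
  have ce: "C_e_star q * (E1 + E0) = 2 / \<beta> * E1 + 2 / \<beta> * E0 + C_lam_e q / \<rho> * E1 + C_lam_e q / \<rho> * E0"
    by (simp add: C_e_star_def ring_distribs add_divide_distrib add_ac)
  \<comment> \<open>Slack that gives both errors the common coefficient \<open>C_e_star\<close>; the
    primal descent itself involves only the newer error.\<close>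
  have e0: "0 \<le> 2 / \<beta> * E0" using nn by simp
  have combine: "l2 + a1 \<le> l0 + a0 - b4 + ce"
    if "d \<le> a1 + a0 + c1 + c0" "a1 \<le> b8" "b2 = b4 + b8 + b8" "ce = e1 + e0 + c1 + c0" "0 \<le> e0"
      "l2 = l1 + d" "l1 \<le> l0 - b2 + e1"
    for l2 a1 l0 a0 b4 ce d c1 c0 b8 b2 e1 e0 l1 :: real
    using that by linarith
  show ?thesis
    unfolding \<Phi>_def diff_Suc_1 defs[symmetric]
    by (rule combine[OF dual dom split ce e0 lagrangian_dual_step[OF k]
          lagrangian_primal_descent[OF k, folded defs]])
qed

text \<open>Descent compares two consecutive steps and so starts at index 1; \<open>Phi_up\<close>
  is the crude bound of \<open>\<Phi>\<close> there, its
  \<open>4 * \<Lambda>\<^sup>2 / \<rho>\<close> being equal shares of the multiplier and the penalty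
  term.\<close>

lemma \<Phi>_first:
  assumes "0 < N"
  shows "\<Phi> 1 \<le> Phi_up q f x0"
proof -
  have f: "f (x 1) \<le> f x0 + G_f q * \<Delta>"
    using f_step_le[OF visited[OF assms] p_bound[OF assms]] x_Suc[OF assms] start by simp
  have c: "norm (c (x 1)) \<le> 2 * \<Lambda> / \<rho>" using c_bound[of 1] assms by (simp add: field_simps)
  have "l 1 \<bullet> c (x 1) \<le> norm (l 1) * norm (c (x 1))" by (rule norm_cauchy_schwarz)
  also have "\<dots> \<le> \<Lambda> * (2 * \<Lambda> / \<rho>)" using c l_bound[of 1] assms by (intro mult_mono) auto
  finally have "l 1 \<bullet> c (x 1) \<le> 2 * \<Lambda>\<^sup>2 / \<rho>" by (simp add: power2_eq_square mult_ac)
  moreover have "\<rho> / 2 * (norm (c (x 1)))\<^sup>2 \<le> 2 * \<Lambda>\<^sup>2 / \<rho>"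
  proof -
    have "\<rho> / 2 * (norm (c (x 1)))\<^sup>2 \<le> \<rho> / 2 * (2 * \<Lambda> / \<rho>)\<^sup>2"
      using c by (intro mult_left_mono power_mono) auto
    also have "\<dots> = 2 * \<Lambda>\<^sup>2 / \<rho>" by (simp add: power2_eq_square)
    finally show ?thesis .
  qed
  moreover have "C_lam_p q / \<rho> * (norm (p 0))\<^sup>2 \<le> C_lam_p q / \<rho> * \<Delta>\<^sup>2"
    using p_bound[OF assms] C_lam_p_nonneg by (intro mult_left_mono power_mono) auto
  moreover have "4 * \<Lambda>\<^sup>2 / \<rho> = 2 * \<Lambda>\<^sup>2 / \<rho> + 2 * \<Lambda>\<^sup>2 / \<rho>" by simp
  moreover have "\<Phi> 1 = f (x 1) + l 1 \<bullet> c (x 1) + \<rho> / 2 * (norm (c (x 1)))\<^sup>2 + C_lam_p q / \<rho> * (norm (p 0))\<^sup>2"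
    by (simp only: \<Phi>_def lagrangian_def diff_self_eq_0)
  ultimately show ?thesis using f unfolding Phi_up_def by linarith
qed

text \<open>Completing the square in \<open>l k + \<rho> *\<^sub>R c (x k)\<close> shows that the
  Lagrangian terms lose at most \<open>|l|^2 / (2 * \<rho>)\<close>. This yields both the lower
  bound \<open>Phi_low\<close> and control of the objective at exit.\<close>

lemma f_le_\<Phi>:
  assumes "k \<le> N"
  shows "f (x k) \<le> \<Phi> k + \<Lambda>\<^sup>2 / (2 * \<rho>)"
proof -
  have "0 \<le> (norm (l k + \<rho> *\<^sub>R c (x k)))\<^sup>2 / (2 * \<rho>)" by simp
  also have "\<dots> = ((norm (l k))\<^sup>2 + 2 * \<rho> * (l k \<bullet> c (x k)) + \<rho>\<^sup>2 * (norm (c (x k)))\<^sup>2) / (2 * \<rho>)"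
    unfolding power2_norm_eq_inner
    by (simp add: inner_add_left inner_add_right inner_commute power2_eq_square algebra_simps)
  also have "\<dots> = (norm (l k))\<^sup>2 / (2 * \<rho>) + l k \<bullet> c (x k) + \<rho> / 2 * (norm (c (x k)))\<^sup>2"
    by (simp add: add_divide_distrib power2_eq_square)
  also have "(norm (l k))\<^sup>2 / (2 * \<rho>) \<le> \<Lambda>\<^sup>2 / (2 * \<rho>)"
    using l_bound[OF assms] by (intro divide_right_mono power_mono) auto
  finally have "0 \<le> \<Lambda>\<^sup>2 / (2 * \<rho>) + l k \<bullet> c (x k) + \<rho> / 2 * (norm (c (x k)))\<^sup>2" by simp
  moreover have "0 \<le> C_lam_p q / \<rho> * (norm (p (k - 1)))\<^sup>2" using C_lam_p_nonneg by simp
  ultimately show ?thesis unfolding \<Phi>_def lagrangian_def by simp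
qed

lemma \<Phi>_telescope:
  "Suc n \<le> N \<Longrightarrow> \<Phi> (Suc n) + \<beta> / 4 * (\<Sum>k<n. (norm (p (Suc k)))\<^sup>2)
    \<le> Phi_up q f x0 + C_e_star q * ((\<Sum>k<n. (norm (e (Suc k)))\<^sup>2) + (\<Sum>k<n. (norm (e k))\<^sup>2))"
proof (induction n)
  case 0
  then show ?case using \<Phi>_first by simp
next
  case (Suc n)
  then show ?case using \<Phi>_descent[of n] by (simp add: distrib_left algebra_simps)
qed

section \<open>Summed steps, errors and residuals\<close>

definition "sum_e = (\<Sum>k<N. (norm (e k))\<^sup>2)"
definition "sum_p = (\<Sum>k<N. (norm (p k))\<^sup>2)"

text \<open>Each error enters at most two consecutive descent inequalities, hence the factor 2. Step
  0 precedes them all and is therefore taken out of \<open>sum_p\<close>.\<close>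

lemma \<Phi>_last:
  assumes "0 < N"
  shows "\<Phi> N + \<beta> / 4 * (sum_p - (norm (p 0))\<^sup>2) \<le> Phi_up q f x0 + 2 * C_e_star q * sum_e"
proof -
  obtain n where n: "N = Suc n" using assms by (cases N) auto
  have "sum_p = (norm (p 0))\<^sup>2 + (\<Sum>k<n. (norm (p (Suc k)))\<^sup>2)"
    "sum_e = (norm (e 0))\<^sup>2 + (\<Sum>k<n. (norm (e (Suc k)))\<^sup>2)"
    unfolding sum_p_def sum_e_def by (simp_all only: n sum.lessThan_Suc_shift)
  moreover have "sum_e = (\<Sum>k<n. (norm (e k))\<^sup>2) + (norm (e n))\<^sup>2"
    unfolding sum_e_def by (simp only: n sum.lessThan_Suc)
  moreover from calculation have "C_e_star q * ((\<Sum>k<n. (norm (e (Suc k)))\<^sup>2) + (\<Sum>k<n. (norm (e k))\<^sup>2))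
      \<le> C_e_star q * (2 * sum_e)"
    using C_e_star_pos zero_le_power2[of "norm (e 0)"] zero_le_power2[of "norm (e n)"]
    by (intro mult_left_mono) linarith+
  moreover from calculation have diff: "sum_p - (norm (p 0))\<^sup>2 = (\<Sum>k<n. (norm (p (Suc k)))\<^sup>2)"
    by linarith
  moreover note \<Phi>_telescope[of n, folded n, OF order_refl]
  ultimately show ?thesis
    unfolding diff mult.left_commute[of 2 "C_e_star q"] mult.assoc by (simp only: add_left_mono order_trans)
qed

lemma sum_p_nonneg: "0 \<le> sum_p" and sum_e_nonneg: "0 \<le> sum_e"
  unfolding sum_p_def sum_e_def by (simp_all add: sum_nonneg)

lemma f_last:
  assumes "0 < N"
  shows "f (x N) \<le> H_det q f x0 + 2 * C_e_star q * sum_e"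
proof -
  have "(norm (p 0))\<^sup>2 \<le> sum_p"
    unfolding sum_p_def using assms by (intro member_le_sum) auto
  then have "0 \<le> \<beta> / 4 * (sum_p - (norm (p 0))\<^sup>2)" by simp
  then show ?thesis using \<Phi>_last[OF assms] f_le_\<Phi>[of N] unfolding H_det_def by linarith
qed

lemma sum_p_le: "sum_p \<le> D_0 q f x0 + D_1 q * sum_e"
proof (cases "N = 0")
  case True
  have "sum_p = 0" "sum_e = 0"
    unfolding sum_p_def sum_e_def by (simp_all only: True lessThan_0 sum.empty)
  then show ?thesis using D_0_pos by simp
next
  case False
  then have N: "0 < N" by simp
  have "Phi_low q \<le> \<Phi> N"
    using f_le_\<Phi>[of N] f_lower[OF iterate_in_U[of N]] unfolding Phi_low_def by simp
  with \<Phi>_last[OF N] have "\<beta> / 4 * (sum_p - (norm (p 0))\<^sup>2) \<le> Phi_up q f x0 - Phi_low q + 2 * C_e_star q * sum_e"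
    by linarith
  then have "sum_p \<le> (norm (p 0))\<^sup>2 + 4 * (Phi_up q f x0 - Phi_low q + 2 * C_e_star q * sum_e) / \<beta>"
    by (simp add: field_simps)
  \<comment> \<open>The step missing from the telescoped sum; it accounts for the summand
    \<open>\<Delta>\<^sup>2\<close> of \<open>D_0\<close>.\<close>
  moreover have "(norm (p 0))\<^sup>2 \<le> \<Delta>\<^sup>2" using p_bound[OF N] by (intro power_mono) auto
  moreover have "4 * (Phi_up q f x0 - Phi_low q + 2 * C_e_star q * sum_e) / \<beta>
      = 4 * (Phi_up q f x0 - Phi_low q) / \<beta> + 8 * C_e_star q / \<beta> * sum_e"
    by (simp add: field_simps)
  ultimately show ?thesis unfolding D_0_def D_1_def by linarith
qed

text \<open>Stationarity follows from \<open>jac_multiplier\<close> after moving gradient and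
  Jacobian to the new point. For feasibility, the dual update makes the constraint value a
  multiplier increment divided by \<open>\<rho>\<close>, so \<open>multiplier_increment\<close>
  applies again.\<close>

lemma residual_le:
  assumes k: "Suc k < N"
  shows "(kkt_residual f c (x (Suc (Suc k))) (l (Suc (Suc k))))\<^sup>2
    \<le> C_R_st q * ((norm (p (Suc k)))\<^sup>2 + (norm (p k))\<^sup>2 + ((norm (e (Suc k)))\<^sup>2 + (norm (e k))\<^sup>2))"
proof -
  let ?k = "Suc k" and ?y = "x (Suc (Suc k))" and ?m = "l (Suc (Suc k))"
  define P1 P0 E1 E0 where defs: "P1 = (norm (p ?k))\<^sup>2" "P0 = (norm (p k))\<^sup>2"
    "E1 = (norm (e ?k))\<^sup>2" "E0 = (norm (e k))\<^sup>2"
  have nn: "P1 \<ge> 0" "P0 \<ge> 0" "E1 \<ge> 0" "E0 \<ge> 0" by (simp_all add: defs)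
  have y: "?y \<in> U" using iterate_in_U[of "Suc ?k"] k by simp
  note xk = visited_U[OF k]
  have split: "g ?y + J ?y *v ?m = (g ?y - g (x ?k)) + (J ?y *v ?m - J (x ?k) *v ?m)
      - \<beta> *\<^sub>R p ?k - e ?k + \<rho> *\<^sub>R (J (x ?k) *v r ?k)"
    using jac_multiplier[OF k] by (simp add: e_def)
  have "norm (g ?y + J ?y *v ?m) \<le> norm (g ?y - g (x ?k)) + norm (J ?y *v ?m - J (x ?k) *v ?m)
      + norm (\<beta> *\<^sub>R p ?k) + norm (e ?k) + norm (\<rho> *\<^sub>R (J (x ?k) *v r ?k))"
    unfolding split by (rule norm_triangle5)
  also have "\<dots> \<le> C_s q * norm (p ?k) + norm (e ?k)"
  proof -
    have gbd: "norm (g ?y - g (x ?k)) \<le> L_f q * norm (p ?k)"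
      using grad_lip[OF y xk] by (simp add: x_Suc[OF k])
    have jbd: "norm (J ?y *v ?m - J (x ?k) *v ?m) \<le> L_c q * \<Lambda> * norm (p ?k)"
      using jac_diff_multiplier_bound[OF y xk l_bound[of "Suc ?k"]] k by (simp add: x_Suc[OF k])
    have n: "norm (\<beta> *\<^sub>R p ?k) = \<beta> * norm (p ?k)" by simp
    have Cs: "C_s q * norm (p ?k) = \<beta> * norm (p ?k) + \<rho> * M_c q * \<kappa> * \<Delta> * norm (p ?k)
        + L_f q * norm (p ?k) + L_c q * \<Lambda> * norm (p ?k)"
      by (simp only: C_s_def distrib_right)
    have combine: "n1 + n2 + n3 + d + n5 \<le> a + d"
      if "n1 \<le> t1" "n2 \<le> t2" "n3 = t3" "a = t3 + t5 + t1 + t2" "n5 \<le> t5"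
      for n1 n2 n3 n5 d t1 t2 t3 t5 a :: real
      using that by linarith
    show ?thesis by (rule combine[OF gbd jbd n Cs jac_r_bound[OF k k]])
  qed
  finally have "(norm (g ?y + J ?y *v ?m))\<^sup>2 \<le> (C_s q * norm (p ?k) + norm (e ?k))\<^sup>2"
    by (intro power_mono) auto
  also have "\<dots> \<le> 2 * (C_s q)\<^sup>2 * P1 + 2 * E1"
    using power2_sum2_le[of "C_s q * norm (p ?k)" "norm (e ?k)"] by (simp add: power_mult_distrib defs)
  finally have stat: "(norm (g ?y + J ?y *v ?m))\<^sup>2 \<le> 2 * (C_s q)\<^sup>2 * P1 + 2 * E1" .
  have "c ?y = (1 / \<rho>) *\<^sub>R (?m - l ?k)" by (simp add: l_Suc[OF k])
  then have "(norm (c ?y))\<^sup>2 = (norm (?m - l ?k))\<^sup>2 / \<rho>\<^sup>2"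
    by (simp add: power_divide)
  also have "\<dots> \<le> (C_lam_p q * (P1 + P0) + C_lam_e q * (E1 + E0)) / \<rho>\<^sup>2"
    using multiplier_increment[OF k] by (intro divide_right_mono) (simp_all add: defs)
  also have "\<dots> = C_lam_p q / \<rho>\<^sup>2 * (P1 + P0) + C_lam_e q / \<rho>\<^sup>2 * (E1 + E0)"
    by (simp add: add_divide_distrib)
  finally have feas: "(norm (c ?y))\<^sup>2 \<le> C_lam_p q / \<rho>\<^sup>2 * (P1 + P0) + C_lam_e q / \<rho>\<^sup>2 * (E1 + E0)" .
  have "(2 * (C_s q)\<^sup>2 + C_lam_p q / \<rho>\<^sup>2) * (P1 + P0) \<le> C_R_st q * (P1 + P0)"
    "(2 + C_lam_e q / \<rho>\<^sup>2) * (E1 + E0) \<le> C_R_st q * (E1 + E0)"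
    unfolding C_R_st_def using nn by (intro mult_right_mono, simp_all)+
  moreover have "(2 * (C_s q)\<^sup>2 + C_lam_p q / \<rho>\<^sup>2) * (P1 + P0)
      = 2 * (C_s q)\<^sup>2 * P1 + 2 * (C_s q)\<^sup>2 * P0 + C_lam_p q / \<rho>\<^sup>2 * (P1 + P0)"
    "(2 + C_lam_e q / \<rho>\<^sup>2) * (E1 + E0) = 2 * E1 + 2 * E0 + C_lam_e q / \<rho>\<^sup>2 * (E1 + E0)"
    by (simp_all add: algebra_simps)
  moreover have "0 \<le> 2 * (C_s q)\<^sup>2 * P0" "0 \<le> 2 * E0" using nn by simp_all
  moreover have "(kkt_residual f c ?y ?m)\<^sup>2 = (norm (g ?y + J ?y *v ?m))\<^sup>2 + (norm (c ?y))\<^sup>2"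
    by (simp add: kkt_residual_def)
  ultimately show ?thesis
    using stat feas unfolding defs[symmetric] distrib_left[of "C_R_st q" "P1 + P0"] by linarith
qed

lemma residual_sum_le:
  "(\<Sum>k=1..<N. (kkt_residual f c (x (k + 1)) (l (k + 1)))\<^sup>2) \<le> 2 * C_R_st q * (sum_p + sum_e)"
proof (cases "N = 0")
  case False
  then obtain n where n: "N = Suc n" by (cases N) auto
  have "(\<Sum>k=1..<N. (kkt_residual f c (x (k + 1)) (l (k + 1)))\<^sup>2)
      = (\<Sum>k<n. (kkt_residual f c (x (Suc (Suc k))) (l (Suc (Suc k))))\<^sup>2)"
    unfolding n by (simp only: One_nat_def sum.shift_bounds_Suc_ivl) (simp add: atLeast0LessThan)
  also have "\<dots> \<le> (\<Sum>k<n. C_R_st q * ((norm (p (Suc k)))\<^sup>2 + (norm (p k))\<^sup>2 + ((norm (e (Suc k)))\<^sup>2 + (norm (e k))\<^sup>2)))"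
    by (intro sum_mono residual_le) (simp add: n)
  also have "\<dots> = C_R_st q * ((\<Sum>k<n. (norm (p (Suc k)))\<^sup>2) + (\<Sum>k<n. (norm (p k))\<^sup>2)
      + ((\<Sum>k<n. (norm (e (Suc k)))\<^sup>2) + (\<Sum>k<n. (norm (e k))\<^sup>2)))"
    by (simp add: sum_distrib_left[symmetric] sum.distrib)
  also have "\<dots> \<le> C_R_st q * (2 * (sum_p + sum_e))"
  proof (rule mult_left_mono[OF _ C_R_st_nonneg])
    have "sum_p = (norm (p 0))\<^sup>2 + (\<Sum>k<n. (norm (p (Suc k)))\<^sup>2)"
      "sum_e = (norm (e 0))\<^sup>2 + (\<Sum>k<n. (norm (e (Suc k)))\<^sup>2)"
      unfolding sum_p_def sum_e_def by (simp_all only: n sum.lessThan_Suc_shift)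
    moreover have "sum_p = (\<Sum>k<n. (norm (p k))\<^sup>2) + (norm (p n))\<^sup>2"
      "sum_e = (\<Sum>k<n. (norm (e k))\<^sup>2) + (norm (e n))\<^sup>2"
      unfolding sum_p_def sum_e_def by (simp_all only: n sum.lessThan_Suc)
    moreover have "0 \<le> (norm (p 0))\<^sup>2" "0 \<le> (norm (p n))\<^sup>2" "0 \<le> (norm (e 0))\<^sup>2" "0 \<le> (norm (e n))\<^sup>2"
      by simp_all
    ultimately show "(\<Sum>k<n. (norm (p (Suc k)))\<^sup>2) + (\<Sum>k<n. (norm (p k))\<^sup>2)
      + ((\<Sum>k<n. (norm (e (Suc k)))\<^sup>2) + (\<Sum>k<n. (norm (e k))\<^sup>2)) \<le> 2 * (sum_p + sum_e)"
      unfolding distrib_left by linarith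
  qed
  finally show ?thesis by (simp add: algebra_simps)
qed (use C_R_st_nonneg sum_p_nonneg sum_e_nonneg in simp)

lemma c_last: "0 < N \<Longrightarrow> norm (c (x N)) \<le> 2 * \<Lambda> / \<rho>"
  using c_bound[of N] by (simp add: field_simps)

end

section \<open>Mini-batch variance\<close>

text \<open>The cross term has mean zero. Here \<open>u\<close> plays the part of the error already
  fixed by the past and \<open>W\<close> that of fresh noise.\<close>

lemma (in prob_space) nn_integral_norm_add_centered:
  fixes W :: "'a \<Rightarrow> 'b::euclidean_space"
  assumes W: "integrable M W" "integral\<^sup>L M W = 0"
    and S: "(\<integral>\<^sup>+s. ennreal ((norm (W s))\<^sup>2) \<partial>M) \<le> ennreal S" "0 \<le> S"
  shows "(\<integral>\<^sup>+s. ennreal ((norm (u + W s))\<^sup>2) \<partial>M) \<le> ennreal ((norm u)\<^sup>2 + S)"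
proof -
  have [measurable]: "W \<in> borel_measurable M" using W by simp
  have sq: "integrable M (\<lambda>s. (norm (W s))\<^sup>2)"
    using le_less_trans[OF S(1) ennreal_less_top] by (intro integrableI_bounded) auto
  have exp: "(norm (u + W s))\<^sup>2 = (norm u)\<^sup>2 + 2 * (u \<bullet> W s) + (norm (W s))\<^sup>2" for s
    by (simp add: power2_norm_eq_inner inner_add_left inner_add_right inner_commute)
  have int: "integrable M (\<lambda>s. (norm (u + W s))\<^sup>2)"
    unfolding exp using W sq by auto
  have "(\<integral>s. (norm (u + W s))\<^sup>2 \<partial>M) = (norm u)\<^sup>2 + (\<integral>s. (norm (W s))\<^sup>2 \<partial>M)"
    unfolding exp using W sq by (simp add: prob_space)
  also have "(\<integral>s. (norm (W s))\<^sup>2 \<partial>M) \<le> S"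
  proof -
    have "ennreal (\<integral>s. (norm (W s))\<^sup>2 \<partial>M) \<le> ennreal S"
      using S(1) sq by (subst nn_integral_eq_integral[symmetric]) auto
    then show ?thesis using S(2) by simp
  qed
  finally show ?thesis
    using int by (subst nn_integral_eq_integral) (auto intro: ennreal_leI)
qed

text \<open>Induction over the batch: the newest sample is integrated out with all others frozen, so
  that these merely join \<open>u\<close> and only one cross term arises at a time.\<close>

lemma nn_integral_norm_sum_centered:
  fixes W :: "'x \<Rightarrow> 'b::euclidean_space"
  assumes P: "prob_space P" and W: "integrable P W" "integral\<^sup>L P W = 0"
    and S: "(\<integral>\<^sup>+s. ennreal ((norm (W s))\<^sup>2) \<partial>P) \<le> ennreal S" "0 \<le> S" and I: "finite I"
  shows "(\<integral>\<^sup>+z. ennreal ((norm (u + (\<Sum>i\<in>I. W (z i))))\<^sup>2) \<partial>(\<Pi>\<^sub>M i\<in>I. P))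
    \<le> ennreal ((norm u)\<^sup>2 + real (card I) * S)"
  using I
proof (induction I)
  case empty
  interpret prob_space P by fact
  interpret PS: product_sigma_finite "\<lambda>_. P" by standard
  show ?case by (simp add: PiM_empty nn_integral_count_space_finite)
next
  case (insert i I)
  interpret prob_space P by fact
  interpret PS: product_sigma_finite "\<lambda>_. P" by standard
  interpret PI: prob_space "\<Pi>\<^sub>M i\<in>I. P" by (rule prob_space_PiM) (rule P)
  have [measurable]: "W \<in> borel_measurable P" using W by simp
  have "(\<integral>\<^sup>+z. ennreal ((norm (u + (\<Sum>j\<in>insert i I. W (z j))))\<^sup>2) \<partial>(\<Pi>\<^sub>M j\<in>insert i I. P))
      = (\<integral>\<^sup>+z. \<integral>\<^sup>+y. ennreal ((norm (u + (\<Sum>j\<in>insert i I. W ((z(i := y)) j))))\<^sup>2) \<partial>P \<partial>(\<Pi>\<^sub>M j\<in>I. P))"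
    using insert by (intro PS.product_nn_integral_insert) auto
  also have "\<dots> = (\<integral>\<^sup>+z. \<integral>\<^sup>+y. ennreal ((norm ((u + (\<Sum>j\<in>I. W (z j))) + W y))\<^sup>2) \<partial>P \<partial>(\<Pi>\<^sub>M j\<in>I. P))"
  proof -
    have "(\<Sum>j\<in>insert i I. W ((z(i := y)) j)) = W y + (\<Sum>j\<in>I. W (z j))" for z y
      using insert by (subst sum.insert) (auto intro!: sum.cong)
    then show ?thesis by (simp add: add_ac)
  qed
  also have "\<dots> \<le> (\<integral>\<^sup>+z. ennreal ((norm (u + (\<Sum>j\<in>I. W (z j))))\<^sup>2 + S) \<partial>(\<Pi>\<^sub>M j\<in>I. P))"
    by (intro nn_integral_mono nn_integral_norm_add_centered W S)
  also have "\<dots> = (\<integral>\<^sup>+z. ennreal ((norm (u + (\<Sum>j\<in>I. W (z j))))\<^sup>2) \<partial>(\<Pi>\<^sub>M j\<in>I. P)) + ennreal S"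
    using S(2) by (simp add: nn_integral_add PI.emeasure_space_1)
  also have "\<dots> \<le> ennreal ((norm u)\<^sup>2 + real (card I) * S) + ennreal S"
    by (intro add_right_mono insert.IH)
  also have "\<dots> = ennreal ((norm u)\<^sup>2 + real (card (insert i I)) * S)"
    using S(2) insert by (subst ennreal_plus[symmetric]) (auto simp: algebra_simps)
  finally show ?case .
qed

lemma nn_integral_batch_mean:
  fixes D :: "'x \<Rightarrow> 'b::euclidean_space"
  assumes P: "prob_space P" and D: "has_bochner_integral P D \<mu>"
    and S: "(\<integral>\<^sup>+s. ennreal ((norm (D s - \<mu>))\<^sup>2) \<partial>P) \<le> ennreal S" "0 \<le> S" and n: "0 < n"
  shows "(\<integral>\<^sup>+z. ennreal ((norm (u + ((1 / real n) *\<^sub>R (\<Sum>i<n. D (z i)) - \<mu>)))\<^sup>2) \<partial>(\<Pi>\<^sub>M i\<in>{..<n}. P))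
    \<le> ennreal ((norm u)\<^sup>2 + S / real n)"
proof -
  interpret prob_space P by fact
  define W where "W s = (1 / real n) *\<^sub>R (D s - \<mu>)" for s
  have [measurable]: "D \<in> borel_measurable P" and int: "integrable P D" "integral\<^sup>L P D = \<mu>"
    using D by (auto simp: has_bochner_integral_iff)
  have W: "integrable P W" "integral\<^sup>L P W = 0"
    unfolding W_def using int by (auto simp: prob_space)
  have "(\<integral>\<^sup>+s. ennreal ((norm (W s))\<^sup>2) \<partial>P) = (\<integral>\<^sup>+s. ennreal (1 / (real n)\<^sup>2) * ennreal ((norm (D s - \<mu>))\<^sup>2) \<partial>P)"
    unfolding W_def by (simp add: power_mult_distrib ennreal_mult[symmetric] power_divide)
  also have "\<dots> = ennreal (1 / (real n)\<^sup>2) * (\<integral>\<^sup>+s. ennreal ((norm (D s - \<mu>))\<^sup>2) \<partial>P)"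
    by (rule nn_integral_cmult) simp
  also have "\<dots> \<le> ennreal (1 / (real n)\<^sup>2) * ennreal S" by (intro mult_left_mono S) simp
  also have "\<dots> = ennreal (S / (real n)\<^sup>2)" using S by (simp add: ennreal_mult[symmetric])
  finally have "(\<integral>\<^sup>+s. ennreal ((norm (W s))\<^sup>2) \<partial>P) \<le> ennreal (S / (real n)\<^sup>2)" .
  from nn_integral_norm_sum_centered[OF P W this, of "{..<n}" u]
  have "(\<integral>\<^sup>+z. ennreal ((norm (u + (\<Sum>i<n. W (z i))))\<^sup>2) \<partial>(\<Pi>\<^sub>M i\<in>{..<n}. P))
      \<le> ennreal ((norm u)\<^sup>2 + real n * (S / (real n)\<^sup>2))" using S by simp
  moreover have "(\<Sum>i<n. W (z i)) = (1 / real n) *\<^sub>R (\<Sum>i<n. D (z i)) - \<mu>" for z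
    using n unfolding W_def by (simp add: scaleR_sum_right[symmetric] sum_subtractf scaleR_diff_right sum_constant_scaleR)
  moreover have "real n * (S / (real n)\<^sup>2) = S / real n" using n by (simp add: power2_eq_square)
  ultimately show ?thesis by simp
qed

text \<open>Bridges the oracle smoothness, which bounds raw gradient differences, and the batch
  estimate, which wants centred ones.\<close>

lemma (in prob_space) nn_integral_variance_le_second_moment:
  fixes D :: "'a \<Rightarrow> 'b::euclidean_space"
  assumes D: "has_bochner_integral M D \<mu>"
    and S: "(\<integral>\<^sup>+s. ennreal ((norm (D s))\<^sup>2) \<partial>M) \<le> ennreal S" "0 \<le> S"
  shows "(\<integral>\<^sup>+s. ennreal ((norm (D s - \<mu>))\<^sup>2) \<partial>M) \<le> ennreal S"
proof -
  have [measurable]: "D \<in> borel_measurable M" and int: "integrable M D" "integral\<^sup>L M D = \<mu>"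
    using D by (auto simp: has_bochner_integral_iff)
  have sq: "integrable M (\<lambda>s. (norm (D s))\<^sup>2)"
    using le_less_trans[OF S(1) ennreal_less_top] by (intro integrableI_bounded) auto
  have exp: "(norm (D s - \<mu>))\<^sup>2 = (norm (D s))\<^sup>2 - 2 * (\<mu> \<bullet> D s) + (norm \<mu>)\<^sup>2" for s
    by (simp add: power2_norm_eq_inner inner_diff_left inner_diff_right inner_commute)
  have i: "integrable M (\<lambda>s. (norm (D s - \<mu>))\<^sup>2)"
    unfolding exp using int sq by auto
  have "(\<integral>s. (norm (D s - \<mu>))\<^sup>2 \<partial>M) = (\<integral>s. (norm (D s))\<^sup>2 \<partial>M) - (norm \<mu>)\<^sup>2"
    unfolding exp using int sq by (simp add: prob_space power2_norm_eq_inner)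
  then have "(\<integral>s. (norm (D s - \<mu>))\<^sup>2 \<partial>M) \<le> (\<integral>s. (norm (D s))\<^sup>2 \<partial>M)" by simp
  then have "ennreal (\<integral>s. (norm (D s - \<mu>))\<^sup>2 \<partial>M) \<le> ennreal (\<integral>s. (norm (D s))\<^sup>2 \<partial>M)" by (rule ennreal_leI)
  also have "\<dots> = (\<integral>\<^sup>+s. ennreal ((norm (D s))\<^sup>2) \<partial>M)" using sq by (subst nn_integral_eq_integral) auto
  finally have "ennreal (\<integral>s. (norm (D s - \<mu>))\<^sup>2 \<partial>M) \<le> ennreal S" using S(1) by (rule order_trans)
  then show ?thesis using i by (subst nn_integral_eq_integral) auto
qed

text \<open>Cramer's rule makes the dependence of the solution on the system visibly measurable.\<close>

definition cramer_solution :: "real^'n^'n \<Rightarrow> real^'n \<Rightarrow> real^'n" where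
  "cramer_solution A r = (\<chi> k. det (\<chi> i j. if j = k then r $ i else A $ i $ j) / det A)"

lemma cramer_solution_iff: "det A \<noteq> 0 \<Longrightarrow> A *v w = r \<longleftrightarrow> w = cramer_solution A r"
  unfolding cramer_solution_def by (rule cramer)

lemma continuous_on_det:
  fixes f :: "'a::topological_space \<Rightarrow> real^'n^'n"
  assumes "\<And>i j. continuous_on S (\<lambda>x. f x $ i $ j)"
  shows "continuous_on S (\<lambda>x. det (f x))"
  unfolding det_def by (intro continuous_intros assms)

text \<open>Each component is a quotient of continuous determinants; division by zero being zero, it
  is Borel on singular matrices too.\<close>

lemma borel_measurable_cramer_solution [measurable (raw)]:
  assumes [measurable]: "A \<in> borel_measurable M" "r \<in> borel_measurable M"
  shows "(\<lambda>\<omega>. cramer_solution (A \<omega>) (r \<omega>) :: real^'n) \<in> borel_measurable M"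
proof -
  have "(\<lambda>(A, r). cramer_solution A r :: real^'n) \<in> borel_measurable borel"
  proof (rule borel_measurable_euclidean_space[THEN iffD2], rule ballI)
    fix b :: "real^'n" assume "b \<in> Basis"
    then obtain k where b: "b = axis k 1" by (auto simp: Basis_vec_def)
    have c1: "continuous_on UNIV (\<lambda>p::(real^'n^'n) \<times> (real^'n). det (\<chi> i j. if j = k then snd p $ i else fst p $ i $ j))"
    proof (rule continuous_on_det)
      fix i j
      show "continuous_on UNIV (\<lambda>p::(real^'n^'n) \<times> (real^'n).
          (\<chi> i j. if j = k then snd p $ i else fst p $ i $ j) $ i $ j)"
        by (cases "j = k") (auto intro!: continuous_intros)
    qed
    have c2: "continuous_on UNIV (\<lambda>p::(real^'n^'n) \<times> (real^'n). det (fst p))"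
      by (rule continuous_on_det) (intro continuous_intros)
    have "(\<lambda>p::(real^'n^'n) \<times> (real^'n). det (\<chi> i j. if j = k then snd p $ i else fst p $ i $ j) / det (fst p))
        \<in> borel_measurable borel"
      by (intro borel_measurable_divide borel_measurable_continuous_onI c1 c2)
    then show "(\<lambda>x. (case x of (A, r) \<Rightarrow> cramer_solution A r) \<bullet> b) \<in> borel_measurable borel"
      by (simp add: cramer_solution_def b inner_axis case_prod_beta)
  qed
  from measurable_compose[OF borel_measurable_Pair[OF assms] this] show ?thesis by simp
qed

section \<open>Independence and restarts\<close>

text \<open>Fubini on the joint law: \<open>X\<close> is frozen while \<open>Y\<close> is integrated
  out. This takes the place of conditioning on the history.\<close>

lemma (in prob_space) nn_integral_indep_var:
  assumes ind: "indep_var S X T Y" and [measurable]: "\<phi> \<in> borel_measurable (S \<Otimes>\<^sub>M T)"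
  shows "(\<integral>\<^sup>+\<omega>. \<phi> (X \<omega>, Y \<omega>) \<partial>M) = (\<integral>\<^sup>+\<omega>. \<integral>\<^sup>+y. \<phi> (X \<omega>, y) \<partial>distr M T Y \<partial>M)"
proof -
  have [measurable]: "X \<in> measurable M S" "Y \<in> measurable M T"
    and eq: "distr M S X \<Otimes>\<^sub>M distr M T Y = distr M (S \<Otimes>\<^sub>M T) (\<lambda>\<omega>. (X \<omega>, Y \<omega>))"
    using ind by (auto simp: indep_var_distribution_eq)
  interpret Y: prob_space "distr M T Y" by (rule prob_space_distr) measurable
  have "(\<integral>\<^sup>+\<omega>. \<phi> (X \<omega>, Y \<omega>) \<partial>M) = (\<integral>\<^sup>+z. \<phi> z \<partial>(distr M S X \<Otimes>\<^sub>M distr M T Y))"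
    unfolding eq by (subst nn_integral_distr) simp_all
  also have "\<dots> = (\<integral>\<^sup>+x. \<integral>\<^sup>+y. \<phi> (x, y) \<partial>distr M T Y \<partial>distr M S X)"
    by (rule Y.nn_integral_fst[symmetric]) simp
  also have "\<dots> = (\<integral>\<^sup>+\<omega>. \<integral>\<^sup>+y. \<phi> (X \<omega>, y) \<partial>distr M T Y \<partial>M)"
  proof (rule nn_integral_distr)
    have "sets (S \<Otimes>\<^sub>M distr M T Y) = sets (S \<Otimes>\<^sub>M T)"
      by (intro sets_pair_measure_cong) simp_all
    then have "\<phi> \<in> borel_measurable (S \<Otimes>\<^sub>M distr M T Y)"
      using assms(2) measurable_cong_sets by blast
    then show "(\<lambda>x. \<integral>\<^sup>+y. \<phi> (x, y) \<partial>distr M T Y) \<in> borel_measurable (distr M S X)"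
      using Y.borel_measurable_nn_integral_fst by (simp cong: measurable_cong_sets)
  qed simp
  finally show ?thesis .
qed

text \<open>Moves the law of a batch from index triples to bare batch positions, the index set of
  the variance estimates.\<close>

lemma (in prob_space) distr_iid_reindex:
  assumes ind: "indep_vars (\<lambda>_. P) \<xi> I" and law: "\<And>t. t \<in> I \<Longrightarrow> distr M P (\<xi> t) = P"
    and P: "prob_space P" and f: "inj_on f N" "f ` N \<subseteq> I" and N: "N \<noteq> {}"
  shows "distr M (\<Pi>\<^sub>M i\<in>N. P) (\<lambda>\<omega>. \<lambda>i\<in>N. \<xi> (f i) \<omega>) = (\<Pi>\<^sub>M i\<in>N. P)"
proof -
  let ?J = "f ` N"
  have rv: "\<And>t. t \<in> I \<Longrightarrow> \<xi> t \<in> measurable M P" using ind by (auto simp: indep_vars_def)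
  have [measurable]: "(\<lambda>\<omega>. \<lambda>t\<in>?J. \<xi> t \<omega>) \<in> measurable M (\<Pi>\<^sub>M t\<in>?J. P)"
    by (rule measurable_restrict) (use rv f in auto)
  have J: "distr M (\<Pi>\<^sub>M t\<in>?J. P) (\<lambda>\<omega>. \<lambda>t\<in>?J. \<xi> t \<omega>) = (\<Pi>\<^sub>M t\<in>?J. P)"
  proof -
    have "distr M (\<Pi>\<^sub>M t\<in>?J. P) (\<lambda>\<omega>. \<lambda>t\<in>?J. \<xi> t \<omega>) = (\<Pi>\<^sub>M t\<in>?J. distr M P (\<xi> t))"
      by (rule indep_vars_iff_distr_eq_PiM'[THEN iffD1])
         (use N f rv indep_vars_subset[OF ind] in auto)
    also have "\<dots> = (\<Pi>\<^sub>M t\<in>?J. P)" by (rule PiM_cong) (use law f in auto)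
    finally show ?thesis .
  qed
  have [measurable]: "(\<lambda>y. \<lambda>i\<in>N. y (f i)) \<in> measurable (\<Pi>\<^sub>M t\<in>?J. P) (\<Pi>\<^sub>M i\<in>N. P)"
    by (rule measurable_restrict) simp
  have "distr M (\<Pi>\<^sub>M i\<in>N. P) (\<lambda>\<omega>. \<lambda>i\<in>N. \<xi> (f i) \<omega>)
      = distr (distr M (\<Pi>\<^sub>M t\<in>?J. P) (\<lambda>\<omega>. \<lambda>t\<in>?J. \<xi> t \<omega>)) (\<Pi>\<^sub>M i\<in>N. P) (\<lambda>y. \<lambda>i\<in>N. y (f i))"
    by (subst distr_distr) (auto intro!: arg_cong[where f="distr M _"] simp: comp_def fun_eq_iff)
  also have "\<dots> = (\<Pi>\<^sub>M i\<in>N. P)"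
    unfolding J by (rule distr_PiM_reindex) (use P f in auto)
  finally show ?thesis .
qed

text \<open>The \<open>j\<close>-th summand is a product over distinct attempts: rejection
  indicators of the earlier ones and the cost of attempt \<open>j\<close>. Independence factorizes
  it; how the cost of attempt \<open>j\<close> depends on its own acceptance does not
  matter.\<close>

lemma (in prob_space) restart_expectation_le:
  fixes W :: "nat \<Rightarrow> 'a \<Rightarrow> 'b" and \<delta> r :: real
  assumes ind: "indep_vars N W UNIV"
    and [measurable]: "\<And>j. Measurable.pred (N j) (R j)" "\<And>j. Y j \<in> borel_measurable (N j)"
    and \<delta>: "0 \<le> \<delta>" "\<delta> < 1" and r: "0 \<le> r"
    and rej: "\<And>j. emeasure M {\<omega> \<in> space M. R j (W j \<omega>)} \<le> ennreal \<delta>"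
    and cost: "\<And>j. (\<integral>\<^sup>+\<omega>. Y j (W j \<omega>) \<partial>M) \<le> ennreal r"
  shows "(\<integral>\<^sup>+\<omega>. (\<Sum>j. if \<forall>i<j. R i (W i \<omega>) then Y j (W j \<omega>) else 0) \<partial>M) \<le> ennreal (r / (1 - \<delta>))"
proof -
  have W [measurable]: "W j \<in> measurable M (N j)" for j using ind by (auto simp: indep_vars_def)
  have term_le: "(\<integral>\<^sup>+\<omega>. (if \<forall>i<j. R i (W i \<omega>) then Y j (W j \<omega>) else 0) \<partial>M) \<le> ennreal (\<delta> ^ j * r)" for j
  proof -
    \<comment> \<open>Indicators and cost in one family, so that the product formula for independent
      variables is applied once.\<close>
    define Z where "Z i w = (if i < j then (if R i w then 1 else 0) else Y i w)" for i w
    have Z [measurable]: "Z i \<in> borel_measurable (N i)" for i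
      unfolding Z_def by (cases "i < j") simp_all
    have "(\<integral>\<^sup>+\<omega>. (if \<forall>i<j. R i (W i \<omega>) then Y j (W j \<omega>) else 0) \<partial>M) = (\<integral>\<^sup>+\<omega>. (\<Prod>i\<in>{..j}. Z i (W i \<omega>)) \<partial>M)"
    proof (rule nn_integral_cong)
      fix \<omega>
      have "(\<Prod>i\<in>{..<j}. Z i (W i \<omega>)) = (if \<forall>i<j. R i (W i \<omega>) then 1 else 0)"
        unfolding Z_def by (auto intro!: prod.neutral)
      then show "(if \<forall>i<j. R i (W i \<omega>) then Y j (W j \<omega>) else 0) = (\<Prod>i\<in>{..j}. Z i (W i \<omega>))"
        using prod.lessThan_Suc[of "\<lambda>i. Z i (W i \<omega>)" j]
        by (simp only: lessThan_Suc_atMost) (auto simp: Z_def[of j])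
    qed
    also have "\<dots> = (\<Prod>i\<in>{..j}. \<integral>\<^sup>+\<omega>. Z i (W i \<omega>) \<partial>M)"
    proof (rule indep_vars_nn_integral)
      show "indep_vars (\<lambda>_. borel) (\<lambda>i \<omega>. Z i (W i \<omega>)) {..j}"
        by (rule indep_vars_compose2[OF indep_vars_subset[OF ind]]) auto
    qed auto
    also have "\<dots> = (\<Prod>i\<in>{..<j}. \<integral>\<^sup>+\<omega>. Z i (W i \<omega>) \<partial>M) * (\<integral>\<^sup>+\<omega>. Z j (W j \<omega>) \<partial>M)"
      by (simp add: lessThan_Suc_atMost[symmetric])
    also have "\<dots> \<le> (\<Prod>i\<in>{..<j}. ennreal \<delta>) * ennreal r"
    proof (rule mult_mono)
      have factor: "(\<integral>\<^sup>+\<omega>. Z i (W i \<omega>) \<partial>M) \<le> ennreal \<delta>" if "i < j" for i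
      proof -
        have "(\<integral>\<^sup>+\<omega>. Z i (W i \<omega>) \<partial>M) = (\<integral>\<^sup>+\<omega>. indicator {\<omega> \<in> space M. R i (W i \<omega>)} \<omega> \<partial>M)"
          by (rule nn_integral_cong) (use that in \<open>auto simp: Z_def\<close>)
        also have "\<dots> = emeasure M {\<omega> \<in> space M. R i (W i \<omega>)}" by (rule nn_integral_indicator) simp
        finally show ?thesis using rej by simp
      qed
      have "(\<Prod>i<m. \<integral>\<^sup>+\<omega>. Z i (W i \<omega>) \<partial>M) \<le> (\<Prod>i<m. ennreal \<delta>)" if "m \<le> j" for m
        using that
      proof (induction m)
        case (Suc m)
        then show ?case unfolding prod.lessThan_Suc by (intro mult_mono factor) auto
      qed simp
      then show "(\<Prod>i<j. \<integral>\<^sup>+\<omega>. Z i (W i \<omega>) \<partial>M) \<le> (\<Prod>i<j. ennreal \<delta>)" by simp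
    qed (use cost in \<open>simp_all add: Z_def\<close>)
    also have "\<dots> = ennreal (\<delta> ^ j * r)" using \<delta> r by (simp add: ennreal_mult ennreal_power)
    finally show ?thesis .
  qed
  have "(\<integral>\<^sup>+\<omega>. (\<Sum>j. if \<forall>i<j. R i (W i \<omega>) then Y j (W j \<omega>) else 0) \<partial>M)
      = (\<Sum>j. \<integral>\<^sup>+\<omega>. (if \<forall>i<j. R i (W i \<omega>) then Y j (W j \<omega>) else 0) \<partial>M)"
    by (rule nn_integral_suminf) measurable
  also have "\<dots> \<le> (\<Sum>j. ennreal (\<delta> ^ j * r))"
    by (intro suminf_le term_le) auto
  also have "\<dots> = ennreal (r / (1 - \<delta>))"
  proof (rule sums_unique[symmetric])
    have "(\<lambda>j. \<delta> ^ j * r) sums (1 / (1 - \<delta>) * r)"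
      by (intro sums_mult2 geometric_sums) (use \<delta> in simp)
    then show "(\<lambda>j. ennreal (\<delta> ^ j * r)) sums ennreal (r / (1 - \<delta>))"
      using \<delta> r by (subst sums_ennreal) auto
  qed
  finally show ?thesis .
qed

section \<open>The attempt as a measurable process\<close>

lemma borel_measurable_matrix_vector_mult [measurable (raw)]:
  fixes A :: "'a \<Rightarrow> real^'m^'n"
  assumes "A \<in> borel_measurable M" "r \<in> borel_measurable M"
  shows "(\<lambda>\<omega>. A \<omega> *v r \<omega>) \<in> borel_measurable M"
proof -
  have "continuous_on UNIV (\<lambda>p::(real^'m^'n) \<times> (real^'m). fst p *v snd p)"
    unfolding matrix_vector_mult_def by (intro continuous_intros)
  from borel_measurable_continuous_on[OF this borel_measurable_Pair[OF assms]] show ?thesis by simp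
qed

lemma borel_measurable_regularized_gram [measurable (raw)]:
  fixes A :: "'a \<Rightarrow> real^'m^'n"
  assumes "A \<in> borel_measurable M"
  shows "(\<lambda>\<omega>. mat k + r *\<^sub>R (A \<omega> ** transpose (A \<omega>))) \<in> borel_measurable M"
proof -
  have "continuous_on UNIV (\<lambda>A::real^'m^'n. mat k + r *\<^sub>R (A ** transpose A))"
    unfolding matrix_matrix_mult_def transpose_def by (intro continuous_intros)
  from borel_measurable_continuous_on[OF this assms] show ?thesis .
qed

lemma exit_time_gt_iff: "enat k < exit_time X x \<longleftrightarrow> (\<forall>i. 1 \<le> i \<and> i \<le> k \<longrightarrow> x i \<in> X)"
proof
  assume less: "enat k < exit_time X x"
  show "\<forall>i. 1 \<le> i \<and> i \<le> k \<longrightarrow> x i \<in> X"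
  proof (intro allI impI, rule ccontr)
    fix i assume i: "1 \<le> i \<and> i \<le> k" "x i \<notin> X"
    then have "exit_time X x \<le> enat i" unfolding exit_time_def by (intro INF_lower) auto
    also have "\<dots> \<le> enat k" using i by simp
    finally show False using less by simp
  qed
next
  assume inX: "\<forall>i. 1 \<le> i \<and> i \<le> k \<longrightarrow> x i \<in> X"
  \<comment> \<open>A strict inequality need not survive an infimum, but the successor bound does,
    also over the empty set.\<close>
  have "enat (Suc k) \<le> exit_time X x"
    unfolding exit_time_def
  proof (rule INF_greatest)
    fix i assume "i \<in> {k. 1 \<le> k \<and> x k \<notin> X}"
    then have "\<not> i \<le> k" using inX by auto
    then show "enat (Suc k) \<le> enat i" by simp
  qed
  then show "enat k < exit_time X x" by (rule less_le_trans[rotated]) simp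
qed

locale spider = nr_lalm q U f c x0 l0 X
  for q U and f :: "real^'n \<Rightarrow> real" and c :: "real^'n \<Rightarrow> real^'m" and x0 l0 X +
  fixes P :: "'x measure" and F :: "real^'n \<Rightarrow> 'x \<Rightarrow> real" and gF :: "real^'n \<Rightarrow> 'x \<Rightarrow> real^'n"
    and Q B b :: nat
  assumes sampling: "stochastic_oracle q U f P F gF" and X_borel [measurable]: "X \<in> sets borel"
    and batch_pos: "0 < Q" "0 < B" "0 < b"
begin

sublocale P: prob_space P
  using sampling by (simp add: stochastic_oracle_def)

lemma U_borel [measurable]: "U \<in> sets borel"
  using regular by (auto simp: regularity_def)

text \<open>Extensions by zero, since regularity and measurability are given only on
  \<open>U\<close> while the chain must be total. The constraint is extended from \<open>U\<close>
  rather than \<open>X\<close> because it is evaluated at the next iterate, which may have left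
  \<open>X\<close>.\<close>

definition "gF_X y s = (if y \<in> X then gF y s else 0)"
definition "J_X y = (if y \<in> X then J y else 0)"
definition "g_X y = (if y \<in> X then g y else 0)"
definition "c_U y = (if y \<in> U then c y else 0)"

definition "batch_size k = (if k mod Q = 0 then B else b)"

definition "estimator k y y' h z =
  (if k mod Q = 0 then (1 / real B) *\<^sub>R (\<Sum>i<B. gF_X y (z i))
   else h + (1 / real b) *\<^sub>R (\<Sum>i<b. gF_X y (z i) - gF_X y' (z i)))"

definition "projection h = closest_point (cball 0 (G_f q)) (h :: real^'n)"

definition "direction y m h = cramer_solution (mat \<beta> + \<rho> *\<^sub>R (J_X y ** transpose (J_X y)))
  (- projection h - J_X y *v (m + \<rho> *\<^sub>R c_U y))"

text \<open>States are \<open>(x\<^sub>k, \<lambda>\<^sub>k, x\<^bsub>k-1\<^esub>, h\<^bsub>k-1\<^esub>)\<close>. The chain is frozen after leaving \<open>X\<close>, so that it is a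
  total measurable function of the samples which agrees with every attempt until its exit.\<close>

definition "step k s z = (case s of (y, m, y', h) \<Rightarrow>
  if y \<in> X then
    (let h' = estimator k y y' h z; w = direction y m h' in (y + w, m + \<rho> *\<^sub>R c_U (y + w), y, h'))
  else s)"

text \<open>The last two initial components are placeholders: \<open>0 mod Q = 0\<close>, so
  iteration 0 starts a block and reads neither.\<close>

primrec state :: "(nat \<Rightarrow> nat \<Rightarrow> 'x) \<Rightarrow> nat \<Rightarrow> (real^'n) \<times> (real^'m) \<times> (real^'n) \<times> (real^'n)" where
  "state z 0 = (x0, l0, x0, 0)"
| "state z (Suc k) = step k (state z k) (z k)"

definition "iterate z k = fst (state z k)"
definition "multiplier z k = fst (snd (state z k))"
definition "previous s = fst (snd (snd s))" for s :: "(real^'n) \<times> (real^'m) \<times> (real^'n) \<times> (real^'n)"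
definition "last_estimate s = snd (snd (snd s))" for s :: "(real^'n) \<times> (real^'m) \<times> (real^'n) \<times> (real^'n)"
definition "estimate z k = last_estimate (state z (Suc k))"
definition "clipped_estimate z k = projection (estimate z k)"
definition "displacement z k = iterate z (Suc k) - iterate z k"

text \<open>Joint measurability of the oracle is available over \<open>U\<close> only; restrict it
  to the measurable rectangle over \<open>X\<close> and extend by zero.\<close>

lemma borel_measurable_gF_X [measurable (raw)]:
  assumes a: "a \<in> borel_measurable N" and s: "s \<in> measurable N P"
  shows "(\<lambda>w. gF_X (a w) (s w)) \<in> borel_measurable N"
proof -
  have id: "(\<lambda>p. p) \<in> measurable (restrict_space (borel \<Otimes>\<^sub>M P) (X \<times> space P)) (restrict_space borel U \<Otimes>\<^sub>M P)"
  proof -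
    have "fst \<in> measurable (restrict_space (borel \<Otimes>\<^sub>M P) (X \<times> space P)) (restrict_space borel U)"
      using X_subset_U
      by (intro measurable_restrict_space2 measurable_restrict_space1 measurable_fst)
         (auto simp: space_restrict_space space_pair_measure)
    moreover have "snd \<in> measurable (restrict_space (borel \<Otimes>\<^sub>M P) (X \<times> space P)) P"
      by (intro measurable_restrict_space1 measurable_snd)
    ultimately show ?thesis by (subst measurable_pair_iff) (simp add: comp_def)
  qed
  have "(\<lambda>(x, s). gF x s) \<in> borel_measurable (restrict_space borel U \<Otimes>\<^sub>M P)"
    using sampling by (simp add: stochastic_oracle_def)
  from measurable_compose[OF id this]
  have "(\<lambda>(x, s). gF x s) \<in> borel_measurable (restrict_space (borel \<Otimes>\<^sub>M P) (X \<times> space P))" by simp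
  then have "(\<lambda>p. if p \<in> X \<times> space P then (case p of (x, s) \<Rightarrow> gF x s) else 0) \<in> borel_measurable (borel \<Otimes>\<^sub>M P)"
    by (subst (asm) measurable_restrict_space_iff) (auto intro!: sets.Int pair_measureI)
  from measurable_compose[OF measurable_Pair[OF a s] this]
  show ?thesis
    by (rule measurable_cong[THEN iffD1, rotated])
       (use measurable_space[OF s] in \<open>auto simp: gF_X_def\<close>)
qed

lemma borel_measurable_J_X [measurable]: "J_X \<in> borel_measurable borel"
proof -
  have "continuous_on X J" using regular X_subset_U by (auto simp: regularity_def intro: continuous_on_subset)
  then have "(\<lambda>y. if y \<in> X then J y else 0) \<in> borel_measurable borel"
    by (intro borel_measurable_continuous_on_if) auto
  then show ?thesis by (simp add: J_X_def[abs_def])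
qed

lemma borel_measurable_g_X [measurable]: "g_X \<in> borel_measurable borel"
proof -
  have "continuous_on X g" using regular X_subset_U by (auto simp: regularity_def intro: continuous_on_subset)
  then have "(\<lambda>y. if y \<in> X then g y else 0) \<in> borel_measurable borel"
    by (intro borel_measurable_continuous_on_if) auto
  then show ?thesis by (simp add: g_X_def[abs_def])
qed

lemma borel_measurable_c_U [measurable]: "c_U \<in> borel_measurable borel"
proof -
  have "continuous_on U c"
    using c_diff by (intro differentiable_imp_continuous_on) (auto simp: differentiable_on_def intro: differentiable_at_withinI)
  then have "(\<lambda>y. if y \<in> U then c y else 0) \<in> borel_measurable borel"
    by (intro borel_measurable_continuous_on_if) auto
  then show ?thesis by (simp add: c_U_def[abs_def])
qed

lemma ball_G: "convex (cball (0::real^'n) (G_f q))" "closed (cball (0::real^'n) (G_f q))" "cball (0::real^'n) (G_f q) \<noteq> {}"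
  by (simp_all add: not_less)

lemma borel_measurable_projection [measurable]: "projection \<in> borel_measurable borel"
  unfolding projection_def[abs_def]
  by (intro borel_measurable_continuous_onI continuous_on_closest_point ball_G)

lemma norm_projection_le: "norm (projection h) \<le> G_f q"
  using closest_point_in_set[OF ball_G(2,3), of h] by (simp add: projection_def)

text \<open>The true gradient lies in the ball, hence is fixed by the projection, which is
  nonexpansive.\<close>

lemma projection_nearer:
  assumes "y \<in> U"
  shows "norm (projection h - g y) \<le> norm (h - g y)"
proof -
  have "projection (g y) = g y"
    unfolding projection_def by (rule closest_point_self) (use grad_bound[OF assms] in simp)
  then show ?thesis
    using closest_point_lipschitz[OF ball_G, of h "g y"] by (simp add: projection_def dist_norm)
qed

text \<open>Measurability is asked only of positions inside the batch, because samples outside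
  \<open>sample_index\<close> are unconstrained.\<close>

lemma borel_measurable_estimator [measurable (raw)]:
  assumes [measurable]: "y \<in> borel_measurable N" "y' \<in> borel_measurable N" "h \<in> borel_measurable N"
    and z: "\<And>i. i < batch_size k \<Longrightarrow> (\<lambda>w. z w i) \<in> measurable N P"
  shows "(\<lambda>w. estimator k (y w) (y' w) (h w) (z w)) \<in> borel_measurable N"
proof (cases "k mod Q = 0")
  case True
  then have [measurable]: "i < B \<Longrightarrow> (\<lambda>w. z w i) \<in> measurable N P" for i
    using z by (simp add: batch_size_def)
  show ?thesis
    unfolding estimator_def using True by simp
next
  case False
  then have [measurable]: "i < b \<Longrightarrow> (\<lambda>w. z w i) \<in> measurable N P" for i
    using z by (simp add: batch_size_def)
  show ?thesis
    unfolding estimator_def using False by simp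
qed

lemma borel_measurable_direction [measurable (raw)]:
  assumes [measurable]: "y \<in> borel_measurable N" "m \<in> borel_measurable N" "h \<in> borel_measurable N"
  shows "(\<lambda>w. direction (y w) (m w) (h w)) \<in> borel_measurable N"
  unfolding direction_def by measurable

lemma borel_measurable_fst_snd [measurable]:
  "(fst :: 'a::second_countable_topology \<times> 'b::second_countable_topology \<Rightarrow> 'a) \<in> borel_measurable borel"
  "(snd :: 'a::second_countable_topology \<times> 'b::second_countable_topology \<Rightarrow> 'b) \<in> borel_measurable borel"
  by (intro borel_measurable_continuous_onI continuous_intros)+

lemma borel_measurable_prev_est [measurable]:
  "previous \<in> borel_measurable borel" "last_estimate \<in> borel_measurable borel"
  unfolding previous_def[abs_def] last_estimate_def[abs_def] by measurable

lemma borel_measurable_step [measurable (raw)]: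
  assumes [measurable]: "s \<in> borel_measurable N"
    and [measurable]: "\<And>i. i < batch_size k \<Longrightarrow> (\<lambda>w. z w i) \<in> measurable N P"
  shows "(\<lambda>w. step k (s w) (z w)) \<in> borel_measurable N"
  unfolding step_def Let_def case_prod_beta by measurable

lemma step_cong: "(\<And>i. i < batch_size k \<Longrightarrow> z i = z' i) \<Longrightarrow> step k s z = step k s z'"
  by (auto simp: step_def estimator_def batch_size_def Let_def intro!: if_cong sum.cong split: prod.split)

text \<open>State \<open>k\<close> reads only the batches before \<open>k\<close>. This separates
  history from the current batch and lets raw samples be replaced by their restriction to one
  attempt.\<close>

lemma state_cong:
  "(\<And>k' i. k' < k \<Longrightarrow> i < batch_size k' \<Longrightarrow> z k' i = z' k' i) \<Longrightarrow> state z k = state z' k"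
proof (induction k)
  case (Suc k)
  then have "state z k = state z' k" by simp
  moreover have "step k s (z k) = step k s (z' k)" for s by (rule step_cong) (use Suc in simp)
  ultimately show ?case by simp
qed simp

lemma borel_measurable_state:
  "(\<And>k' i. k' < k \<Longrightarrow> i < batch_size k' \<Longrightarrow> (\<lambda>w. z w k' i) \<in> measurable N P)
    \<Longrightarrow> (\<lambda>w. state (z w) k) \<in> borel_measurable N"
  by (induction k) (auto intro!: borel_measurable_step)

end

context spider
begin

lemma state_Suc_out: "iterate z k \<notin> X \<Longrightarrow> state z (Suc k) = state z k"
  by (auto simp: iterate_def step_def split: prod.split)

lemma state_Suc_in:
  assumes "iterate z k \<in> X"
  shows "estimate z k = estimator k (iterate z k) (previous (state z k)) (last_estimate (state z k)) (z k)"
    and "iterate z (Suc k) = iterate z k + direction (iterate z k) (multiplier z k) (estimate z k)"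
    and "multiplier z (Suc k) = multiplier z k + \<rho> *\<^sub>R c_U (iterate z (Suc k))"
    and "previous (state z (Suc k)) = iterate z k"
  using assms
  by (auto simp: iterate_def multiplier_def estimate_def last_estimate_def previous_def step_def Let_def case_prod_beta)

lemma out_stays: "iterate z k \<notin> X \<Longrightarrow> k \<le> k' \<Longrightarrow> iterate z k' \<notin> X"
proof (induction k')
  case (Suc n)
  then show ?case using state_Suc_out[of z n] by (cases "k = Suc n") (auto simp: iterate_def)
qed simp

lemma in_before: "iterate z k' \<in> X \<Longrightarrow> k \<le> k' \<Longrightarrow> iterate z k \<in> X"
  using out_stays by blast

text \<open>Both directions matter: one identifies the step of an arbitrary attempt with that of the
  chain, the other shows that the chain solves the linear system.\<close>

lemma direction_unique:
  assumes "y \<in> X"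
  shows "(mat \<beta> + \<rho> *\<^sub>R (J y ** transpose (J y))) *v w = - projection h - J y *v (m + \<rho> *\<^sub>R c y)
    \<longleftrightarrow> w = direction y m h"
proof -
  let ?A = "mat \<beta> + \<rho> *\<^sub>R (J y ** transpose (J y))"
  have "inj (\<lambda>w. ?A *v w)"
    unfolding regularized_gram_vector_mult by (rule regularized_gram_inj) simp_all
  then have "det ?A \<noteq> 0" by (simp add: invertible_det_nz[symmetric] invertible_left_inverse matrix_left_invertible_injective)
  moreover have "y \<in> U" using assms X_subset_U by blast
  ultimately show ?thesis
    using assms by (simp add: cramer_solution_iff direction_def J_X_def c_U_def)
qed

lemma direction_solves:
  assumes "y \<in> X"
  shows "\<beta> *\<^sub>R direction y m h + \<rho> *\<^sub>R (J y *v (transpose (J y) *v direction y m h))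
    = - projection h - J y *v (m + \<rho> *\<^sub>R c y)"
  using direction_unique[OF assms, of "direction y m h" h m] unfolding regularized_gram_vector_mult by blast

text \<open>Induction is forced by \<open>c_U\<close>, which equals \<open>c\<close> only on
  \<open>U\<close>: the trajectory of length \<open>N\<close> bounds its last multiplier and
  constraint, hence the next step, so the next iterate lies in \<open>U\<close> and the dual update
  is the true one.\<close>

lemma trajectory_state:
  "(\<And>k. k < N \<Longrightarrow> iterate z k \<in> X) \<Longrightarrow> trajectory q U f c x0 l0 X N (iterate z) (multiplier z) (clipped_estimate z) (displacement z)"
proof (induction N)
  case 0
  show ?case by unfold_locales (auto simp: iterate_def multiplier_def)
next
  case (Suc N)
  then interpret T: trajectory q U f c x0 l0 X N "iterate z" "multiplier z" "clipped_estimate z" "displacement z" by simp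
  have N: "iterate z N \<in> X" using Suc.prems by simp
  have d: "displacement z N = direction (iterate z N) (multiplier z N) (estimate z N)"
    using state_Suc_in(2)[OF N] by (simp add: displacement_def)
  have eq: "\<beta> *\<^sub>R displacement z N + \<rho> *\<^sub>R (J (iterate z N) *v (transpose (J (iterate z N)) *v displacement z N))
      = - clipped_estimate z N - J (iterate z N) *v (multiplier z N + \<rho> *\<^sub>R c (iterate z N))"
    unfolding d clipped_estimate_def by (rule direction_solves[OF N])
  have "norm (displacement z N) \<le> \<Delta>"
    by (rule direction_bound[OF _ _ T.l_bound T.c_bound eq])
       (use N X_subset_U norm_projection_le in \<open>auto simp: clipped_estimate_def\<close>)
  then have "iterate z N + displacement z N \<in> U" by (rule step_in_U[OF N])
  then have "iterate z (Suc N) \<in> U" by (simp add: displacement_def)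
  then have l: "multiplier z (Suc N) = multiplier z N + \<rho> *\<^sub>R c (iterate z (Suc N))"
    using state_Suc_in(3)[OF N] by (simp add: c_U_def)
  show ?case
  proof unfold_locales
    fix k assume k: "k < Suc N"
    show "iterate z k \<in> X" using Suc.prems k .
    show "norm (clipped_estimate z k) \<le> G_f q" by (simp add: clipped_estimate_def norm_projection_le)
    show "\<beta> *\<^sub>R displacement z k + \<rho> *\<^sub>R (J (iterate z k) *v (transpose (J (iterate z k)) *v displacement z k))
      = - clipped_estimate z k - J (iterate z k) *v (multiplier z k + \<rho> *\<^sub>R c (iterate z k))"
      using k eq T.p_eq by (cases "k = N") auto
    show "iterate z (Suc k) = iterate z k + displacement z k" by (simp add: displacement_def)
    show "multiplier z (Suc k) = multiplier z k + \<rho> *\<^sub>R c (iterate z (Suc k))"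
      using k l T.l_Suc by (cases "k = N") auto
  qed (auto simp: iterate_def multiplier_def)
qed

text \<open>Membership in \<open>X\<close> is required strictly before \<open>k\<close> only, so the
  exit point itself is still compared. The stored pair is meaningful at positive indices
  only.\<close>

lemma state_attempt_run:
  assumes run: "attempt_run q c gF x0 l0 X K Q B b z x l h v p"
  shows "k \<le> K \<Longrightarrow> (\<And>i. i < k \<Longrightarrow> x i \<in> X) \<Longrightarrow> iterate z k = x k \<and> multiplier z k = l k
    \<and> (\<forall>i. k = Suc i \<longrightarrow> previous (state z k) = x i \<and> last_estimate (state z k) = h i)"
proof (induction k)
  case 0
  show ?case using run by (simp add: attempt_run_def iterate_def multiplier_def)
next
  case (Suc k)
  then have IH: "iterate z k = x k" "multiplier z k = l k"
    "\<And>i. k = Suc i \<Longrightarrow> previous (state z k) = x i \<and> last_estimate (state z k) = h i" by auto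
  have xk: "x i \<in> X" if "i \<le> k" for i using Suc.prems that by simp
  have "k \<in> executed X K x"
    using Suc.prems xk by (simp add: executed_def exit_time_gt_iff)
  note R = run[unfolded attempt_run_def, THEN conjunct2, THEN conjunct2, rule_format, OF this]
  have inX: "iterate z k \<in> X" using IH xk by simp
  have hk: "estimate z k = h k"
  proof (cases "k mod Q = 0")
    case True
    then show ?thesis using state_Suc_in(1)[OF inX] R xk[of k] IH(1)
      by (simp add: estimator_def gF_X_def)
  next
    case False
    then obtain i where i: "k = Suc i" by (cases k) auto
    show ?thesis using state_Suc_in(1)[OF inX] R xk[of k] xk[of i] IH(1) IH(3)[OF i] False i
      by (simp add: estimator_def gF_X_def)
  qed
  have p: "p k = direction (x k) (l k) (h k)"
    using direction_unique[OF xk[OF order_refl], of "p k" "h k" "l k"] R by (simp add: projection_def)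
  have xS: "iterate z (Suc k) = x (Suc k)"
    using state_Suc_in(2)[OF inX] IH hk p R by simp
  \<comment> \<open>Needed to replace \<open>c_U\<close> by \<open>c\<close> in the update of the
    multiplier at a point possibly outside \<open>X\<close>.\<close>
  interpret T: trajectory q U f c x0 l0 X "Suc k" "iterate z" "multiplier z" "clipped_estimate z" "displacement z"
    by (rule trajectory_state) (use in_before[OF inX] in simp)
  have "multiplier z (Suc k) = l (Suc k)"
    using T.l_Suc[of k] IH xS R by simp
  moreover have "previous (state z (Suc k)) = x k" using state_Suc_in(4)[OF inX] IH by simp
  ultimately show ?case using xS hk by (simp add: estimate_def)
qed

text \<open>Freezing lets membership at a single index record the whole past. Acceptance and
  execution thereby become measurable events about one iterate.\<close>

lemma attempt_run_in_X_iff: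
  assumes run: "attempt_run q c gF x0 l0 X K Q B b z x l h v p" and k: "k \<le> K"
  shows "iterate z k \<in> X \<longleftrightarrow> (\<forall>i. 1 \<le> i \<and> i \<le> k \<longrightarrow> x i \<in> X)"
proof
  have x00: "x 0 = x0" using run by (simp add: attempt_run_def)
  show "\<forall>i. 1 \<le> i \<and> i \<le> k \<longrightarrow> x i \<in> X" if "iterate z k \<in> X"
  proof -
    have "i \<le> k \<Longrightarrow> x i \<in> X" for i
    proof (induction i rule: less_induct)
      case (less i)
      have "iterate z i = x i" using state_attempt_run[OF run, of i] less k by auto
      then show ?case using in_before[OF that, of i] less by simp
    qed
    then show ?thesis by blast
  qed
  show "iterate z k \<in> X" if *: "\<forall>i. 1 \<le> i \<and> i \<le> k \<longrightarrow> x i \<in> X"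
  proof -
    have "x i \<in> X" if "i \<le> k" for i using * that x00 x0_in by (cases "i = 0") auto
    then show ?thesis using state_attempt_run[OF run, of k] k by auto
  qed
qed

lemma accepted_iff:
  assumes "attempt_run q c gF x0 l0 X K Q B b z x l h v p"
  shows "accepted X K x \<longleftrightarrow> iterate z K \<in> X"
  using attempt_run_in_X_iff[OF assms order_refl] by (simp add: accepted_def exit_time_gt_iff)

lemma executed_eq:
  assumes "attempt_run q c gF x0 l0 X K Q B b z x l h v p"
  shows "executed X K x = {k. k < K \<and> iterate z k \<in> X}"
  using attempt_run_in_X_iff[OF assms] by (auto simp: executed_def exit_time_gt_iff)

lemma accepted_state:
  assumes run: "attempt_run q c gF x0 l0 X K Q B b z x l h v p" and acc: "iterate z K \<in> X" and k: "k \<le> K"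
  shows "x k = iterate z k" "l k = multiplier z k"
proof -
  have "x i \<in> X" if "i \<le> K" for i
    using attempt_run_in_X_iff[OF run order_refl] acc run x0_in that
    by (cases "i = 0") (auto simp: attempt_run_def)
  then show "x k = iterate z k" "l k = multiplier z k" using state_attempt_run[OF run k] k by auto
qed

text \<open>The stopped sums are written over the fixed range below \<open>K\<close> with
  indicators, so that expectations can be taken term by term.\<close>

definition "err_sum K z = (\<Sum>k<K. if iterate z k \<in> X then (norm (clipped_estimate z k - g_X (iterate z k)))\<^sup>2 else 0)"
definition "move_sum K z = (\<Sum>k<K. if iterate z k \<in> X then (norm (displacement z k))\<^sup>2 else 0)"

text \<open>\<open>N\<close> is the first index outside \<open>X\<close>, capped at
  \<open>K\<close>: sample by sample, the indicator sums are sums over a deterministic trajectory of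
  that length.\<close>

lemma stopped_trajectory:
  obtains N where "N \<le> K" "\<And>k. k < N \<Longrightarrow> iterate z k \<in> X" "N = K \<or> iterate z N \<notin> X"
    "trajectory q U f c x0 l0 X N (iterate z) (multiplier z) (clipped_estimate z) (displacement z)"
    "err_sum K z = trajectory.sum_e f N (iterate z) (clipped_estimate z)" "move_sum K z = trajectory.sum_p N (displacement z)"
proof -
  define N where "N = (LEAST k. k = K \<or> iterate z k \<notin> X)"
  have N: "N = K \<or> iterate z N \<notin> X" unfolding N_def by (rule LeastI[of _ K]) simp
  have le: "N \<le> K" unfolding N_def by (rule Least_le) simp
  have inX: "iterate z k \<in> X" if "k < N" for k
    using not_less_Least[of k "\<lambda>k. k = K \<or> iterate z k \<notin> X"] that by (auto simp: N_def)
  interpret T: trajectory q U f c x0 l0 X N "iterate z" "multiplier z" "clipped_estimate z" "displacement z"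
    by (rule trajectory_state) (rule inX)
  have iff: "iterate z k \<in> X \<longleftrightarrow> k < N" if "k < K" for k
    using N inX out_stays[of z N k] that by (cases "k < N") auto
  have stop: "(\<Sum>k<K. if iterate z k \<in> X then F k else 0) = (\<Sum>k<N. F k)" for F :: "nat \<Rightarrow> real"
  proof -
    have "(\<Sum>k<K. if iterate z k \<in> X then F k else 0) = (\<Sum>k\<in>{..<K}. if k \<in> {..<N} then F k else 0)"
      by (rule sum.cong) (auto simp: iff)
    also have "\<dots> = (\<Sum>k<N. F k)"
      by (rule sum.mono_neutral_cong_right) (use le in auto)
    finally show ?thesis .
  qed
  have "err_sum K z = T.sum_e"
    unfolding err_sum_def stop T.sum_e_def T.e_def by (rule sum.cong) (auto simp: g_X_def inX)
  moreover have "move_sum K z = T.sum_p" unfolding move_sum_def stop T.sum_p_def ..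
  ultimately show ?thesis using that[OF le inX N T.trajectory_axioms] by blast
qed

lemma move_sum_le: "move_sum K z \<le> D_0 q f x0 + D_1 q * err_sum K z"
proof -
  obtain N where N: "trajectory q U f c x0 l0 X N (iterate z) (multiplier z) (clipped_estimate z) (displacement z)"
    "err_sum K z = trajectory.sum_e f N (iterate z) (clipped_estimate z)" "move_sum K z = trajectory.sum_p N (displacement z)"
    by (rule stopped_trajectory[of K z])
  show ?thesis unfolding N(2,3) by (rule trajectory.sum_p_le[OF N(1)])
qed

lemma Gamma_e_pos: "0 < Gamma_e q f x0"
  unfolding Gamma_e_def using D_0_pos D_1_pos by (intro add_nonneg_pos) simp_all

lemma exit_err_sum:
  assumes S: "S_st q f c x0 \<delta> \<subseteq> X" and \<delta>: "0 < \<delta>" and exit: "iterate z K \<notin> X"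
  shows "Gamma_e q f x0 \<le> \<delta> * err_sum K z"
proof -
  obtain N where N: "N \<le> K" "\<And>k. k < N \<Longrightarrow> iterate z k \<in> X" "N = K \<or> iterate z N \<notin> X"
    "trajectory q U f c x0 l0 X N (iterate z) (multiplier z) (clipped_estimate z) (displacement z)"
    "err_sum K z = trajectory.sum_e f N (iterate z) (clipped_estimate z)" "move_sum K z = trajectory.sum_p N (displacement z)"
    by (rule stopped_trajectory[of K z]) blast
  have out: "iterate z N \<notin> X" using N(3) exit by auto
  \<comment> \<open>The start lies in \<open>X\<close>, so at least one step was taken before the
    exit, as the bounds at the last point require.\<close>
  then have "0 < N" using x0_in by (cases N) (auto simp: iterate_def)
  have f: "f (iterate z N) \<le> H_det q f x0 + 2 * C_e_star q * err_sum K z"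
    unfolding N(5) by (rule trajectory.f_last[OF N(4) \<open>0 < N\<close>])
  have "norm (c (iterate z N)) \<le> 2 * \<Lambda> / \<rho>" by (rule trajectory.c_last[OF N(4) \<open>0 < N\<close>])
  moreover have "iterate z N \<notin> S_st q f c x0 \<delta>" using out S by blast
  ultimately have "H_st q f x0 \<delta> < f (iterate z N)" by (simp add: S_st_def not_le)
  with f have "2 * C_e_star q * Gamma_e q f x0 / \<delta> \<le> 2 * C_e_star q * err_sum K z"
    unfolding H_st_def by linarith
  then have "2 * C_e_star q * Gamma_e q f x0 \<le> 2 * C_e_star q * (\<delta> * err_sum K z)"
    using \<delta> by (simp add: pos_divide_le_eq mult_ac)
  then show ?thesis using C_e_star_pos by simp
qed

lemma accepted_residual_sum:
  assumes "iterate z K \<in> X"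
  shows "(\<Sum>k=1..<K. (kkt_residual f c (iterate z (k + 1)) (multiplier z (k + 1)))\<^sup>2)
    \<le> 2 * C_R_st q * (move_sum K z + err_sum K z)"
proof -
  obtain N where N: "N \<le> K" "\<And>k. k < N \<Longrightarrow> iterate z k \<in> X" "N = K \<or> iterate z N \<notin> X"
    "trajectory q U f c x0 l0 X N (iterate z) (multiplier z) (clipped_estimate z) (displacement z)"
    "err_sum K z = trajectory.sum_e f N (iterate z) (clipped_estimate z)" "move_sum K z = trajectory.sum_p N (displacement z)"
    by (rule stopped_trajectory[of K z]) blast
  have "N = K" using N(1,3) assms in_before[of z K N] by blast
  then show ?thesis unfolding N(5,6) using trajectory.residual_sum_le[OF N(4)] by simp
qed

lemma dd_bound: "iterate z k \<in> X \<Longrightarrow> norm (displacement z k) \<le> \<Delta>"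
  using trajectory.p_bound[OF trajectory_state[of "Suc k" z], of k] in_before[of z k] by simp

end

section \<open>Expected SPIDER error of one attempt\<close>

text \<open>Unrolled back to the start of its block, \<open>D k\<close> costs \<open>a\<close> plus
  \<open>t\<close> times the earlier \<open>R i\<close> of that block. A block has at most
  \<open>Q\<close> indices, so each \<open>R i\<close> is charged at most \<open>Q\<close> times
  after exchanging the sums. Working in \<open>ennreal\<close> avoids any finiteness
  condition.\<close>

lemma block_recursion_sum_le:
  fixes D R :: "nat \<Rightarrow> ennreal"
  assumes Q: "0 < Q" and start: "\<And>k. k < K \<Longrightarrow> k mod Q = 0 \<Longrightarrow> D k \<le> a"
    and step: "\<And>k. Suc k < K \<Longrightarrow> Suc k mod Q \<noteq> 0 \<Longrightarrow> D (Suc k) \<le> D k + t * R k"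
  shows "(\<Sum>k<K. D k) \<le> of_nat K * a + t * of_nat Q * (\<Sum>k<K. R k)"
proof -
  have bound: "k < K \<Longrightarrow> D k \<le> a + t * (\<Sum>i | i < k \<and> i div Q = k div Q. R i)" for k
  proof (induction k)
    case 0
    then show ?case using start[of 0] by simp
  next
    case (Suc k)
    show ?case
    proof (cases "Suc k mod Q = 0")
      case True
      then show ?thesis using start[of "Suc k"] Suc.prems by (simp add: add_increasing2)
    next
      case False
      then have "{i. i < Suc k \<and> i div Q = Suc k div Q} = insert k {i. i < k \<and> i div Q = k div Q}"
        by (auto simp: div_Suc)
      then have "(\<Sum>i | i < Suc k \<and> i div Q = Suc k div Q. R i) = R k + (\<Sum>i | i < k \<and> i div Q = k div Q. R i)"
        by simp
      then have eq: "a + t * (\<Sum>i | i < Suc k \<and> i div Q = Suc k div Q. R i)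
          = (a + t * (\<Sum>i | i < k \<and> i div Q = k div Q. R i)) + t * R k"
        by (simp add: distrib_left add_ac)
      have IH: "D k \<le> a + t * (\<Sum>i | i < k \<and> i div Q = k div Q. R i)" using Suc by simp
      show ?thesis unfolding eq by (rule order_trans[OF step[OF Suc.prems False] add_right_mono[OF IH]])
    qed
  qed
  have card: "card {k. k < K \<and> i div Q = k div Q} \<le> Q" for i
  proof -
    have "{k. k < K \<and> i div Q = k div Q} \<subseteq> {(i div Q) * Q..<(i div Q) * Q + Q}"
    proof
      fix k assume "k \<in> {k. k < K \<and> i div Q = k div Q}"
      then have "i div Q = k div Q" by simp
      then have "k = (i div Q) * Q + k mod Q" by simp
      then show "k \<in> {(i div Q) * Q..<(i div Q) * Q + Q}" using mod_less_divisor[OF Q, of k] by simp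
    qed
    from card_mono[OF _ this] show ?thesis by simp
  qed
  have "(\<Sum>k<K. \<Sum>i | i < k \<and> i div Q = k div Q. R i) \<le> (\<Sum>k<K. \<Sum>i<K. if i div Q = k div Q then R i else 0)"
  proof (rule sum_mono)
    fix k assume k: "k \<in> {..<K}"
    have "(\<Sum>i | i < k \<and> i div Q = k div Q. R i) \<le> (\<Sum>i | i < K \<and> i div Q = k div Q. R i)"
      by (rule sum_mono2) (use k in auto)
    also have "\<dots> = (\<Sum>i<K. if i div Q = k div Q then R i else 0)"
      by (simp add: sum.If_cases Int_def)
    finally show "(\<Sum>i | i < k \<and> i div Q = k div Q. R i) \<le> (\<Sum>i<K. if i div Q = k div Q then R i else 0)" .
  qed
  also have "\<dots> = (\<Sum>i<K. \<Sum>k<K. if i div Q = k div Q then R i else 0)" by (rule sum.swap)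
  also have "\<dots> = (\<Sum>i<K. of_nat (card {k. k < K \<and> i div Q = k div Q}) * R i)"
    by (simp add: sum.If_cases Int_def)
  also have "\<dots> \<le> (\<Sum>i<K. of_nat Q * R i)"
    by (intro sum_mono mult_right_mono) (simp_all add: card)
  also have "\<dots> = of_nat Q * (\<Sum>i<K. R i)" by (simp add: sum_distrib_left)
  finally have double: "(\<Sum>k<K. \<Sum>i | i < k \<and> i div Q = k div Q. R i) \<le> of_nat Q * (\<Sum>i<K. R i)" .
  have "(\<Sum>k<K. D k) \<le> (\<Sum>k<K. a + t * (\<Sum>i | i < k \<and> i div Q = k div Q. R i))"
    by (intro sum_mono bound) simp
  also have "\<dots> = of_nat K * a + t * (\<Sum>k<K. \<Sum>i | i < k \<and> i div Q = k div Q. R i)"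
    by (simp add: sum.distrib sum_distrib_left)
  also have "\<dots> \<le> of_nat K * a + t * (of_nat Q * (\<Sum>i<K. R i))"
    by (intro add_left_mono mult_left_mono double) simp
  finally show ?thesis by (simp add: mult.assoc)
qed

context spider
begin

lemma oracle_facts:
  "y \<in> U \<Longrightarrow> has_bochner_integral P (gF y) (g y)"
  "y \<in> U \<Longrightarrow> (\<integral>\<^sup>+s. ennreal ((norm (gF y s - g y))\<^sup>2) \<partial>P) \<le> ennreal ((sig_f q)\<^sup>2)"
  "y \<in> U \<Longrightarrow> y' \<in> U \<Longrightarrow> (\<integral>\<^sup>+s. ennreal ((norm (gF y s - gF y' s))\<^sup>2) \<partial>P) \<le> ennreal ((L_s q)\<^sup>2 * (norm (y - y'))\<^sup>2)"
  using sampling by (auto simp: stochastic_oracle_def)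

lemma estimator_error_start:
  assumes "k mod Q = 0" "y \<in> X"
  shows "(\<integral>\<^sup>+z. ennreal ((norm (estimator k y y' h z - g_X y))\<^sup>2) \<partial>(\<Pi>\<^sub>M i\<in>{..<batch_size k}. P))
    \<le> ennreal ((sig_f q)\<^sup>2 / real B)"
proof -
  have y: "y \<in> U" using assms X_subset_U by blast
  have "(\<integral>\<^sup>+z. ennreal ((norm (0 + ((1 / real B) *\<^sub>R (\<Sum>i<B. gF y (z i)) - g y)))\<^sup>2) \<partial>(\<Pi>\<^sub>M i\<in>{..<B}. P))
    \<le> ennreal ((norm (0::real^'n))\<^sup>2 + (sig_f q)\<^sup>2 / real B)"
    by (rule nn_integral_batch_mean[OF P.prob_space_axioms oracle_facts(1)[OF y] oracle_facts(2)[OF y]]) (use batch_pos in simp_all)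
  then show ?thesis
    using assms by (simp add: estimator_def batch_size_def gF_X_def g_X_def)
qed

text \<open>The new error is the old one plus a centred batch mean of gradient differences; the two
  add in square, and the second is small when the step is short.\<close>

lemma estimator_error_step:
  assumes "k mod Q \<noteq> 0" "y \<in> X" "y' \<in> X"
  shows "(\<integral>\<^sup>+z. ennreal ((norm (estimator k y y' h z - g_X y))\<^sup>2) \<partial>(\<Pi>\<^sub>M i\<in>{..<batch_size k}. P))
    \<le> ennreal ((norm (h - g_X y'))\<^sup>2) + ennreal ((L_s q)\<^sup>2 / real b) * ennreal ((norm (y - y'))\<^sup>2)"
proof -
  have y: "y \<in> U" "y' \<in> U" using assms X_subset_U by blast+
  let ?S = "(L_s q)\<^sup>2 * (norm (y - y'))\<^sup>2"
  have D: "has_bochner_integral P (\<lambda>s. gF y s - gF y' s) (g y - g y')"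
    by (intro has_bochner_integral_diff oracle_facts y)
  have S: "(\<integral>\<^sup>+s. ennreal ((norm (gF y s - gF y' s - (g y - g y')))\<^sup>2) \<partial>P) \<le> ennreal ?S"
    by (rule P.nn_integral_variance_le_second_moment[OF D oracle_facts(3)[OF y]]) simp
  have "(\<integral>\<^sup>+z. ennreal ((norm ((h - g y') + ((1 / real b) *\<^sub>R (\<Sum>i<b. gF y (z i) - gF y' (z i)) - (g y - g y'))))\<^sup>2)
      \<partial>(\<Pi>\<^sub>M i\<in>{..<b}. P)) \<le> ennreal ((norm (h - g y'))\<^sup>2 + ?S / real b)"
    by (rule nn_integral_batch_mean[OF P.prob_space_axioms D S]) (use batch_pos in simp_all)
  also have "\<dots> = ennreal ((norm (h - g y'))\<^sup>2) + ennreal ((L_s q)\<^sup>2 / real b) * ennreal ((norm (y - y'))\<^sup>2)"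
    by (simp add: ennreal_mult[symmetric])
  finally show ?thesis
    using assms by (simp add: estimator_def batch_size_def gF_X_def g_X_def algebra_simps)
qed

end

section \<open>Separation of history and batch inside one attempt\<close>

locale restart = spider q U f c x0 l0 X P F gF Q B b + prob_space M
  for q U and f :: "real^'n \<Rightarrow> real" and c :: "real^'n \<Rightarrow> real^'m" and x0 l0 X
    and P :: "'x measure" and F gF Q B b and M :: "'w measure" +
  fixes K :: nat and \<xi> :: "nat \<times> nat \<times> nat \<Rightarrow> 'w \<Rightarrow> 'x"
  assumes \<xi>_indep: "indep_vars (\<lambda>_. P) \<xi> (sample_index K Q B b)"
    and \<xi>_law: "\<And>t. t \<in> sample_index K Q B b \<Longrightarrow> distr M P (\<xi> t) = P"
begin

definition "attempt_index j = {(j, k, i) | k i. k < K \<and> i < batch_size k}"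
definition "attempt_samples j \<omega> = (\<lambda>t\<in>attempt_index j. \<xi> t \<omega>)"
definition "array j y = (\<lambda>k i. y (j, k, i))" for y :: "nat \<times> nat \<times> nat \<Rightarrow> 'x"
definition "attempt_array j \<omega> = array j (attempt_samples j \<omega>)"

lemma attempt_index_subset: "attempt_index j \<subseteq> sample_index K Q B b"
  by (auto simp: attempt_index_def sample_index_def batch_size_def)

lemma in_attempt_index: "(j, k, i) \<in> attempt_index j \<longleftrightarrow> k < K \<and> i < batch_size k"
  by (auto simp: attempt_index_def)

lemma \<xi>_measurable: "t \<in> sample_index K Q B b \<Longrightarrow> \<xi> t \<in> measurable M P"
  using \<xi>_indep by (auto simp: indep_vars_def)

lemma attempt_samples_measurable [measurable]:
  "attempt_samples j \<in> measurable M (\<Pi>\<^sub>M t\<in>attempt_index j. P)"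
  unfolding attempt_samples_def[abs_def]
  by (rule measurable_restrict) (use \<xi>_measurable attempt_index_subset in blast)

lemma state_array_measurable:
  assumes "k \<le> K" "\<And>k' i. k' < k \<Longrightarrow> i < batch_size k' \<Longrightarrow> (j, k', i) \<in> A"
  shows "(\<lambda>y. state (array j y) k) \<in> borel_measurable (\<Pi>\<^sub>M t\<in>A. P)"
  by (rule borel_measurable_state)
     (auto simp: array_def intro!: measurable_component_singleton[where M="\<lambda>_. P"] assms(2))

lemma state_zz_measurable [measurable]: "k \<le> K \<Longrightarrow> (\<lambda>\<omega>. state (attempt_array j \<omega>) k) \<in> borel_measurable M"
  unfolding attempt_array_def
  by (rule measurable_compose[OF attempt_samples_measurable state_array_measurable])
     (auto simp: in_attempt_index)

lemma it_mu_zz_measurable [measurable]: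
  "k \<le> K \<Longrightarrow> (\<lambda>\<omega>. iterate (attempt_array j \<omega>) k) \<in> borel_measurable M"
  "k \<le> K \<Longrightarrow> (\<lambda>\<omega>. multiplier (attempt_array j \<omega>) k) \<in> borel_measurable M"
  "k < K \<Longrightarrow> (\<lambda>\<omega>. estimate (attempt_array j \<omega>) k) \<in> borel_measurable M"
  "k < K \<Longrightarrow> (\<lambda>\<omega>. clipped_estimate (attempt_array j \<omega>) k) \<in> borel_measurable M"
  "k < K \<Longrightarrow> (\<lambda>\<omega>. displacement (attempt_array j \<omega>) k) \<in> borel_measurable M"
  unfolding iterate_def multiplier_def estimate_def clipped_estimate_def displacement_def by measurable

text \<open>\<open>A1\<close> holds the samples of earlier iterations and \<open>A2\<close> the
  current batch. The index sets are disjoint, so the batch can be integrated out under its product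
  law with the state frozen.\<close>

lemma nn_integral_history_batch:
  assumes k: "k < K" and \<phi> [measurable]: "\<phi> \<in> borel_measurable (borel \<Otimes>\<^sub>M (\<Pi>\<^sub>M i\<in>{..<batch_size k}. P))"
  shows "(\<integral>\<^sup>+\<omega>. \<phi> (state (attempt_array j \<omega>) k, \<lambda>i\<in>{..<batch_size k}. attempt_array j \<omega> k i) \<partial>M)
    = (\<integral>\<^sup>+\<omega>. \<integral>\<^sup>+y. \<phi> (state (attempt_array j \<omega>) k, y) \<partial>(\<Pi>\<^sub>M i\<in>{..<batch_size k}. P) \<partial>M)"
proof -
  let ?n = "batch_size k" and ?I = "sample_index K Q B b"
  define A1 where "A1 = {(j, k', i) | k' i. k' < k \<and> i < batch_size k'}"
  define A2 where "A2 = {(j, k, i) | i. i < ?n}"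
  have sub: "A1 \<subseteq> ?I" "A2 \<subseteq> ?I"
    using k by (auto simp: A1_def A2_def sample_index_def batch_size_def)
  define T where "T y = (\<lambda>i\<in>{..<?n}. y (j, k, i))" for y :: "nat \<times> nat \<times> nat \<Rightarrow> 'x"
  have [measurable]: "(\<lambda>y. state (array j y) k) \<in> borel_measurable (\<Pi>\<^sub>M t\<in>A1. P)"
    by (rule state_array_measurable) (use k in \<open>auto simp: A1_def\<close>)
  have [measurable]: "T \<in> measurable (\<Pi>\<^sub>M t\<in>A2. P) (\<Pi>\<^sub>M i\<in>{..<?n}. P)"
    unfolding T_def[abs_def]
    by (rule measurable_restrict) (auto simp: A2_def intro!: measurable_component_singleton[where M="\<lambda>_. P"])
  have [measurable]: "(\<lambda>\<omega>. \<lambda>t\<in>A2. \<xi> t \<omega>) \<in> measurable M (\<Pi>\<^sub>M t\<in>A2. P)"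
    by (rule measurable_restrict) (use \<xi>_measurable sub in blast)
  have hist: "state (array j (\<lambda>t\<in>A1. \<xi> t \<omega>)) k = state (attempt_array j \<omega>) k" for \<omega>
    using k by (auto simp: attempt_array_def array_def A1_def attempt_samples_def in_attempt_index intro!: state_cong)
  have batch: "T (\<lambda>t\<in>A2. \<xi> t \<omega>) = (\<lambda>i\<in>{..<?n}. attempt_array j \<omega> k i)" for \<omega>
    using k by (auto simp: fun_eq_iff T_def attempt_array_def array_def A2_def attempt_samples_def in_attempt_index)
  have batch': "T (\<lambda>t\<in>A2. \<xi> t \<omega>) = (\<lambda>i\<in>{..<?n}. \<xi> (j, k, i) \<omega>)" for \<omega>
    by (auto simp: fun_eq_iff T_def A2_def)
  have law: "distr M (\<Pi>\<^sub>M i\<in>{..<?n}. P) (\<lambda>\<omega>. T (\<lambda>t\<in>A2. \<xi> t \<omega>)) = (\<Pi>\<^sub>M i\<in>{..<?n}. P)"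
    unfolding batch'
    by (rule distr_iid_reindex[OF \<xi>_indep \<xi>_law P.prob_space_axioms])
       (use k batch_pos in \<open>auto simp: inj_on_def sample_index_def batch_size_def\<close>)
  have inner: "(\<integral>\<^sup>+y. \<phi> (s, T y) \<partial>distr M (\<Pi>\<^sub>M t\<in>A2. P) (\<lambda>\<omega>. \<lambda>t\<in>A2. \<xi> t \<omega>))
      = (\<integral>\<^sup>+y. \<phi> (s, y) \<partial>(\<Pi>\<^sub>M i\<in>{..<?n}. P))" for s
  proof -
    have "(\<integral>\<^sup>+y. \<phi> (s, T y) \<partial>distr M (\<Pi>\<^sub>M t\<in>A2. P) (\<lambda>\<omega>. \<lambda>t\<in>A2. \<xi> t \<omega>))
        = (\<integral>\<^sup>+\<omega>. \<phi> (s, T (\<lambda>t\<in>A2. \<xi> t \<omega>)) \<partial>M)"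
      by (rule nn_integral_distr) measurable
    also have "\<dots> = (\<integral>\<^sup>+y. \<phi> (s, y) \<partial>distr M (\<Pi>\<^sub>M i\<in>{..<?n}. P) (\<lambda>\<omega>. T (\<lambda>t\<in>A2. \<xi> t \<omega>)))"
      by (rule nn_integral_distr[symmetric]) measurable
    finally show ?thesis unfolding law .
  qed
  have "indep_var (\<Pi>\<^sub>M t\<in>A1. P) (\<lambda>\<omega>. \<lambda>t\<in>A1. \<xi> t \<omega>) (\<Pi>\<^sub>M t\<in>A2. P) (\<lambda>\<omega>. \<lambda>t\<in>A2. \<xi> t \<omega>)"
    by (rule indep_var_restrict[OF \<xi>_indep _ sub]) (auto simp: A1_def A2_def)
  from nn_integral_indep_var[OF this, of "\<lambda>(y1, y2). \<phi> (state (array j y1) k, T y2)"]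
  have "(\<integral>\<^sup>+\<omega>. \<phi> (state (array j (\<lambda>t\<in>A1. \<xi> t \<omega>)) k, T (\<lambda>t\<in>A2. \<xi> t \<omega>)) \<partial>M)
    = (\<integral>\<^sup>+\<omega>. \<integral>\<^sup>+y. \<phi> (state (array j (\<lambda>t\<in>A1. \<xi> t \<omega>)) k, T y)
        \<partial>distr M (\<Pi>\<^sub>M t\<in>A2. P) (\<lambda>\<omega>. \<lambda>t\<in>A2. \<xi> t \<omega>) \<partial>M)"
    by simp
  then show ?thesis unfolding hist inner batch .
qed

text \<open>Measured with the raw estimate, for which the recursion is unbiased; the clipped error
  is dominated by it.\<close>

definition "err_sq j k = (\<integral>\<^sup>+\<omega>. (if iterate (attempt_array j \<omega>) k \<in> X then ennreal ((norm (estimate (attempt_array j \<omega>) k - g_X (iterate (attempt_array j \<omega>) k)))\<^sup>2) else 0) \<partial>M)"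
definition "move_sq j k = (\<integral>\<^sup>+\<omega>. (if iterate (attempt_array j \<omega>) k \<in> X then ennreal ((norm (displacement (attempt_array j \<omega>) k))\<^sup>2) else 0) \<partial>M)"

lemma estimator_restrict: "estimator k y y' h (\<lambda>i\<in>{..<batch_size k}. z i) = estimator k y y' h z"
  by (auto simp: estimator_def batch_size_def intro!: sum.cong)

lemma estimator_error_measurable [measurable]:
  "(\<lambda>(s, z). ennreal ((norm (estimator k (fst s) (previous s) (last_estimate s) z - g_X (fst s)))\<^sup>2))
    \<in> borel_measurable (borel \<Otimes>\<^sub>M (\<Pi>\<^sub>M i\<in>{..<batch_size k}. P))"
  unfolding case_prod_beta by measurable

lemma err_sq_start:
  assumes k: "k < K" "k mod Q = 0"
  shows "err_sq j k \<le> ennreal ((sig_f q)\<^sup>2 / real B)"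
proof -
  define \<phi> where "\<phi> = (\<lambda>(s, z). if fst s \<in> X
    then ennreal ((norm (estimator k (fst s) (previous s) (last_estimate s) z - g_X (fst s)))\<^sup>2) else 0)"
  have [measurable]: "\<phi> \<in> borel_measurable (borel \<Otimes>\<^sub>M (\<Pi>\<^sub>M i\<in>{..<batch_size k}. P))"
    unfolding \<phi>_def case_prod_beta using estimator_error_measurable[of k] unfolding case_prod_beta by measurable
  have "err_sq j k = (\<integral>\<^sup>+\<omega>. \<phi> (state (attempt_array j \<omega>) k, \<lambda>i\<in>{..<batch_size k}. attempt_array j \<omega> k i) \<partial>M)"
    unfolding err_sq_def
    by (rule nn_integral_cong) (auto simp: \<phi>_def estimator_restrict state_Suc_in(1) iterate_def[symmetric])
  also have "\<dots> = (\<integral>\<^sup>+\<omega>. \<integral>\<^sup>+y. \<phi> (state (attempt_array j \<omega>) k, y) \<partial>(\<Pi>\<^sub>M i\<in>{..<batch_size k}. P) \<partial>M)"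
    by (rule nn_integral_history_batch) (use k in simp_all)
  also have "\<dots> \<le> (\<integral>\<^sup>+\<omega>. ennreal ((sig_f q)\<^sup>2 / real B) \<partial>M)"
  proof (rule nn_integral_mono)
    fix \<omega>
    show "(\<integral>\<^sup>+y. \<phi> (state (attempt_array j \<omega>) k, y) \<partial>(\<Pi>\<^sub>M i\<in>{..<batch_size k}. P)) \<le> ennreal ((sig_f q)\<^sup>2 / real B)"
      using estimator_error_start[OF k(2)] by (cases "fst (state (attempt_array j \<omega>) k) \<in> X") (simp_all add: \<phi>_def)
  qed
  also have "\<dots> = ennreal ((sig_f q)\<^sup>2 / real B)" by (simp add: emeasure_space_1)
  finally show ?thesis .
qed

lemma err_sq_step:
  assumes k: "Suc k < K" "Suc k mod Q \<noteq> 0"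
  shows "err_sq j (Suc k) \<le> err_sq j k + ennreal ((L_s q)\<^sup>2 / real b) * move_sq j k"
proof -
  \<comment> \<open>For the states of the chain the second guard follows from the first by
    \<open>prev_in\<close>, but \<open>\<phi>\<close> ranges over arbitrary states, where the oracle
    bounds need both points in \<open>X\<close>.\<close>
  define \<phi> where "\<phi> = (\<lambda>(s, z). if fst s \<in> X \<and> previous s \<in> X
    then ennreal ((norm (estimator (Suc k) (fst s) (previous s) (last_estimate s) z - g_X (fst s)))\<^sup>2) else 0)"
  have [measurable]: "\<phi> \<in> borel_measurable (borel \<Otimes>\<^sub>M (\<Pi>\<^sub>M i\<in>{..<batch_size (Suc k)}. P))"
    unfolding \<phi>_def case_prod_beta using estimator_error_measurable[of "Suc k"] unfolding case_prod_beta by measurable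
  have prev_in: "iterate (attempt_array j \<omega>) k \<in> X" "previous (state (attempt_array j \<omega>) (Suc k)) = iterate (attempt_array j \<omega>) k"
    if "iterate (attempt_array j \<omega>) (Suc k) \<in> X" for \<omega>
    using in_before[OF that, of k] state_Suc_in(4) by auto
  have "err_sq j (Suc k) = (\<integral>\<^sup>+\<omega>. \<phi> (state (attempt_array j \<omega>) (Suc k), \<lambda>i\<in>{..<batch_size (Suc k)}. attempt_array j \<omega> (Suc k) i) \<partial>M)"
    unfolding err_sq_def
    by (rule nn_integral_cong)
       (auto simp: \<phi>_def estimator_restrict state_Suc_in(1) iterate_def[symmetric] prev_in simp del: state.simps)
  also have "\<dots> = (\<integral>\<^sup>+\<omega>. \<integral>\<^sup>+y. \<phi> (state (attempt_array j \<omega>) (Suc k), y) \<partial>(\<Pi>\<^sub>M i\<in>{..<batch_size (Suc k)}. P) \<partial>M)"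
    by (rule nn_integral_history_batch) (use k in simp_all)
  \<comment> \<open>Enlarges the event from being in \<open>X\<close> at \<open>Suc k\<close> to
    being in \<open>X\<close> at \<open>k\<close>, so that the right-hand side has the indicators of
    the previous index.\<close>
  also have "\<dots> \<le> (\<integral>\<^sup>+\<omega>. (if iterate (attempt_array j \<omega>) k \<in> X then ennreal ((norm (estimate (attempt_array j \<omega>) k - g_X (iterate (attempt_array j \<omega>) k)))\<^sup>2) else 0)
      + ennreal ((L_s q)\<^sup>2 / real b) * (if iterate (attempt_array j \<omega>) k \<in> X then ennreal ((norm (displacement (attempt_array j \<omega>) k))\<^sup>2) else 0) \<partial>M)"
  proof (rule nn_integral_mono)
    fix \<omega>
    let ?s = "state (attempt_array j \<omega>) (Suc k)"
    show "(\<integral>\<^sup>+y. \<phi> (?s, y) \<partial>(\<Pi>\<^sub>M i\<in>{..<batch_size (Suc k)}. P))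
      \<le> (if iterate (attempt_array j \<omega>) k \<in> X then ennreal ((norm (estimate (attempt_array j \<omega>) k - g_X (iterate (attempt_array j \<omega>) k)))\<^sup>2) else 0)
      + ennreal ((L_s q)\<^sup>2 / real b) * (if iterate (attempt_array j \<omega>) k \<in> X then ennreal ((norm (displacement (attempt_array j \<omega>) k))\<^sup>2) else 0)"
    proof (cases "fst ?s \<in> X \<and> previous ?s \<in> X")
      case True
      then have "iterate (attempt_array j \<omega>) (Suc k) \<in> X" by (simp only: iterate_def)
      note * = prev_in[OF this]
      have "(\<integral>\<^sup>+y. \<phi> (?s, y) \<partial>(\<Pi>\<^sub>M i\<in>{..<batch_size (Suc k)}. P))
        \<le> ennreal ((norm (last_estimate ?s - g_X (previous ?s)))\<^sup>2) + ennreal ((L_s q)\<^sup>2 / real b) * ennreal ((norm (fst ?s - previous ?s))\<^sup>2)"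
        using estimator_error_step[OF k(2), of "fst ?s" "previous ?s" "last_estimate ?s"] True by (simp add: \<phi>_def del: state.simps)
      then show ?thesis using * by (simp add: estimate_def displacement_def iterate_def del: state.simps)
    next
      case False
      then have "\<And>y. \<phi> (?s, y) = 0" by (auto simp: \<phi>_def simp del: state.simps)
      then show ?thesis by (simp del: state.simps)
    qed
  qed
  also have "\<dots> = err_sq j k + ennreal ((L_s q)\<^sup>2 / real b) * move_sq j k"
    unfolding err_sq_def move_sq_def using k by (subst nn_integral_add) (auto simp: nn_integral_cmult)
  finally show ?thesis .
qed

end

lemma ennreal_sum_if:
  assumes "\<And>k. 0 \<le> a k"
  shows "ennreal (\<Sum>k\<in>S. if p k then a k else 0) = (\<Sum>k\<in>S. if p k then ennreal (a k) else 0)"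
proof -
  have "ennreal (\<Sum>k\<in>S. if p k then a k else 0) = (\<Sum>k\<in>S. ennreal (if p k then a k else 0))"
    by (rule sum_ennreal[symmetric]) (simp add: assms)
  also have "\<dots> = (\<Sum>k\<in>S. if p k then ennreal (a k) else 0)" by (rule sum.cong) simp_all
  finally show ?thesis .
qed

text \<open>Weighting \<open>M\<close> by \<open>E\<close> merely rescales the law of
  \<open>\<Xi>\<close>; the identity for events thus extends to every nonnegative Borel
  \<open>G\<close>.\<close>

lemma (in prob_space) nn_integral_indep_indicator:
  assumes E [measurable]: "E \<in> sets M" and \<Xi> [measurable]: "\<Xi> \<in> measurable M N" and G [measurable]: "G \<in> borel_measurable N"
    and ind: "\<And>A. A \<in> sets N \<Longrightarrow> prob (E \<inter> (\<Xi> -` A \<inter> space M)) = prob E * prob (\<Xi> -` A \<inter> space M)"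
  shows "(\<integral>\<^sup>+\<omega>. indicator E \<omega> * G (\<Xi> \<omega>) \<partial>M) = emeasure M E * (\<integral>\<^sup>+\<omega>. G (\<Xi> \<omega>) \<partial>M)"
proof -
  have "distr (density M (indicator E)) N \<Xi> = scale_measure (emeasure M E) (distr M N \<Xi>)"
  proof (rule measure_eqI)
    fix A assume "A \<in> sets (distr (density M (indicator E)) N \<Xi>)"
    then have A [measurable]: "A \<in> sets N" by simp
    have A': "\<Xi> -` A \<inter> space M \<in> sets M" by measurable
    have "emeasure (distr (density M (indicator E)) N \<Xi>) A = emeasure (density M (indicator E)) (\<Xi> -` A \<inter> space M)"
      by (simp add: emeasure_distr)
    also have "\<dots> = (\<integral>\<^sup>+\<omega>. indicator E \<omega> * indicator (\<Xi> -` A \<inter> space M) \<omega> \<partial>M)"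
      using A' by (intro emeasure_density) auto
    also have "\<dots> = (\<integral>\<^sup>+\<omega>. indicator (E \<inter> (\<Xi> -` A \<inter> space M)) \<omega> \<partial>M)"
      by (simp only: indicator_inter_arith)
    also have "\<dots> = emeasure M (E \<inter> (\<Xi> -` A \<inter> space M))"
      using A' E by (intro nn_integral_indicator) auto
    also have "\<dots> = emeasure M E * emeasure M (\<Xi> -` A \<inter> space M)"
      using ind[OF A] by (simp add: emeasure_eq_measure ennreal_mult)
    also have "\<dots> = emeasure (scale_measure (emeasure M E) (distr M N \<Xi>)) A"
      by (simp add: emeasure_distr)
    finally show "emeasure (distr (density M (indicator E)) N \<Xi>) A
      = emeasure (scale_measure (emeasure M E) (distr M N \<Xi>)) A" .
  qed simp
  then have "(\<integral>\<^sup>+y. G y \<partial>distr (density M (indicator E)) N \<Xi>) = (\<integral>\<^sup>+y. G y \<partial>scale_measure (emeasure M E) (distr M N \<Xi>))"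
    by simp
  then show ?thesis
    by (simp add: nn_integral_distr nn_integral_density nn_integral_scale_measure)
qed

section \<open>Boundedness and expectations of the stopped sums\<close>

context restart
begin

lemma err_move_measurable [measurable]:
  "(\<lambda>\<omega>. err_sum K (attempt_array j \<omega>)) \<in> borel_measurable M" "(\<lambda>\<omega>. move_sum K (attempt_array j \<omega>)) \<in> borel_measurable M"
  unfolding err_sum_def move_sum_def by measurable

lemma err_move_nonneg: "0 \<le> err_sum K z" "0 \<le> move_sum K z"
  unfolding err_sum_def move_sum_def by (auto intro!: sum_nonneg)

lemma err_sum_bounded: "err_sum K z \<le> real K * (2 * G_f q)\<^sup>2"
proof -
  have "err_sum K z \<le> (\<Sum>k<K. (2 * G_f q)\<^sup>2)"
    unfolding err_sum_def
  proof (rule sum_mono)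
    fix k
    show "(if iterate z k \<in> X then (norm (clipped_estimate z k - g_X (iterate z k)))\<^sup>2 else 0) \<le> (2 * G_f q)\<^sup>2"
    proof (cases "iterate z k \<in> X")
      case True
      then have "norm (clipped_estimate z k - g_X (iterate z k)) \<le> 2 * G_f q"
        using norm_triangle_ineq4[of "clipped_estimate z k" "g (iterate z k)"] norm_projection_le[of "estimate z k"] grad_bound[of "iterate z k"]
          X_subset_U by (auto simp: g_X_def clipped_estimate_def)
      from power_mono[OF this, of 2] show ?thesis using True by simp
    qed simp
  qed
  then show ?thesis by simp
qed

lemma move_sum_bounded: "move_sum K z \<le> real K * \<Delta>\<^sup>2"
proof -
  have "move_sum K z \<le> (\<Sum>k<K. \<Delta>\<^sup>2)"
    unfolding move_sum_def by (intro sum_mono) (auto intro!: power_mono dd_bound)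
  then show ?thesis by simp
qed

lemma err_move_integrable: "integrable M (\<lambda>\<omega>. err_sum K (attempt_array j \<omega>))" "integrable M (\<lambda>\<omega>. move_sum K (attempt_array j \<omega>))"
proof -
  show "integrable M (\<lambda>\<omega>. err_sum K (attempt_array j \<omega>))"
    by (rule integrable_const_bound[where B="real K * (2 * G_f q)\<^sup>2"])
       (use err_sum_bounded err_move_nonneg in simp_all)
  show "integrable M (\<lambda>\<omega>. move_sum K (attempt_array j \<omega>))"
    by (rule integrable_const_bound[where B="real K * \<Delta>\<^sup>2"])
       (use move_sum_bounded err_move_nonneg in simp_all)
qed

lemma nn_integral_err_sum_le: "(\<integral>\<^sup>+\<omega>. ennreal (err_sum K (attempt_array j \<omega>)) \<partial>M) \<le> (\<Sum>k<K. err_sq j k)"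
proof -
  have "(\<integral>\<^sup>+\<omega>. ennreal (err_sum K (attempt_array j \<omega>)) \<partial>M)
      = (\<integral>\<^sup>+\<omega>. (\<Sum>k<K. if iterate (attempt_array j \<omega>) k \<in> X then ennreal ((norm (clipped_estimate (attempt_array j \<omega>) k - g_X (iterate (attempt_array j \<omega>) k)))\<^sup>2) else 0) \<partial>M)"
    unfolding err_sum_def by (subst ennreal_sum_if) simp_all
  also have "\<dots> \<le> (\<integral>\<^sup>+\<omega>. (\<Sum>k<K. if iterate (attempt_array j \<omega>) k \<in> X then ennreal ((norm (estimate (attempt_array j \<omega>) k - g_X (iterate (attempt_array j \<omega>) k)))\<^sup>2) else 0) \<partial>M)"
    using X_subset_U
    by (intro nn_integral_mono sum_mono) (auto simp: clipped_estimate_def g_X_def intro!: ennreal_leI power_mono projection_nearer)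
  also have "\<dots> = (\<Sum>k<K. err_sq j k)"
    unfolding err_sq_def by (rule nn_integral_sum) simp
  finally show ?thesis .
qed

lemma nn_integral_move_sum: "(\<integral>\<^sup>+\<omega>. ennreal (move_sum K (attempt_array j \<omega>)) \<partial>M) = (\<Sum>k<K. move_sq j k)"
proof -
  have "(\<integral>\<^sup>+\<omega>. ennreal (move_sum K (attempt_array j \<omega>)) \<partial>M)
      = (\<integral>\<^sup>+\<omega>. (\<Sum>k<K. if iterate (attempt_array j \<omega>) k \<in> X then ennreal ((norm (displacement (attempt_array j \<omega>) k))\<^sup>2) else 0) \<partial>M)"
    unfolding move_sum_def by (subst ennreal_sum_if) simp_all
  also have "\<dots> = (\<Sum>k<K. move_sq j k)"
    unfolding move_sq_def by (rule nn_integral_sum) simp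
  finally show ?thesis .
qed

end

section \<open>One attempt with the prescribed batch sizes\<close>

locale restart_tuned = restart +
  fixes \<delta> :: real
  assumes K: "2 \<le> K" and BK: "B = K" and b_large: "2 * D_1 q * (L_s q)\<^sup>2 * real Q \<le> real b"
    and \<delta>: "0 < \<delta>" "\<delta> < 1" and S_subset: "S_st q f c x0 \<delta> \<subseteq> X"
begin

text \<open>With \<open>e\<close> and \<open>m\<close> the two expectations,
  \<open>e \<le> sig_f\<^sup>2 + m / (2 * D_1)\<close> and \<open>m \<le> D_0 + D_1 * e\<close>.
  Substitution leaves \<open>e / 2\<close> on the right; moving it over gives
  \<open>Gamma_e\<close>, and inserting that gives \<open>Gamma_p\<close>.\<close>

lemma expected_err_le: "expectation (\<lambda>\<omega>. err_sum K (attempt_array j \<omega>)) \<le> Gamma_e q f x0"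
  and expected_move_le: "expectation (\<lambda>\<omega>. move_sum K (attempt_array j \<omega>)) \<le> Gamma_p q f x0"
proof -
  define e m t where "e = expectation (\<lambda>\<omega>. err_sum K (attempt_array j \<omega>))"
    and "m = expectation (\<lambda>\<omega>. move_sum K (attempt_array j \<omega>))" and "t = (L_s q)\<^sup>2 / real b"
  have nn: "0 \<le> e" "0 \<le> m" "0 \<le> t" unfolding e_def m_def t_def using err_move_nonneg by simp_all
  have e: "(\<integral>\<^sup>+\<omega>. ennreal (err_sum K (attempt_array j \<omega>)) \<partial>M) = ennreal e"
    and m: "(\<integral>\<^sup>+\<omega>. ennreal (move_sum K (attempt_array j \<omega>)) \<partial>M) = ennreal m"
    unfolding e_def m_def using err_move_integrable err_move_nonneg by (simp_all add: nn_integral_eq_integral)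
  have "ennreal e \<le> (\<Sum>k<K. err_sq j k)" using nn_integral_err_sum_le[of j] e by simp
  also have "\<dots> \<le> of_nat K * ennreal ((sig_f q)\<^sup>2 / real B) + ennreal t * of_nat Q * (\<Sum>k<K. move_sq j k)"
    unfolding t_def by (rule block_recursion_sum_le) (use batch_pos err_sq_start err_sq_step in auto)
  \<comment> \<open>Here \<open>B = K\<close> matters: the \<open>K\<close> initial variances of
    size \<open>sig_f\<^sup>2 / B\<close> add up to a single \<open>sig_f\<^sup>2\<close>.\<close>
  also have "\<dots> = ennreal ((sig_f q)\<^sup>2 + t * real Q * m)"
    unfolding nn_integral_move_sum[symmetric] m using nn K
    by (simp add: BK ennreal_of_nat_eq_real_of_nat ennreal_mult[symmetric] ennreal_plus[symmetric] del: ennreal_plus)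
  finally have "e \<le> (sig_f q)\<^sup>2 + t * real Q * m"
    using nn by (subst (asm) ennreal_le_iff) auto
  also have "t * real Q * m \<le> 1 / (2 * D_1 q) * m"
  proof (rule mult_right_mono[OF _ nn(2)])
    \<comment> \<open>The requirement that determines the size of \<open>b\<close>.\<close>
    show "t * real Q \<le> 1 / (2 * D_1 q)"
      unfolding t_def using b_large D_1_pos batch_pos by (simp add: field_simps)
  qed
  finally have em: "e \<le> (sig_f q)\<^sup>2 + m / (2 * D_1 q)" by simp
  have "m \<le> expectation (\<lambda>\<omega>. D_0 q f x0 + D_1 q * err_sum K (attempt_array j \<omega>))"
    unfolding m_def by (intro integral_mono move_sum_le) (use err_move_integrable in simp_all)
  also have "\<dots> = D_0 q f x0 + D_1 q * e"
    unfolding e_def using err_move_integrable by (simp add: prob_space)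
  finally have me: "m \<le> D_0 q f x0 + D_1 q * e" .
  then have "m / (2 * D_1 q) \<le> D_0 q f x0 / D_1 q / 2 + e / 2"
    using D_1_pos by (simp add: field_simps)
  moreover have "a \<le> 2 * s + d" if "a \<le> s + w" "w \<le> d / 2 + a / 2" for a s w d :: real
    using that by linarith
  ultimately have "e \<le> Gamma_e q f x0" unfolding Gamma_e_def using em by blast
  have "m \<le> Gamma_p q f x0"
  proof -
    have "D_1 q * e \<le> D_1 q * Gamma_e q f x0" using \<open>e \<le> Gamma_e q f x0\<close> D_1_pos by simp
    also have "\<dots> = 2 * D_1 q * (sig_f q)\<^sup>2 + D_0 q f x0"
      unfolding Gamma_e_def using D_1_pos by (simp add: field_simps)
    finally show ?thesis using me unfolding Gamma_p_def by linarith
  qed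
  with \<open>e \<le> Gamma_e q f x0\<close> show "expectation (\<lambda>\<omega>. err_sum K (attempt_array j \<omega>)) \<le> Gamma_e q f x0"
    "expectation (\<lambda>\<omega>. move_sum K (attempt_array j \<omega>)) \<le> Gamma_p q f x0" by (simp_all add: e_def m_def)
qed

lemma rejection_prob_le: "emeasure M {\<omega> \<in> space M. iterate (attempt_array j \<omega>) K \<notin> X} \<le> ennreal \<delta>"
proof -
  have "emeasure M {\<omega> \<in> space M. iterate (attempt_array j \<omega>) K \<notin> X} = (\<integral>\<^sup>+\<omega>. indicator {\<omega> \<in> space M. iterate (attempt_array j \<omega>) K \<notin> X} \<omega> \<partial>M)"
    by (rule nn_integral_indicator[symmetric]) measurable
  also have "\<dots> \<le> (\<integral>\<^sup>+\<omega>. ennreal (\<delta> / Gamma_e q f x0 * err_sum K (attempt_array j \<omega>)) \<partial>M)"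
  proof (rule nn_integral_mono)
    fix \<omega>
    show "indicator {\<omega> \<in> space M. iterate (attempt_array j \<omega>) K \<notin> X} \<omega> \<le> ennreal (\<delta> / Gamma_e q f x0 * err_sum K (attempt_array j \<omega>))"
    proof (cases "iterate (attempt_array j \<omega>) K \<notin> X")
      case True
      then have "1 \<le> \<delta> / Gamma_e q f x0 * err_sum K (attempt_array j \<omega>)"
        using exit_err_sum[OF S_subset \<delta>(1) True] Gamma_e_pos by (simp add: field_simps)
      then have "ennreal 1 \<le> ennreal (\<delta> / Gamma_e q f x0 * err_sum K (attempt_array j \<omega>))" by (rule ennreal_leI)
      then show ?thesis by (simp add: indicator_def)
    qed (simp add: indicator_def)
  qed
  also have "\<dots> = ennreal (\<delta> / Gamma_e q f x0 * expectation (\<lambda>\<omega>. err_sum K (attempt_array j \<omega>)))"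
    using err_move_integrable(1)[of j] err_move_nonneg \<delta> Gamma_e_pos
    by (subst nn_integral_eq_integral) auto
  also have "\<dots> \<le> ennreal \<delta>"
  proof (rule ennreal_leI)
    have "\<delta> / Gamma_e q f x0 * expectation (\<lambda>\<omega>. err_sum K (attempt_array j \<omega>)) \<le> \<delta> / Gamma_e q f x0 * Gamma_e q f x0"
      using expected_err_le[of j] \<delta> Gamma_e_pos by (intro mult_left_mono) auto
    then show "\<delta> / Gamma_e q f x0 * expectation (\<lambda>\<omega>. err_sum K (attempt_array j \<omega>)) \<le> \<delta>" using Gamma_e_pos by simp
  qed
  finally show ?thesis .
qed

text \<open>A total Borel substitute for the squared residual, equal to it on
  \<open>X\<close>.\<close>

definition "res_sq y m = (norm (g_X y + J_X y *v m))\<^sup>2 + (norm (c_U y))\<^sup>2"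

lemma res_sq_eq: "y \<in> X \<Longrightarrow> res_sq y m = (kkt_residual f c y m)\<^sup>2"
  using X_subset_U by (auto simp: res_sq_def kkt_residual_def g_X_def J_X_def c_U_def)

lemma res_sq_measurable [measurable (raw)]:
  assumes [measurable]: "a \<in> borel_measurable N" "m \<in> borel_measurable N"
  shows "(\<lambda>w. res_sq (a w) (m w)) \<in> borel_measurable N"
  unfolding res_sq_def by measurable

text \<open>The pathwise residual bound applies on acceptance; on rejection the integrand is zero.
  No division by the acceptance probability occurs, as \<open>1 - \<delta>\<close> enters only
  through the restart series.\<close>

lemma expected_residual_le:
  "(\<integral>\<^sup>+\<omega>. (if iterate (attempt_array j \<omega>) K \<in> X then (\<Sum>k=1..<K. ennreal (res_sq (iterate (attempt_array j \<omega>) (k + 1)) (multiplier (attempt_array j \<omega>) (k + 1)))) else 0) \<partial>M)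
    \<le> ennreal (C_st q f x0)"
proof -
  have "(\<integral>\<^sup>+\<omega>. (if iterate (attempt_array j \<omega>) K \<in> X then (\<Sum>k=1..<K. ennreal (res_sq (iterate (attempt_array j \<omega>) (k + 1)) (multiplier (attempt_array j \<omega>) (k + 1)))) else 0) \<partial>M)
    \<le> (\<integral>\<^sup>+\<omega>. ennreal (2 * C_R_st q * (move_sum K (attempt_array j \<omega>) + err_sum K (attempt_array j \<omega>))) \<partial>M)"
  proof (rule nn_integral_mono)
    fix \<omega>
    show "(if iterate (attempt_array j \<omega>) K \<in> X then (\<Sum>k=1..<K. ennreal (res_sq (iterate (attempt_array j \<omega>) (k + 1)) (multiplier (attempt_array j \<omega>) (k + 1)))) else 0)
      \<le> ennreal (2 * C_R_st q * (move_sum K (attempt_array j \<omega>) + err_sum K (attempt_array j \<omega>)))"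
    proof (cases "iterate (attempt_array j \<omega>) K \<in> X")
      case True
      have "(\<Sum>k=1..<K. ennreal (res_sq (iterate (attempt_array j \<omega>) (k + 1)) (multiplier (attempt_array j \<omega>) (k + 1))))
          = (\<Sum>k=1..<K. ennreal ((kkt_residual f c (iterate (attempt_array j \<omega>) (k + 1)) (multiplier (attempt_array j \<omega>) (k + 1)))\<^sup>2))"
        by (intro sum.cong refl arg_cong[where f=ennreal] res_sq_eq in_before[OF True]) auto
      also have "\<dots> = ennreal (\<Sum>k=1..<K. (kkt_residual f c (iterate (attempt_array j \<omega>) (k + 1)) (multiplier (attempt_array j \<omega>) (k + 1)))\<^sup>2)"
        by (rule sum_ennreal) simp
      also have "\<dots> \<le> ennreal (2 * C_R_st q * (move_sum K (attempt_array j \<omega>) + err_sum K (attempt_array j \<omega>)))"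
        by (rule ennreal_leI[OF accepted_residual_sum[OF True]])
      finally show ?thesis using True by simp
    qed simp
  qed
  also have "\<dots> = ennreal (2 * C_R_st q * (expectation (\<lambda>\<omega>. move_sum K (attempt_array j \<omega>)) + expectation (\<lambda>\<omega>. err_sum K (attempt_array j \<omega>))))"
    using err_move_integrable[of j] err_move_nonneg C_R_st_nonneg
    by (subst nn_integral_eq_integral) auto
  also have "\<dots> \<le> ennreal (C_st q f x0)"
  proof (rule ennreal_leI)
    show "2 * C_R_st q * (expectation (\<lambda>\<omega>. move_sum K (attempt_array j \<omega>)) + expectation (\<lambda>\<omega>. err_sum K (attempt_array j \<omega>)))
      \<le> C_st q f x0"
      unfolding C_st_def using expected_err_le[of j] expected_move_le[of j] C_R_st_nonneg
      by (intro mult_left_mono add_mono) auto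
  qed
  finally show ?thesis .
qed

lemma attempts_indep:
  "indep_vars (\<lambda>j. \<Pi>\<^sub>M t\<in>attempt_index j. P) attempt_samples UNIV"
  unfolding attempt_samples_def[abs_def]
  by (rule indep_vars_restrict[OF \<xi>_indep attempt_index_subset])
     (auto simp: disjoint_family_on_def attempt_index_def)

lemma it_mu_array_measurable [measurable]:
  assumes "k \<le> K" "attempt_index j \<subseteq> A"
  shows "(\<lambda>y. iterate (array j y) k) \<in> borel_measurable (\<Pi>\<^sub>M t\<in>A. P)"
    and "(\<lambda>y. multiplier (array j y) k) \<in> borel_measurable (\<Pi>\<^sub>M t\<in>A. P)"
proof -
  have [measurable]: "(\<lambda>y. state (array j y) k) \<in> borel_measurable (\<Pi>\<^sub>M t\<in>A. P)"
    by (rule state_array_measurable) (use assms in \<open>auto simp: in_attempt_index\<close>)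
  show "(\<lambda>y. iterate (array j y) k) \<in> borel_measurable (\<Pi>\<^sub>M t\<in>A. P)"
    "(\<lambda>y. multiplier (array j y) k) \<in> borel_measurable (\<Pi>\<^sub>M t\<in>A. P)"
    unfolding iterate_def multiplier_def by measurable
qed

lemma restart_bound:
  assumes Y: "\<And>j. Y j \<in> borel_measurable (\<Pi>\<^sub>M t\<in>attempt_index j. P)" and r: "0 \<le> r"
    and cost: "\<And>j. (\<integral>\<^sup>+\<omega>. Y j (attempt_samples j \<omega>) \<partial>M) \<le> ennreal r"
  shows "(\<integral>\<^sup>+\<omega>. (\<Sum>j. if \<forall>i<j. iterate (attempt_array i \<omega>) K \<notin> X then Y j (attempt_samples j \<omega>) else 0) \<partial>M) \<le> ennreal (r / (1 - \<delta>))"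
proof -
  have "(\<integral>\<^sup>+\<omega>. (\<Sum>j. if \<forall>i<j. iterate (array i (attempt_samples i \<omega>)) K \<notin> X then Y j (attempt_samples j \<omega>) else 0) \<partial>M)
    \<le> ennreal (r / (1 - \<delta>))"
  proof (rule restart_expectation_le[OF attempts_indep, where R="\<lambda>i y. iterate (array i y) K \<notin> X" and Y=Y])
    show "Measurable.pred (\<Pi>\<^sub>M t\<in>attempt_index j. P) (\<lambda>y. iterate (array j y) K \<notin> X)" for j
      using it_mu_array_measurable(1)[of K j "attempt_index j"] by simp
    show "emeasure M {\<omega> \<in> space M. iterate (array j (attempt_samples j \<omega>)) K \<notin> X} \<le> ennreal \<delta>" for j
      using rejection_prob_le[of j] by (simp add: attempt_array_def)
  qed (use \<delta> r Y cost in auto)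
  then show ?thesis by (simp add: attempt_array_def)
qed

end

section \<open>The restart procedure\<close>

text \<open>The run variables are tied to the samples only pointwise, so every claim about them is
  first rewritten on \<open>space M\<close> as one about the measurable chain.\<close>

locale restart_run = restart_tuned q U f c x0 l0 X P F gF Q B b M K \<xi> \<delta>
  for q U and f :: "real^'n \<Rightarrow> real" and c :: "real^'n \<Rightarrow> real^'m" and x0 l0 X
    and P :: "'x measure" and F gF Q B b and M :: "'w measure" and K \<xi> \<delta> +
  fixes kh :: "'w \<Rightarrow> nat" and x :: "'w \<Rightarrow> nat \<Rightarrow> nat \<Rightarrow> real^'n" and l :: "'w \<Rightarrow> nat \<Rightarrow> nat \<Rightarrow> real^'m"
    and h v p :: "'w \<Rightarrow> nat \<Rightarrow> nat \<Rightarrow> real^'n"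
  assumes randomness: "restart_randomness M P (sample_index K Q B b) K \<xi> kh"
    and runs: "\<And>\<omega> j. \<omega> \<in> space M \<Longrightarrow> attempt_run q c gF x0 l0 X K Q B b (\<lambda>k i. \<xi> (j, k, i) \<omega>)
         (x \<omega> j) (l \<omega> j) (h \<omega> j) (v \<omega> j) (p \<omega> j)"
begin

lemma state_raw: "k \<le> K \<Longrightarrow> state (\<lambda>k i. \<xi> (j, k, i) \<omega>) k = state (attempt_array j \<omega>) k"
  by (rule state_cong) (simp add: attempt_array_def array_def attempt_samples_def in_attempt_index)

lemma accepted_run: "\<omega> \<in> space M \<Longrightarrow> accepted X K (x \<omega> j) \<longleftrightarrow> iterate (attempt_array j \<omega>) K \<in> X"
  using accepted_iff[OF runs, of \<omega> j] state_raw[of K j \<omega>] by (simp add: iterate_def)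

lemma executed_run: "\<omega> \<in> space M \<Longrightarrow> executed X K (x \<omega> j) = {k. k < K \<and> iterate (attempt_array j \<omega>) k \<in> X}"
  using executed_eq[OF runs, of \<omega> j] state_raw[of _ j \<omega>] by (auto simp: iterate_def)

lemma accepted_pair:
  assumes "\<omega> \<in> space M" "iterate (attempt_array j \<omega>) K \<in> X" "k \<le> K"
  shows "x \<omega> j k = iterate (attempt_array j \<omega>) k" "l \<omega> j k = multiplier (attempt_array j \<omega>) k"
  using accepted_state[OF runs[OF assms(1)], of j k] state_raw[of K j \<omega>] state_raw[of k j \<omega>] assms
  by (simp_all add: iterate_def multiplier_def)

text \<open>One bound for all counts: \<open>a\<close> is charged once per attempt and
  \<open>w k\<close> per executed iteration, and an attempt executes at most all \<open>K\<close> of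
  them.\<close>

lemma expected_cost_le:
  assumes r: "real (a + (\<Sum>k<K. w k)) \<le> r"
  shows "expectation_le M (\<lambda>\<omega>. total_cost (\<lambda>j. accepted X K (x \<omega> j))
    (\<lambda>j. a + (\<Sum>k\<in>executed X K (x \<omega> j). w k))) (r / (1 - \<delta>))"
proof -
  define Y :: "nat \<Rightarrow> (nat \<times> nat \<times> nat \<Rightarrow> 'x) \<Rightarrow> ennreal"
    where "Y j y = of_nat a + (\<Sum>k<K. if iterate (array j y) k \<in> X then of_nat (w k) else 0)" for j y
  have Y [measurable]: "Y j \<in> borel_measurable (\<Pi>\<^sub>M t\<in>attempt_index j. P)" for j
  proof -
    have [measurable]: "k < K \<Longrightarrow> (\<lambda>y. iterate (array j y) k) \<in> borel_measurable (\<Pi>\<^sub>M t\<in>attempt_index j. P)" for k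
      by (rule it_mu_array_measurable) auto
    show ?thesis unfolding Y_def[abs_def] by measurable
  qed
  have eq: "total_cost (\<lambda>j. accepted X K (x \<omega> j)) (\<lambda>j. a + (\<Sum>k\<in>executed X K (x \<omega> j). w k))
      = (\<Sum>j. if \<forall>i<j. iterate (attempt_array i \<omega>) K \<notin> X then Y j (attempt_samples j \<omega>) else 0)"
    if \<omega>: "\<omega> \<in> space M" for \<omega>
  proof -
    have cost: "of_nat (a + (\<Sum>k\<in>executed X K (x \<omega> j). w k)) = Y j (attempt_samples j \<omega>)" for j
    proof -
      have "(\<Sum>k\<in>executed X K (x \<omega> j). w k) = (\<Sum>k<K. if iterate (attempt_array j \<omega>) k \<in> X then w k else 0)"
        unfolding executed_run[OF \<omega>] by (simp add: sum.If_cases Int_def)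
      then show ?thesis by (simp add: Y_def attempt_array_def of_nat_sum if_distrib[where f=of_nat] cong: if_cong)
    qed
    show ?thesis unfolding total_cost_def accepted_run[OF \<omega>] cost ..
  qed
  have "0 \<le> r" using r by (meson of_nat_0_le_iff order_trans)
  have "(\<integral>\<^sup>+\<omega>. (\<Sum>j. if \<forall>i<j. iterate (attempt_array i \<omega>) K \<notin> X then Y j (attempt_samples j \<omega>) else 0) \<partial>M) \<le> ennreal (r / (1 - \<delta>))"
  proof (rule restart_bound[OF Y \<open>0 \<le> r\<close>])
    fix j
    have "Y j y \<le> ennreal r" for y
    proof -
      have "Y j y \<le> of_nat a + (\<Sum>k<K. of_nat (w k))"
        unfolding Y_def by (intro add_left_mono sum_mono) simp
      also have "\<dots> = of_nat (a + (\<Sum>k<K. w k))" by simp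
      also have "\<dots> \<le> ennreal r" using r by (simp only: ennreal_of_nat_eq_real_of_nat ennreal_leI)
      finally show ?thesis .
    qed
    then have "(\<integral>\<^sup>+\<omega>. Y j (attempt_samples j \<omega>) \<partial>M) \<le> (\<integral>\<^sup>+\<omega>. ennreal r \<partial>M)" by (intro nn_integral_mono)
    then show "(\<integral>\<^sup>+\<omega>. Y j (attempt_samples j \<omega>) \<partial>M) \<le> ennreal r" by (simp add: emeasure_space_1)
  qed
  moreover have "(\<lambda>\<omega>. \<Sum>j. if \<forall>i<j. iterate (attempt_array i \<omega>) K \<notin> X then Y j (attempt_samples j \<omega>) else 0) \<in> borel_measurable M"
    by measurable
  ultimately show ?thesis
    unfolding expectation_le_def by (simp add: eq cong: measurable_cong nn_integral_cong)
qed

text \<open>With unit cost the total is the number of attempts, which would be infinite without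
  acceptance; its expectation is finite.\<close>

lemma terminates: "AE \<omega> in M. \<exists>j. accepted X K (x \<omega> j)"
proof -
  let ?T = "\<lambda>\<omega>. total_cost (\<lambda>j. accepted X K (x \<omega> j)) (\<lambda>j. 1)"
  have "expectation_le M ?T (1 / (1 - \<delta>))"
    using expected_cost_le[of 1 "\<lambda>_. 0" 1] by simp
  then have T: "?T \<in> borel_measurable M" "(\<integral>\<^sup>+\<omega>. ?T \<omega> \<partial>M) \<noteq> \<infinity>"
    by (auto simp: expectation_le_def top_unique)
  have "AE \<omega> in M. ?T \<omega> \<noteq> \<infinity>" by (rule nn_integral_noteq_infinite[OF T])
  then show ?thesis
  proof eventually_elim
    case (elim \<omega>)
    show ?case
    proof (rule ccontr)
      assume never: "\<nexists>j. accepted X K (x \<omega> j)"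
      then have T_eq: "?T \<omega> = (\<Sum>j. 1)" by (simp add: total_cost_def)
      obtain n where n: "?T \<omega> < of_nat n"
        using elim ennreal_Ex_less_of_nat[of "?T \<omega>"] by (auto simp: less_top)
      have "of_nat n = (\<Sum>j<n. (1::ennreal))" by simp
      also have "\<dots> \<le> (\<Sum>j. 1)" by (rule sum_le_suminf) auto
      finally show False using n T_eq by simp
    qed
  qed
qed

section \<open>The returned pair\<close>

definition "all_samples \<omega> = (\<lambda>t\<in>sample_index K Q B b. \<xi> t \<omega>)"

text \<open>A series with at most one nonzero term, that of the first accepted attempt. This form is
  visibly measurable and already has the shape of a restart cost.\<close>

definition "output_sq k y = (\<Sum>j. if \<forall>i<j. iterate (array i y) K \<notin> X
  then (if iterate (array j y) K \<in> X then ennreal (res_sq (iterate (array j y) (k + 1)) (multiplier (array j y) (k + 1))) else 0) else 0)"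

lemma state_all: "k \<le> K \<Longrightarrow> state (array j (all_samples \<omega>)) k = state (attempt_array j \<omega>) k"
  by (rule state_cong)
     (auto simp: attempt_array_def array_def attempt_samples_def all_samples_def in_attempt_index sample_index_def batch_size_def)

lemma it_mu_all:
  assumes "k \<le> K"
  shows "iterate (array j (all_samples \<omega>)) k = iterate (attempt_array j \<omega>) k" "multiplier (array j (all_samples \<omega>)) k = multiplier (attempt_array j \<omega>) k"
  using state_all[OF assms] by (simp_all add: iterate_def multiplier_def)

lemma all_samples_measurable [measurable]: "all_samples \<in> measurable M (\<Pi>\<^sub>M t\<in>sample_index K Q B b. P)"
  unfolding all_samples_def[abs_def] by (rule measurable_restrict) (rule \<xi>_measurable)

lemma output_sq_measurable [measurable]:
  assumes "k < K"
  shows "output_sq k \<in> borel_measurable (\<Pi>\<^sub>M t\<in>sample_index K Q B b. P)"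
proof -
  have [measurable]: "(\<lambda>y. iterate (array j y) K) \<in> borel_measurable (\<Pi>\<^sub>M t\<in>sample_index K Q B b. P)"
    "(\<lambda>y. iterate (array j y) (k + 1)) \<in> borel_measurable (\<Pi>\<^sub>M t\<in>sample_index K Q B b. P)"
    "(\<lambda>y. multiplier (array j y) (k + 1)) \<in> borel_measurable (\<Pi>\<^sub>M t\<in>sample_index K Q B b. P)" for j
    using assms by (auto intro!: it_mu_array_measurable attempt_index_subset)
  show ?thesis unfolding output_sq_def[abs_def] by measurable
qed

lemma returned_eq:
  assumes \<omega>: "\<omega> \<in> space M" and k: "k < K"
  shows "returned_sq_residual f c (\<lambda>j. accepted X K (x \<omega> j)) (x \<omega>) (l \<omega>) k = output_sq k (all_samples \<omega>)"
proof -
  define R where "R j = (iterate (attempt_array j \<omega>) K \<in> X)" for j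
  define Y where "Y j = ennreal (res_sq (iterate (attempt_array j \<omega>) (k + 1)) (multiplier (attempt_array j \<omega>) (k + 1)))" for j
  have out: "output_sq k (all_samples \<omega>) = (\<Sum>j. if \<forall>i<j. \<not> R i then (if R j then Y j else 0) else 0)"
    using k unfolding output_sq_def R_def Y_def by (simp add: it_mu_all cong: if_cong)
  show ?thesis
  proof (cases "\<exists>j. R j")
    case True
    define j where "j = (LEAST j. R j)"
    have j: "R j" "\<And>i. i < j \<Longrightarrow> \<not> R i"
      unfolding j_def using True by (auto intro: LeastI_ex dest: not_less_Least)
    have "(if \<forall>i<j'. \<not> R i then (if R j' then Y j' else 0) else 0) = (if j' = j then Y j else 0)" for j'
      using j by (cases j' j rule: linorder_cases) auto
    then have "output_sq k (all_samples \<omega>) = (\<Sum>j'. if j' = j then Y j else 0)" unfolding out by simp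
    also have "\<dots> = Y j" using sums_single[of j "\<lambda>_. Y j"] by (rule sums_unique[symmetric])
    finally have "output_sq k (all_samples \<omega>) = Y j" .
    moreover have "iterate (attempt_array j \<omega>) (k + 1) \<in> X" using in_before[of "attempt_array j \<omega>" K "k + 1"] j(1) k by (simp add: R_def)
    then have "Y j = ennreal ((kkt_residual f c (x \<omega> j (k + 1)) (l \<omega> j (k + 1)))\<^sup>2)"
      unfolding Y_def using accepted_pair[OF \<omega>, of j "k + 1"] j(1) k by (simp add: res_sq_eq R_def)
    ultimately show ?thesis
      using True unfolding returned_sq_residual_def accepted_run[OF \<omega>] R_def[symmetric] j_def[symmetric] Let_def by simp
  next
    case False
    then show ?thesis
      unfolding returned_sq_residual_def accepted_run[OF \<omega>] R_def[symmetric] out by auto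
  qed
qed

lemma kh_range: "\<omega> \<in> space M \<Longrightarrow> kh \<omega> \<in> {1..<K}"
  using randomness measurable_space[of kh M "count_space {1..K-1}" \<omega>] K by (auto simp: restart_randomness_def)

lemma kh_event:
  assumes "k \<in> {1..<K}"
  shows "kh -` {k} \<inter> space M \<in> sets M" "emeasure M (kh -` {k} \<inter> space M) = ennreal (1 / (real K - 1))"
    and "A \<in> sets (\<Pi>\<^sub>M t\<in>sample_index K Q B b. P) \<Longrightarrow>
      prob ((kh -` {k} \<inter> space M) \<inter> (all_samples -` A \<inter> space M))
        = prob (kh -` {k} \<inter> space M) * prob (all_samples -` A \<inter> space M)"
proof -
  let ?C = "count_space {1..K-1}"
  have kh: "kh \<in> measurable M ?C" and law: "distr M ?C kh = uniform_count_measure {1..K-1}"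
    and ind: "indep_set (sets (vimage_algebra (space M) kh ?C))
       (sets (vimage_algebra (space M) all_samples (\<Pi>\<^sub>M t\<in>sample_index K Q B b. P)))"
    using randomness unfolding restart_randomness_def all_samples_def[abs_def] by auto
  have k: "{k} \<in> sets ?C" using assms by auto
  show "kh -` {k} \<inter> space M \<in> sets M" using kh k by (rule measurable_sets)
  have "emeasure M (kh -` {k} \<inter> space M) = emeasure (uniform_count_measure {1..K-1}) {k}"
    unfolding law[symmetric] using kh k by (simp add: emeasure_distr)
  also have "\<dots> = ennreal (1 / (real K - 1))"
    using assms K by (subst emeasure_uniform_count_measure) (auto simp: of_nat_diff)
  finally show "emeasure M (kh -` {k} \<inter> space M) = ennreal (1 / (real K - 1))" .
  show "prob ((kh -` {k} \<inter> space M) \<inter> (all_samples -` A \<inter> space M))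
      = prob (kh -` {k} \<inter> space M) * prob (all_samples -` A \<inter> space M)"
    if A: "A \<in> sets (\<Pi>\<^sub>M t\<in>sample_index K Q B b. P)"
    by (rule indep_setD[OF ind in_vimage_algebra[OF k] in_vimage_algebra[OF A]])
qed

lemma C_st_nonneg: "0 \<le> C_st q f x0"
proof -
  have "0 \<le> Gamma_p q f x0" unfolding Gamma_p_def using D_0_pos D_1_pos by simp
  then show ?thesis unfolding C_st_def using Gamma_e_pos C_R_st_nonneg by simp
qed

text \<open>Summing over the output index first makes this a restart cost: an attempt pays its whole
  residual sum if accepted and nothing otherwise.\<close>

lemma expected_output_sum_le:
  "(\<integral>\<^sup>+\<omega>. (\<Sum>k=1..<K. output_sq k (all_samples \<omega>)) \<partial>M) \<le> ennreal (C_st q f x0 / (1 - \<delta>))"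
proof -
  define Y :: "nat \<Rightarrow> (nat \<times> nat \<times> nat \<Rightarrow> 'x) \<Rightarrow> ennreal" where "Y j y = (if iterate (array j y) K \<in> X
    then (\<Sum>k=1..<K. ennreal (res_sq (iterate (array j y) (k + 1)) (multiplier (array j y) (k + 1)))) else 0)" for j y
  have "(\<Sum>k=1..<K. output_sq k (all_samples \<omega>))
      = (\<Sum>j. if \<forall>i<j. iterate (attempt_array i \<omega>) K \<notin> X then Y j (attempt_samples j \<omega>) else 0)" for \<omega>
  proof -
    have "(\<Sum>k=1..<K. output_sq k (all_samples \<omega>)) = (\<Sum>k=1..<K. \<Sum>j. if \<forall>i<j. iterate (attempt_array i \<omega>) K \<notin> X
      then (if iterate (attempt_array j \<omega>) K \<in> X then ennreal (res_sq (iterate (attempt_array j \<omega>) (k + 1)) (multiplier (attempt_array j \<omega>) (k + 1))) else 0) else 0)"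
      unfolding output_sq_def by (rule sum.cong) (simp_all add: it_mu_all cong: if_cong)
    also have "\<dots> = (\<Sum>j. \<Sum>k=1..<K. if \<forall>i<j. iterate (attempt_array i \<omega>) K \<notin> X
      then (if iterate (attempt_array j \<omega>) K \<in> X then ennreal (res_sq (iterate (attempt_array j \<omega>) (k + 1)) (multiplier (attempt_array j \<omega>) (k + 1))) else 0) else 0)"
      by (rule suminf_sum[symmetric]) simp
    also have "\<dots> = (\<Sum>j. if \<forall>i<j. iterate (attempt_array i \<omega>) K \<notin> X then Y j (attempt_samples j \<omega>) else 0)"
      by (rule suminf_cong) (auto simp: Y_def attempt_array_def)
    finally show ?thesis .
  qed
  moreover have "(\<integral>\<^sup>+\<omega>. (\<Sum>j. if \<forall>i<j. iterate (attempt_array i \<omega>) K \<notin> X then Y j (attempt_samples j \<omega>) else 0) \<partial>M)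
    \<le> ennreal (C_st q f x0 / (1 - \<delta>))"
  proof (rule restart_bound[OF _ C_st_nonneg])
    fix j
    have [measurable]: "(\<lambda>y. iterate (array j y) k) \<in> borel_measurable (\<Pi>\<^sub>M t\<in>attempt_index j. P)"
      "(\<lambda>y. multiplier (array j y) k) \<in> borel_measurable (\<Pi>\<^sub>M t\<in>attempt_index j. P)" if "k \<le> K" for k
      using that by (auto intro!: it_mu_array_measurable)
    show "Y j \<in> borel_measurable (\<Pi>\<^sub>M t\<in>attempt_index j. P)"
      unfolding Y_def[abs_def] by measurable
    show "(\<integral>\<^sup>+\<omega>. Y j (attempt_samples j \<omega>) \<partial>M) \<le> ennreal (C_st q f x0)"
      unfolding Y_def attempt_array_def[symmetric] by (rule expected_residual_le)
  qed
  ultimately show ?thesis by simp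
qed

text \<open>Split along the finitely many values of \<open>kh\<close>: each has probability
  \<open>1 / (K - 1)\<close> and is independent of the samples, which determine the output at a
  fixed index.\<close>

lemma expected_returned_le:
  "expectation_le M (\<lambda>\<omega>. returned_sq_residual f c (\<lambda>j. accepted X K (x \<omega> j)) (x \<omega>) (l \<omega>) (kh \<omega>))
    (C_st q f x0 / ((1 - \<delta>) * (real K - 1)))"
proof -
  let ?ret = "\<lambda>\<omega>. returned_sq_residual f c (\<lambda>j. accepted X K (x \<omega> j)) (x \<omega>) (l \<omega>) (kh \<omega>)"
  let ?mix = "\<lambda>\<omega>. \<Sum>k=1..<K. indicator (kh -` {k} \<inter> space M) \<omega> * output_sq k (all_samples \<omega>)"
  have eq: "?ret \<omega> = ?mix \<omega>" if \<omega>: "\<omega> \<in> space M" for \<omega>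
  proof -
    have "?mix \<omega> = (\<Sum>k=1..<K. if k = kh \<omega> then output_sq (kh \<omega>) (all_samples \<omega>) else 0)"
      by (rule sum.cong) (use \<omega> in \<open>auto simp: indicator_def\<close>)
    also have "\<dots> = output_sq (kh \<omega>) (all_samples \<omega>)" using kh_range[OF \<omega>] by simp
    finally show ?thesis using returned_eq[OF \<omega>] kh_range[OF \<omega>] by simp
  qed
  have m [measurable]: "k \<in> {1..<K} \<Longrightarrow> kh -` {k} \<inter> space M \<in> sets M" for k by (rule kh_event(1))
  have term_m: "k \<in> {1..<K} \<Longrightarrow> (\<lambda>\<omega>. indicator (kh -` {k} \<inter> space M) \<omega> * output_sq k (all_samples \<omega>)) \<in> borel_measurable M" for k
  proof -
    assume k: "k \<in> {1..<K}"
    have "output_sq k \<in> borel_measurable (\<Pi>\<^sub>M t\<in>sample_index K Q B b. P)"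
      using k by (intro output_sq_measurable) simp
    then have "(\<lambda>\<omega>. output_sq k (all_samples \<omega>)) \<in> borel_measurable M"
      by (rule measurable_compose[OF all_samples_measurable])
    then show "(\<lambda>\<omega>. indicator (kh -` {k} \<inter> space M) \<omega> * output_sq k (all_samples \<omega>)) \<in> borel_measurable M"
      using m[OF k] by simp
  qed
  have "?mix \<in> borel_measurable M" by (rule borel_measurable_sum) (rule term_m)
  then have "?ret \<in> borel_measurable M" by (subst measurable_cong[OF eq])
  have "(\<integral>\<^sup>+\<omega>. ?ret \<omega> \<partial>M) = (\<integral>\<^sup>+\<omega>. ?mix \<omega> \<partial>M)" by (rule nn_integral_cong) (rule eq)
  also have "\<dots> = (\<Sum>k=1..<K. \<integral>\<^sup>+\<omega>. indicator (kh -` {k} \<inter> space M) \<omega> * output_sq k (all_samples \<omega>) \<partial>M)"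
    by (rule nn_integral_sum) (rule term_m)
  also have "\<dots> = (\<Sum>k=1..<K. ennreal (1 / (real K - 1)) * (\<integral>\<^sup>+\<omega>. output_sq k (all_samples \<omega>) \<partial>M))"
  proof (rule sum.cong[OF refl])
    fix k assume k: "k \<in> {1..<K}"
    show "(\<integral>\<^sup>+\<omega>. indicator (kh -` {k} \<inter> space M) \<omega> * output_sq k (all_samples \<omega>) \<partial>M)
      = ennreal (1 / (real K - 1)) * (\<integral>\<^sup>+\<omega>. output_sq k (all_samples \<omega>) \<partial>M)"
      unfolding kh_event(2)[OF k, symmetric]
      by (rule nn_integral_indep_indicator[OF kh_event(1)[OF k] all_samples_measurable output_sq_measurable kh_event(3)[OF k]])
         (use k in simp)
  qed
  also have "\<dots> = ennreal (1 / (real K - 1)) * (\<integral>\<^sup>+\<omega>. (\<Sum>k=1..<K. output_sq k (all_samples \<omega>)) \<partial>M)"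
    by (subst nn_integral_sum)
       (auto simp: sum_distrib_left intro!: measurable_compose[OF all_samples_measurable output_sq_measurable])
  also have "\<dots> \<le> ennreal (1 / (real K - 1)) * ennreal (C_st q f x0 / (1 - \<delta>))"
    by (intro mult_left_mono expected_output_sum_le) simp
  also have "\<dots> = ennreal (C_st q f x0 / ((1 - \<delta>) * (real K - 1)))"
    using K \<delta> C_st_nonneg by (simp add: ennreal_mult[symmetric] mult.commute)
  finally show ?thesis using \<open>?ret \<in> borel_measurable M\<close> by (simp add: expectation_le_def)
qed

end

text \<open>These are the block starts \<open>m * Q\<close> with \<open>m\<close> below
  \<open>K / Q\<close>; their number multiplies the large batch in the gradient count.\<close>

lemma card_multiples_below:
  assumes "0 < Q"
  shows "real (card {k. k < K \<and> k mod Q = 0}) \<le> of_int \<lceil>real K / real Q\<rceil>"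
proof -
  have "{k. k < K \<and> k mod Q = 0} \<subseteq> (\<lambda>m. m * Q) ` {..<nat \<lceil>real K / real Q\<rceil>}"
  proof
    fix k assume k: "k \<in> {k. k < K \<and> k mod Q = 0}"
    then obtain m where m: "k = m * Q" by (auto simp: mod_eq_0_iff_dvd dvd_def mult.commute)
    then have "real m * real Q < real K" using k by (simp add: of_nat_mult[symmetric] del: of_nat_mult)
    then have "real m < real K / real Q" using assms by (simp add: pos_less_divide_eq)
    then have "int m < \<lceil>real K / real Q\<rceil>" by (simp add: less_ceiling_iff)
    then show "k \<in> (\<lambda>m. m * Q) ` {..<nat \<lceil>real K / real Q\<rceil>}" using m by (auto simp: zless_nat_eq_int_zless)
  qed
  then have "card {k. k < K \<and> k mod Q = 0} \<le> card {..<nat \<lceil>real K / real Q\<rceil>}"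
    by (rule surj_card_le[rotated]) simp
  moreover have "0 \<le> \<lceil>real K / real Q\<rceil>"
  proof -
    have "(-1::real) < real K / real Q" by (rule less_le_trans[of _ 0]) simp_all
    then show ?thesis by simp
  qed
  ultimately have "real (card {k. k < K \<and> k mod Q = 0}) \<le> real (nat \<lceil>real K / real Q\<rceil>)"
    by (simp only: card_lessThan of_nat_le_iff)
  also have "\<dots> = of_int \<lceil>real K / real Q\<rceil>" by (rule of_nat_nat) fact
  finally show ?thesis .
qed

theorem corollary3p8:
  fixes f :: "real^'n \<Rightarrow> real" and c :: "real^'n \<Rightarrow> real^'m" and U :: "(real^'n) set"
    and P :: "'x measure" and F :: "real^'n \<Rightarrow> 'x \<Rightarrow> real" and gF :: "real^'n \<Rightarrow> 'x \<Rightarrow> real^'n"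
    and q :: consts_rec and x0 :: "real^'n" and l0 :: "real^'m"
  assumes "regularity q U f c"
    and "stochastic_oracle q U f P F gF"
    and "parameter_assumption q c x0 l0"
  shows "\<exists>C::real. C > 0 \<and>
    (\<forall>(K::nat) (\<delta>::real) (Q::nat) (B::nat) (b::nat) (X::(real^'n) set)
      (M::'w measure) \<xi> kh x l h v p.
      2 \<le> K \<and> 0 < \<delta> \<and> \<delta> < 1 \<and>
      B = K \<and> Q = nat \<lceil>sqrt (real K)\<rceil> \<and> b = max 1 (nat \<lceil>2 * D_1 q * (L_s q)\<^sup>2 * real Q\<rceil>) \<and>
      X \<in> sets borel \<and> x0 \<in> X \<and> S_st q f c x0 \<delta> \<subseteq> X \<and> nbhd (Delta_p q) X \<subseteq> U \<and>
      restart_randomness M P (sample_index K Q B b) K \<xi> kh \<and>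
      (\<forall>\<omega>\<in>space M. \<forall>j. attempt_run q c gF x0 l0 X K Q B b (\<lambda>k i. \<xi> (j, k, i) \<omega>)
         (x \<omega> j) (l \<omega> j) (h \<omega> j) (v \<omega> j) (p \<omega> j))
      \<longrightarrow>
      (let acc = (\<lambda>\<omega> j. accepted X K (x \<omega> j));
           iters = (\<lambda>\<omega> j. executed X K (x \<omega> j))
       in
         (AE \<omega> in M. \<exists>j. acc \<omega> j) \<and>
         expectation_le M (\<lambda>\<omega>. total_cost (acc \<omega>) (\<lambda>j. 1)) (1 / (1 - \<delta>)) \<and>
         expectation_le M (\<lambda>\<omega>. returned_sq_residual f c (acc \<omega>) (x \<omega>) (l \<omega>) (kh \<omega>))
           (C_st q f x0 / ((1 - \<delta>) * (real K - 1))) \<and>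
         expectation_le M (\<lambda>\<omega>. total_cost (acc \<omega>) (\<lambda>j. grad_cost Q B b (iters \<omega> j)))
           ((of_int \<lceil>real K / real Q\<rceil> * real B + 2 * real K * real b) / (1 - \<delta>)) \<and>
         \<comment> \<open>evaluations of \<open>c\<close>, including \<open>c x0\<close> once per attempt\<close>
         expectation_le M (\<lambda>\<omega>. total_cost (acc \<omega>) (\<lambda>j. 1 + card (iters \<omega> j))) (C * (real K / (1 - \<delta>))) \<and>
         \<comment> \<open>evaluations of the Jacobian, exact linear-system solves, and membership tests:
             one of each per executed iteration\<close>
         expectation_le M (\<lambda>\<omega>. total_cost (acc \<omega>) (\<lambda>j. card (iters \<omega> j))) (C * (real K / (1 - \<delta>)))))"
\<comment> \<open>The largest per-attempt count is \<open>1 + K\<close> evaluations of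
  \<open>c\<close>, at most \<open>2 * K\<close>.\<close>
proof (intro exI[of _ "2::real"] conjI allI impI, goal_cases)
  case 1
  show ?case by simp
next
  case (2 K \<delta> Q B b X M \<xi> kh x l h v p)
  then have K: "2 \<le> K" and \<delta>: "0 < \<delta>" "\<delta> < 1" and BK: "B = K" and Q: "Q = nat \<lceil>sqrt (real K)\<rceil>"
    and b: "b = max 1 (nat \<lceil>2 * D_1 q * (L_s q)\<^sup>2 * real Q\<rceil>)"
    and X: "X \<in> sets borel" "x0 \<in> X" "S_st q f c x0 \<delta> \<subseteq> X" "nbhd (Delta_p q) X \<subseteq> U"
    and rand: "restart_randomness M P (sample_index K Q B b) K \<xi> kh"
    and runs: "\<And>\<omega> j. \<omega> \<in> space M \<Longrightarrow> attempt_run q c gF x0 l0 X K Q B b (\<lambda>k i. \<xi> (j, k, i) \<omega>)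
         (x \<omega> j) (l \<omega> j) (h \<omega> j) (v \<omega> j) (p \<omega> j)"
    by blast+
  interpret M: prob_space M using rand by (simp add: restart_randomness_def)
  have Q_pos: "0 < Q" using K unfolding Q by simp
  have b_large: "2 * D_1 q * (L_s q)\<^sup>2 * real Q \<le> real b"
    unfolding b by (simp add: le_max_iff_disj) linarith
  interpret R: restart_run q U f c x0 l0 X P F gF Q B b M K \<xi> \<delta> kh x l h v p
    by unfold_locales
       (use assms X K BK Q_pos b b_large \<delta> rand runs in \<open>auto simp: restart_randomness_def\<close>)
  have attempts: "expectation_le M (\<lambda>\<omega>. total_cost (\<lambda>j. accepted X K (x \<omega> j)) (\<lambda>j. 1)) (1 / (1 - \<delta>))"
    using R.expected_cost_le[of 1 "\<lambda>_. 0" 1] by simp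
  have grads: "expectation_le M (\<lambda>\<omega>. total_cost (\<lambda>j. accepted X K (x \<omega> j)) (\<lambda>j. grad_cost Q B b (executed X K (x \<omega> j))))
      ((of_int \<lceil>real K / real Q\<rceil> * real B + 2 * real K * real b) / (1 - \<delta>))"
  proof -
    \<comment> \<open>Charging \<open>2 * b\<close> at block starts too separates the two terms of
      the stated bound.\<close>
    have "(\<Sum>k<K. if k mod Q = 0 then B else 2 * b) \<le> (\<Sum>k<K. (if k mod Q = 0 then B else 0) + 2 * b)"
      by (rule sum_mono) simp
    also have "\<dots> = card {k. k < K \<and> k mod Q = 0} * B + 2 * K * b"
      by (simp add: sum.distrib sum.If_cases Int_def)
    finally have "real (\<Sum>k<K. if k mod Q = 0 then B else 2 * b) \<le> real (card {k. k < K \<and> k mod Q = 0} * B + 2 * K * b)"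
      by (rule of_nat_mono)
    also have "\<dots> \<le> of_int \<lceil>real K / real Q\<rceil> * real B + 2 * real K * real b"
      using card_multiples_below[OF Q_pos, of K] by (simp add: mult_right_mono)
    finally show ?thesis
      using R.expected_cost_le[of 0 "\<lambda>k. if k mod Q = 0 then B else 2 * b"] by (simp add: grad_cost_def)
  qed
  have evals: "expectation_le M (\<lambda>\<omega>. total_cost (\<lambda>j. accepted X K (x \<omega> j)) (\<lambda>j. a + card (executed X K (x \<omega> j))))
      (2 * (real K / (1 - \<delta>)))" if "a \<le> 1" for a
    using R.expected_cost_le[of a "\<lambda>_. 1" "2 * real K"] that K by simp
  show ?case
    using R.terminates attempts R.expected_returned_le grads evals[of 1] evals[of 0] by (simp add: Let_def)
qed

end
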